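(* If \textsc{TriangleListing} for $t=m$ can be solved in $T(m)$ time, then \textsc{EdgeTriangleDetection} can be solved by a randomized Las Vegas algorithm in $\tilde O(T(m))$ time.
   Context: Graphs are undirected with $m$ edges and no isolated vertices; $\tilde O$ hides polylogarithmic factors. \textsc{EdgeTriangleDetection}: given a graph $G=(V,E)$, determine for every edge $e\in E$ whether some triangle of $G$ contains $e$. \textsc{TriangleListing}: given a graph $G$ and an integer $t$, output $t$ (distinct) triangles of $G$, or all triangles of $G$ if $G$ has fewer than $t$ triangles. *)

theory Defs
  imports "HOL-Probability.Probability" "HOL-Probability.Stream_Space" "HOL-Library.Landau_Symbols"
begin

section \<open>Random access machines\<close>

text \<open>
  Programs are structured RAM programs in three-address form.  A program has finitely many
  registers and finitely many arrays, both named by numbers occurring in its text; array cells are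
  addressed indirectly through registers.  Every executed instruction, every branch and every loop
  test takes one time unit.  The polynomial bound on all stored words, i.e. the restriction to words
  of \<open>O(log m)\<close> bits, is imposed in the definitions of solvability below, so that no
  wrap-around arithmetic is needed.
\<close>

datatype binop = Add | Sub | Mul | Div | Mod | Less | Equal | BitAnd | BitOr | BitXor | Shl | Shr

fun apply_binop :: "binop \<Rightarrow> nat \<Rightarrow> nat \<Rightarrow> nat" where
  "apply_binop Add a b = a + b"
| "apply_binop Sub a b = a - b"
| "apply_binop Mul a b = a * b"
| "apply_binop Div a b = a div b"
| "apply_binop Mod a b = a mod b"
| "apply_binop Less a b = of_bool (a < b)"
| "apply_binop Equal a b = of_bool (a = b)"
| "apply_binop BitAnd a b = semiring_bit_operations_class.and a b"
| "apply_binop BitOr a b = semiring_bit_operations_class.or a b"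
| "apply_binop BitXor a b = semiring_bit_operations_class.xor a b"
| "apply_binop Shl a b = push_bit b a"
| "apply_binop Shr a b = drop_bit b a"

datatype instr =
    Const nat nat          \<comment> \<open>\<open>x := constant\<close>\<close>
  | Op binop nat nat nat   \<comment> \<open>\<open>x := y op z\<close>\<close>
  | Load nat nat nat       \<comment> \<open>\<open>x := a[y]\<close>\<close>
  | Store nat nat nat      \<comment> \<open>\<open>a[x] := y\<close>\<close>
  | Coin nat               \<comment> \<open>\<open>x :=\<close> a fresh random bit\<close>
  | Out nat                \<comment> \<open>append \<open>x\<close> to the output\<close>
  | If nat "instr list" "instr list"
  | While nat "instr list"

type_synonym prog = "instr list"

record state =
  regs :: "nat \<Rightarrow> nat"
  mem :: "nat \<Rightarrow> nat \<Rightarrow> nat"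
  outp :: "nat list"
  coins :: "bool stream"

type_synonym config = "prog \<times> state"

definition set_reg :: "nat \<Rightarrow> nat \<Rightarrow> state \<Rightarrow> state" where
  "set_reg x v s = s\<lparr>regs := (regs s)(x := v)\<rparr>"

text \<open>The first component of a configuration is the program text that remains to be executed.\<close>

fun step :: "config \<Rightarrow> config" where
  "step ([], s) = ([], s)"
| "step (Const x v # p, s) = (p, set_reg x v s)"
| "step (Op f x y z # p, s) = (p, set_reg x (apply_binop f (regs s y) (regs s z)) s)"
| "step (Load x a y # p, s) = (p, set_reg x (mem s a (regs s y)) s)"
| "step (Store a x y # p, s) =
     (p, s\<lparr>mem := (mem s)(a := (mem s a)(regs s x := regs s y))\<rparr>)"
| "step (Coin x # p, s) = (p, (set_reg x (of_bool (shd (coins s))) s)\<lparr>coins := stl (coins s)\<rparr>)"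
| "step (Out x # p, s) = (p, s\<lparr>outp := outp s @ [regs s x]\<rparr>)"
| "step (If x p1 p2 # p, s) = ((if regs s x \<noteq> 0 then p1 else p2) @ p, s)"
| "step (While x q # p, s) = (if regs s x \<noteq> 0 then q @ While x q # p else p, s)"

definition after :: "nat \<Rightarrow> config \<Rightarrow> config" where
  "after k c = (step ^^ k) c"

definition halted :: "config \<Rightarrow> bool" where
  "halted c \<longleftrightarrow> fst c = []"

definition run_time :: "config \<Rightarrow> enat" where
  "run_time c = (INF k\<in>{k. halted (after k c)}. enat k)"

definition words_below :: "nat \<Rightarrow> config \<Rightarrow> bool" where
  "words_below B c \<longleftrightarrow>
     (\<forall>k. let s = snd (after k c) in (\<forall>x. regs s x < B) \<and> (\<forall>a i. mem s a i < B))"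

fun coin_free :: "instr \<Rightarrow> bool" where
  "coin_free (Coin x) = False"
| "coin_free (If x p q) = ((\<forall>i\<in>set p. coin_free i) \<and> (\<forall>i\<in>set q. coin_free i))"
| "coin_free (While x p) = (\<forall>i\<in>set p. coin_free i)"
| "coin_free _ = True"

definition deterministic :: "prog \<Rightarrow> bool" where
  "deterministic p \<longleftrightarrow> (\<forall>i\<in>set p. coin_free i)"

definition coin_tape :: "bool stream measure" where
  "coin_tape = stream_space (measure_pmf (bernoulli_pmf (1/2)))"


section \<open>Graphs and triangles\<close>

definition simple_graph :: "'v set \<Rightarrow> 'v set set \<Rightarrow> bool" where
  "simple_graph V E \<longleftrightarrow> finite V \<and> (\<forall>e\<in>E. e \<subseteq> V \<and> card e = 2)"

definition no_isolated :: "'v set \<Rightarrow> 'v set set \<Rightarrow> bool" where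
  "no_isolated V E \<longleftrightarrow> (\<forall>v\<in>V. \<exists>e\<in>E. v \<in> e)"

definition triangles :: "'v set set \<Rightarrow> 'v set set" where
  "triangles E = {{a, b, c} | a b c.
     a \<noteq> b \<and> b \<noteq> c \<and> a \<noteq> c \<and> {a, b} \<in> E \<and> {b, c} \<in> E \<and> {a, c} \<in> E}"

definition ends_of :: "nat \<times> nat \<Rightarrow> nat set" where
  "ends_of uv = {fst uv, snd uv}"

definition tri_of :: "nat \<times> nat \<times> nat \<Rightarrow> nat set" where
  "tri_of abc = {fst abc, fst (snd abc), snd (snd abc)}"

text \<open>
  Graphs are presented to programs by their edges in arbitrary order, each edge occurring once and
  in an arbitrary orientation, over the vertices \<open>0, \<dots>, n - 1\<close>.
\<close>

definition represents :: "nat \<Rightarrow> (nat \<times> nat) list \<Rightarrow> nat set set \<Rightarrow> bool" where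
  "represents n es E \<longleftrightarrow> simple_graph {..<n} E \<and> no_isolated {..<n} E \<and>
     distinct (map ends_of es) \<and> set (map ends_of es) = E"

text \<open>
  Numeric parameters are placed in registers 0, 1, ..., the endpoints of the edges in arrays 0
  and 1; everything else is zero.
\<close>

definition input :: "nat list \<Rightarrow> (nat \<times> nat) list \<Rightarrow> bool stream \<Rightarrow> state" where
  "input ps es \<omega> = \<lparr>
     regs = (\<lambda>x. if x < length ps then ps ! x else 0),
     mem = (\<lambda>a i. if i < length es then
                    (if a = 0 then fst (es ! i) else if a = 1 then snd (es ! i) else 0)
                  else 0),
     outp = [],
     coins = \<omega>\<rparr>"


section \<open>The two problems and their complexity\<close>

definition listing_correct :: "nat set set \<Rightarrow> nat \<Rightarrow> nat list \<Rightarrow> bool" where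
  "listing_correct E t ws \<longleftrightarrow> (\<exists>ts.
     ws = concat (map (\<lambda>(a, b, c). [a, b, c]) ts) \<and>
     distinct (map tri_of ts) \<and> set (map tri_of ts) \<subseteq> triangles E \<and>
     (length ts = t \<or> card (triangles E) < t \<and> set (map tri_of ts) = triangles E))"

definition detection_output :: "(nat \<times> nat) list \<Rightarrow> nat set set \<Rightarrow> nat list" where
  "detection_output es E = map (\<lambda>uv. of_bool (\<exists>\<Delta>\<in>triangles E. ends_of uv \<subseteq> \<Delta>)) es"

definition triangle_listing_solvable :: "(nat \<Rightarrow> nat) \<Rightarrow> (nat \<Rightarrow> real) \<Rightarrow> bool" where
  "triangle_listing_solvable t T \<longleftrightarrow> (\<exists>p d. deterministic p \<and>
     (\<forall>n es E \<omega>. represents n es E \<longrightarrow>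
        (let m = card E; c = (p, input [n, m, t m] es \<omega>) in
           words_below ((m + 2) ^ d) c \<and>
           (\<exists>k. real k \<le> T m \<and> halted (after k c) \<and>
                listing_correct E (t m) (outp (snd (after k c)))))))"

text \<open>
  Las Vegas: whenever the program halts its output is correct, and its expected running time is
  bounded (in particular it halts almost surely).
\<close>

definition las_vegas_edge_detection_solvable :: "(nat \<Rightarrow> real) \<Rightarrow> bool" where
  "las_vegas_edge_detection_solvable f \<longleftrightarrow> (\<exists>p d.
     \<forall>n es E. represents n es E \<longrightarrow>
        (let m = card E; c = (\<lambda>\<omega>. (p, input [n, m] es \<omega>)) in
           (\<forall>\<omega>. words_below ((m + 2) ^ d) (c \<omega>)) \<and>
           (\<forall>\<omega> k. halted (after k (c \<omega>)) \<longrightarrow>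
                outp (snd (after k (c \<omega>))) = detection_output es E) \<and>
           (\<integral>\<^sup>+ \<omega>. ennreal_of_enat (run_time (c \<omega>)) \<partial>coin_tape) \<le> ennreal (f m)))"

definition soft_O :: "(nat \<Rightarrow> real) \<Rightarrow> (nat \<Rightarrow> real) set" where
  "soft_O T = (\<Union>j::nat. O(\<lambda>m. T m * ln (real m) ^ j))"

end

(* Fix a tripartition A, B, C of the vertices and let the targets be the edges between A and B.
   Listing triangles of the tripartite graph and deleting every target once it is found certifies all
   targets as soon as fewer than m triangles are listed, but a target with many apexes in C could
   absorb many calls. So every vertex c gets a random level, geometrically distributed, and only the
   apexes of level at least r are used, for r decreasing to 0. A target that is still present at r has
   no apex of level above r, so all triangles listed through it have apexes of maximal level among its
   apexes; the expected number of these is at most 1, as is seen by flipping the coin that stopped the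
   level of such an apex. Each full call removes the m triangles it lists, so the expected number of
   full calls is at most 1 per stage. Comparing bits of vertex numbers gives polylogarithmically many
   tripartitions that separate the vertices of every triangle in every way.

   Nothing is known about how T varies with m, so the lister is only ever run on graphs with exactly m
   edges: discarded edges are replaced by isolated ones and the vertices are renumbered. That T is at
   least linear, which pays for the overhead, follows from the graph of (m - 1) div 2 triangles with a
   common edge. *)

theory Submission
  imports Defs "HOL-Library.Log_Nat"
begin

section \<open>Running programs\<close>

text \<open>The lister chooses the triangles, and its answers depend on the levels through all
  earlier calls, so the set of found edges cannot be conditioned on. The way out is a bound for
  every tape: \<open>stage_load x lev\<close> bounds the triangles of a stage whatever was found
  before, and the running time is at most \<open>detection_time lev\<close>, a function of the
  levels alone. All coins are flipped before the first call, so halting and correctness are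
  deterministic statements, and the expectation becomes a count over bit lists of length
  \<open>n * B\<close>. Levels are cut off at \<open>B\<close>, the bit length of n. At threshold r
  = B no earlier stage of the tripartition helps, and there is no stopping coin to flip; but a level
  reaches B with probability at most 2 ^ -B < 1 / n, so a union bound still leaves an expected load
  of at most one apex per target. Each of the \<open>Q\<close> stages ends with one call that is not
  full, so at most 2 Q + 1 rounds are expected. As \<open>Q\<close> is cubic in the bit length, the
  logarithm gets exponent 3.\<close>

lemma after_Suc: "after (Suc k) c = after k (step c)"
  by (simp add: after_def funpow_swap1)

lemma after_0: "after 0 c = c"
  by (simp add: after_def)

lemma after_Nil: "after k ([], s) = ([], s)"
  by (induction k) (simp_all add: after_0 after_Suc)

definition ok :: "nat \<Rightarrow> state \<Rightarrow> bool" where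
  "ok W s \<longleftrightarrow> (\<forall>x. regs s x < W) \<and> (\<forall>a i. mem s a i < W)"

text \<open>Loads and stores only move words already present, so the word bound has to be checked
  only where a value is created.\<close>

fun small_write :: "nat \<Rightarrow> instr \<Rightarrow> state \<Rightarrow> bool" where
  "small_write W (Const x v) s = (v < W)"
| "small_write W (Op f x y z) s = (apply_binop f (regs s y) (regs s z) < W)"
| "small_write W (Coin x) s = (1 < W)"
| "small_write W _ s = True"

text \<open>Total correctness with a step budget: \<open>Q\<close> is asked of the halted state, and
  running out of the budget is failure. Recursion on the budget makes the predicate well defined for
  loops, and checking every write on the way yields the word bound for all intermediate
  states.\<close>

fun wp :: "nat \<Rightarrow> nat \<Rightarrow> prog \<Rightarrow> (state \<Rightarrow> bool) \<Rightarrow> state \<Rightarrow> bool" where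
  "wp W \<tau> [] Q s = Q s"
| "wp W 0 (i # p) Q s = False"
| "wp W (Suc \<tau>) (i # p) Q s =
     (small_write W i s \<and> wp W \<tau> (fst (step (i # p, s))) Q (snd (step (i # p, s))))"

lemma regs_set_reg [simp]: "regs (set_reg x v s) = (regs s)(x := v)"
  and mem_set_reg [simp]: "mem (set_reg x v s) = mem s"
  and outp_set_reg [simp]: "outp (set_reg x v s) = outp s"
  and coins_set_reg [simp]: "coins (set_reg x v s) = coins s"
  by (simp_all add: set_reg_def)

lemma wp_simps [simp]:
  "wp W \<tau> (Const x v # p) Q s \<longleftrightarrow> 0 < \<tau> \<and> v < W \<and> wp W (\<tau> - 1) p Q (set_reg x v s)"
  "wp W \<tau> (Op f x y z # p) Q s \<longleftrightarrow> 0 < \<tau> \<and> apply_binop f (regs s y) (regs s z) < W \<and>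
     wp W (\<tau> - 1) p Q (set_reg x (apply_binop f (regs s y) (regs s z)) s)"
  "wp W \<tau> (Load x a y # p) Q s \<longleftrightarrow> 0 < \<tau> \<and> wp W (\<tau> - 1) p Q (set_reg x (mem s a (regs s y)) s)"
  "wp W \<tau> (Store a x y # p) Q s \<longleftrightarrow> 0 < \<tau> \<and>
     wp W (\<tau> - 1) p Q (s\<lparr>mem := (mem s)(a := (mem s a)(regs s x := regs s y))\<rparr>)"
  "wp W \<tau> (Coin x # p) Q s \<longleftrightarrow> 0 < \<tau> \<and> 1 < W \<and>
     wp W (\<tau> - 1) p Q ((set_reg x (of_bool (shd (coins s))) s)\<lparr>coins := stl (coins s)\<rparr>)"
  "wp W \<tau> (Out x # p) Q s \<longleftrightarrow> 0 < \<tau> \<and> wp W (\<tau> - 1) p Q (s\<lparr>outp := outp s @ [regs s x]\<rparr>)"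
  "wp W \<tau> (If x p1 p2 # p) Q s \<longleftrightarrow> 0 < \<tau> \<and>
     (if regs s x \<noteq> 0 then wp W (\<tau> - 1) (p1 @ p) Q s else wp W (\<tau> - 1) (p2 @ p) Q s)"
  by (cases \<tau>; simp)+

text \<open>Not a simp rule, since it would unroll loops; these go through \<open>wp_loop\<close> or
  \<open>wp_count\<close>.\<close>

lemma wp_While:
  "wp W \<tau> (While x q # p) Q s \<longleftrightarrow> 0 < \<tau> \<and>
     (if regs s x \<noteq> 0 then wp W (\<tau> - 1) (q @ While x q # p) Q s else wp W (\<tau> - 1) p Q s)"
  by (cases \<tau>; simp)

declare wp.simps(3) [simp del]

lemma wp_mono:
  assumes "wp W \<tau> p Q s" "\<tau> \<le> \<tau>'" "\<And>t. Q t \<Longrightarrow> Q' t"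
  shows "wp W \<tau>' p Q' s"
  using assms
proof (induction W \<tau> p Q s arbitrary: \<tau>' rule: wp.induct)
  case (1 W \<tau> Q s)
  then show ?case by simp
next
  case (3 W \<tau> i p Q s)
  then show ?case by (cases \<tau>') (auto simp: wp.simps(3))
qed simp

lemma step_append: "p \<noteq> [] \<Longrightarrow> step (p @ q, s) = (fst (step (p, s)) @ q, snd (step (p, s)))"
  by (cases "(p, s)" rule: step.cases) auto

lemma wp_append:
  assumes "wp W \<tau> p (\<lambda>t. wp W \<tau>' q Q t) s"
  shows "wp W (\<tau> + \<tau>') (p @ q) Q s"
  using assms
proof (induction W \<tau> p "\<lambda>t. wp W \<tau>' q Q t" s rule: wp.induct)
  case (1 W \<tau> s)
  then show ?case by (auto intro: wp_mono)
next
  case (3 W \<tau> i p s)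
  then show ?case
    using step_append[of "i # p" q s] by (auto simp: wp.simps(3))
qed simp

lemma wp_seq:
  assumes "wp W \<tau>1 p P s" and "\<And>t. P t \<Longrightarrow> wp W \<tau>2 q Q t" and "\<tau>1 + \<tau>2 \<le> \<tau>"
  shows "wp W \<tau> (p @ q) Q s"
proof (rule wp_mono)
  show "wp W (\<tau>1 + \<tau>2) (p @ q) Q s"
    by (rule wp_append) (use assms(1,2) in \<open>auto intro: wp_mono\<close>)
qed (use assms in auto)

text \<open>The variant \<open>k\<close> need not be the value of a register, nor be 0 at the exit:
  in the main loop it is the number of stages left plus the number of full calls still paid for.
  Each iteration costs a test besides the body, and the exit costs one more.\<close>

lemma wp_loop:
  assumes "I N s"
    and "\<And>k s. I k s \<Longrightarrow> k \<le> N \<Longrightarrow> regs s x \<noteq> 0 \<Longrightarrow> \<exists>k'. k = Suc k' \<and> wp W \<tau> body (I k') s"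
  shows "wp W (N * (\<tau> + 1) + 1) [While x body] (\<lambda>t. (\<exists>k. I k t) \<and> regs t x = 0) s"
  using assms
proof (induction N arbitrary: s)
  case 0
  then have "regs s x = 0" by fastforce
  with 0 show ?case by (auto simp: wp_While)
next
  case (Suc N)
  show ?case
  proof (cases "regs s x = 0")
    case True
    with Suc.prems(1) show ?thesis by (auto simp: wp_While)
  next
    case False
    then have "wp W \<tau> body (I N) s"
      using Suc.prems(2)[OF Suc.prems(1)] by auto
    then have "wp W (\<tau> + (N * (\<tau> + 1) + 1)) (body @ [While x body])
        (\<lambda>t. (\<exists>k. I k t) \<and> regs t x = 0) s"
      by (rule wp_seq[OF _ Suc.IH]) (use Suc.prems(2) in auto)
    with False show ?thesis by (simp add: wp_While algebra_simps)
  qed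
qed

lemma wp_count:
  assumes "I N s" "regs s x = N"
    and "\<And>k s. I (Suc k) s \<Longrightarrow> k < N \<Longrightarrow> regs s x = Suc k \<Longrightarrow> wp W \<tau> body (\<lambda>t. I k t \<and> regs t x = k) s"
  shows "wp W (N * (\<tau> + 1) + 1) [While x body] (I 0) s"
proof (rule wp_mono)
  show "wp W (N * (\<tau> + 1) + 1) [While x body]
    (\<lambda>t. (\<exists>k. I k t \<and> regs t x = k) \<and> regs t x = 0) s"
  proof (rule wp_loop[where I = "\<lambda>k t. I k t \<and> regs t x = k"])
    fix k s
    assume *: "I k s \<and> regs s x = k" "k \<le> N" "regs s x \<noteq> 0"
    then obtain k' where "k = Suc k'" by (metis not0_implies_Suc)
    with * assms(3)[of k' s] show "\<exists>k'. k = Suc k' \<and> wp W \<tau> body (\<lambda>t. I k' t \<and> regs t x = k') s"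
      by auto
  qed (use assms in auto)
qed auto

lemma ok_step:
  assumes "ok W s" "small_write W i s"
  shows "ok W (snd (step (i # p, s)))"
  using assms by (cases i) (auto simp: ok_def of_bool_def)

lemma wp_sound:
  assumes "wp W \<tau> p Q s" "ok W s"
  shows "\<exists>k\<le>\<tau>. \<exists>t. after k (p, s) = ([], t) \<and> Q t \<and> words_below W (p, s)"
  using assms
proof (induction W \<tau> p Q s rule: wp.induct)
  case (1 W \<tau> Q s)
  then show ?case
    by (auto simp: words_below_def after_Nil ok_def intro!: exI[of _ 0])
next
  case (3 W \<tau> i p Q s)
  let ?c = "step (i # p, s)"
  from 3 ok_step[of W s i p] obtain k t where
    k: "k \<le> \<tau>" "after k (fst ?c, snd ?c) = ([], t)" "Q t" "words_below W (fst ?c, snd ?c)"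
    by (auto simp: wp.simps(3))
  have "words_below W (i # p, s)"
    unfolding words_below_def
  proof
    fix j
    show "let s = snd (after j (i # p, s)) in (\<forall>x. regs s x < W) \<and> (\<forall>a i. mem s a i < W)"
    proof (cases j)
      case 0
      with 3 show ?thesis by (simp add: after_0 ok_def)
    next
      case (Suc j')
      with k(4) show ?thesis by (simp add: after_Suc words_below_def)
    qed
  qed
  with k show ?case
    by (intro exI[of _ "Suc k"] conjI exI[of _ t]) (auto simp: after_Suc)
qed simp

section \<open>Embedding a program as a subroutine\<close>

text \<open>Registers are shifted by 50.  Array \<open>a\<close> becomes array \<open>10 + 2 * a\<close>, and array
  \<open>11 + 2 * a\<close> records for each cell the number of the call (kept in register 5) that wrote it;
  cells with an outdated stamp count as zero, so no memory needs to be cleared between calls.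
  The output goes to array 9, with its length in register 7.  Register 2 holds 1.\<close>

fun embed :: "instr \<Rightarrow> prog" where
  "embed (Const x v) = [Const (50 + x) v]"
| "embed (Op f x y z) = [Op f (50 + x) (50 + y) (50 + z)]"
| "embed (Load x a y) = [Load 9 (11 + 2 * a) (50 + y), Op Equal 9 9 5,
     Load (50 + x) (10 + 2 * a) (50 + y), Op Mul (50 + x) (50 + x) 9]"
| "embed (Store a x y) = [Store (10 + 2 * a) (50 + x) (50 + y), Store (11 + 2 * a) (50 + x) 5]"
| "embed (Coin x) = []"
| "embed (Out x) = [Store 9 7 (50 + x), Op Add 7 7 2]"
| "embed (If x p q) = [If (50 + x) (concat (map embed p)) (concat (map embed q))]"
| "embed (While x p) = [While (50 + x) (concat (map embed p))]"

text \<open>\<open>R\<close> bounds the registers that occur, so that a call can begin by zeroing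
  them in constant time.\<close>

fun embeddable :: "nat \<Rightarrow> instr \<Rightarrow> bool" where
  "embeddable R (Const x v) = (x < R)"
| "embeddable R (Op f x y z) = (x < R \<and> y < R \<and> z < R)"
| "embeddable R (Load x a y) = (x < R \<and> y < R)"
| "embeddable R (Store a x y) = (x < R \<and> y < R)"
| "embeddable R (Coin x) = False"
| "embeddable R (Out x) = (x < R)"
| "embeddable R (If x p q) = (x < R \<and> (\<forall>i\<in>set p. embeddable R i) \<and> (\<forall>i\<in>set q. embeddable R i))"
| "embeddable R (While x p) = (x < R \<and> (\<forall>i\<in>set p. embeddable R i))"

lemma embeddable_mono: "embeddable R i \<Longrightarrow> R \<le> R' \<Longrightarrow> embeddable R' i"
  by (induction R i rule: embeddable.induct) auto

lemma ex_common_bound: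
  assumes "\<And>i. i \<in> set p \<Longrightarrow> \<exists>R. embeddable R i"
  shows "\<exists>R. \<forall>i\<in>set p. embeddable R i"
  using assms
proof (induction p)
  case (Cons i p)
  then obtain R1 R2 where "embeddable R1 i" "\<forall>i\<in>set p. embeddable R2 i"
    by (meson list.set_intros)
  then have "\<forall>i\<in>set (i # p). embeddable (max R1 R2) i"
    by (auto intro: embeddable_mono)
  then show ?case by blast
qed simp

lemma coin_free_embeddable: "coin_free i \<Longrightarrow> \<exists>R. embeddable R i"
proof (induction i rule: coin_free.induct)
  case (2 x p q)
  then obtain R1 R2 where R: "\<forall>i\<in>set p. embeddable R1 i" "\<forall>i\<in>set q. embeddable R2 i"
    using ex_common_bound[of p] ex_common_bound[of q] by auto
  have "embeddable (Suc x + R1 + R2) (If x p q)"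
    using R by (auto intro: embeddable_mono)
  then show ?case by blast
next
  case (3 x p)
  then obtain R where R: "\<forall>i\<in>set p. embeddable R i"
    using ex_common_bound[of p] by auto
  have "embeddable (Suc x + R) (While x p)"
    using R by (auto intro: embeddable_mono)
  then show ?case by blast
next
  case ("4_1" x v) show ?case by (intro exI[of _ "Suc x"]) simp
next
  case ("4_2" f x y z) show ?case by (intro exI[of _ "Suc (x + y + z)"]) simp
next
  case ("4_3" x a y) show ?case by (intro exI[of _ "Suc (x + y)"]) simp
next
  case ("4_4" a x y) show ?case by (intro exI[of _ "Suc (x + y)"]) simp
next
  case ("4_5" x) show ?case by (intro exI[of _ "Suc x"]) simp
qed simp

lemma deterministic_embeddable: "deterministic p \<Longrightarrow> \<exists>R. \<forall>i\<in>set p. embeddable R i"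
  unfolding deterministic_def by (intro ex_common_bound coin_free_embeddable) auto

text \<open>\<open>s\<close> is the state of the stand-alone run, \<open>s'\<close> that of the
  host, and the second argument is the host at the moment of the call, for the frame conditions.
  Stamps never exceed the current call number, so no cell can look as if written by a later call.
  The coins of \<open>s\<close> are left open, as an embeddable program flips none.\<close>

definition simulates :: "nat \<Rightarrow> state \<Rightarrow> state \<Rightarrow> state \<Rightarrow> bool" where
  "simulates R s\<^sub>0 s s' \<longleftrightarrow>
     (\<forall>x<R. regs s' (50 + x) = regs s x) \<and>
     (\<forall>a i. mem s a i = (if mem s' (11 + 2 * a) i = regs s' 5 then mem s' (10 + 2 * a) i else 0)) \<and>
     outp s = map (mem s' 9) [0..<regs s' 7] \<and>
     (\<forall>a i. mem s' (11 + 2 * a) i \<le> regs s' 5) \<and>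
     (\<forall>x<50. x \<noteq> 7 \<longrightarrow> x \<noteq> 9 \<longrightarrow> regs s' x = regs s\<^sub>0 x) \<and> (\<forall>a<9. mem s' a = mem s\<^sub>0 a) \<and>
     outp s' = outp s\<^sub>0 \<and> coins s' = coins s\<^sub>0"

lemma outp_step_length: "length (outp s) \<le> length (outp (snd (step (p, s))))"
  and outp_step_length_le: "length (outp (snd (step (p, s)))) \<le> Suc (length (outp s))"
  by (cases "(p, s)" rule: step.cases; auto)+

text \<open>Since output only grows, its final length bounds the output pointer of the host during
  the whole simulation.\<close>

lemma outp_after_mono: "length (outp s) \<le> length (outp (snd (after k (p, s))))"
proof (induction k arbitrary: p s)
  case (Suc k)
  then show ?case
    using outp_step_length[of s p] by (metis after_Suc le_trans prod.collapse)
qed (simp add: after_0)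

text \<open>One step outputs at most one word; \<open>listing_time_ge\<close> draws its lower bound
  on the running time from this.\<close>

lemma outp_after_le: "length (outp (snd (after k (p, s)))) \<le> length (outp s) + k"
proof (induction k arbitrary: p s)
  case (Suc k)
  then show ?case
    using outp_step_length_le[of p s]
    by (metis (no_types, lifting) add_Suc_shift add_le_mono1 after_Suc le_trans plus_1_eq_Suc
        add.commute prod.collapse)
qed (simp add: after_0)

lemma words_below_step: "words_below W c \<Longrightarrow> words_below W (step c)"
  by (metis after_Suc words_below_def)

lemma words_below_ok: "words_below W (p, s) \<Longrightarrow> ok W s"
  unfolding words_below_def ok_def by (metis after_0 snd_conv)

lemma words_below_mono: "words_below W c \<Longrightarrow> W \<le> W' \<Longrightarrow> words_below W' c"
  unfolding words_below_def by (meson less_le_trans)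

text \<open>The rest of the run enters as a hypothesis, so that branches and loops are treated like
  any other instruction. The 4 is the cost of \<open>Load\<close>, the longest translation.\<close>

lemma simulates_step:
  assumes rel: "simulates R s\<^sub>0 s s'" and i: "embeddable R i" and one: "regs s\<^sub>0 2 = 1"
    and ok': "ok W (snd (step (i # p, s)))" and W: "1 < W"
    and len: "length (outp (snd (step (i # p, s)))) < W"
    and next_wp: "\<And>t'. simulates R s\<^sub>0 (snd (step (i # p, s))) t' \<Longrightarrow>
       wp W \<tau> (concat (map embed (fst (step (i # p, s))))) Q t'"
  shows "wp W (4 + \<tau>) (concat (map embed (i # p))) Q s'"
proof -
  have wp_next: "wp W \<tau>' p' Q t'" if "simulates R s\<^sub>0 (snd (step (i # p, s))) t'" "\<tau> \<le> \<tau>'"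
      "p' = concat (map embed (fst (step (i # p, s))))" for p' \<tau>' t'
    using wp_mono[OF next_wp[OF that(1)] that(2)] that(3) by simp
  show ?thesis
  proof (cases i)
    case (Const x v)
    then have v: "v < W" using ok' by (auto simp: ok_def split: if_splits)
    show ?thesis
      using Const v rel i
      by (auto simp: simulates_def intro!: wp_next)
  next
    case (Op f x y z)
    then have v: "apply_binop f (regs s y) (regs s z) < W" using ok' by (auto simp: ok_def split: if_splits)
    show ?thesis
      using Op v rel i
      by (auto simp: simulates_def intro!: wp_next)
  next
    case (Load x a y)
    then have v: "mem s a (regs s y) < W" using ok' by (auto simp: ok_def split: if_splits)
    have y: "regs s' (50 + y) = regs s y" using rel i Load by (simp add: simulates_def)
    let ?b = "mem s' (11 + 2 * a) (regs s y) = regs s' 5"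
    \<comment> \<open>Multiplying by the 0/1 outcome of the stamp comparison yields the cell or zero
      without a branch.\<close>
    have m: "mem s' (10 + 2 * a) (regs s y) * of_bool ?b = mem s a (regs s y)"
      using rel by (auto simp: simulates_def)
    have "simulates R s\<^sub>0 (set_reg x (mem s a (regs s y)) s)
       (set_reg (50 + x) (mem s a (regs s y)) (set_reg (50 + x) w (set_reg 9 (of_bool ?b) (set_reg 9 w' s'))))" for w w'
      using rel by (auto simp: simulates_def)
    then show ?thesis
      using Load v y m W
      by (auto intro!: wp_next)
  next
    case (Store a x y)
    then have "simulates R s\<^sub>0 (snd (step (i # p, s)))
       (s'\<lparr>mem := (mem s')(10 + 2 * a := (mem s' (10 + 2 * a))(regs s x := regs s y),
            11 + 2 * a := (mem s' (11 + 2 * a))(regs s x := regs s' 5))\<rparr>)"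
      using rel by (auto simp: simulates_def)
    moreover have "regs s' (50 + x) = regs s x" "regs s' (50 + y) = regs s y"
      using rel i Store by (simp_all add: simulates_def)
    moreover have "11 + 2 * a \<noteq> 10 + 2 * a" by presburger
    ultimately show ?thesis
      using Store by (auto intro!: wp_next)
  next
    case (Coin x)
    then show ?thesis using i by simp
  next
    case (Out x)
    have l: "length (outp s) = regs s' 7" using rel by (simp add: simulates_def)
    have "simulates R s\<^sub>0 (snd (step (i # p, s)))
       (set_reg 7 (Suc (regs s' 7)) (s'\<lparr>mem := (mem s')(9 := (mem s' 9)(regs s' 7 := regs s x))\<rparr>))"
      using rel Out by (auto simp: simulates_def)
    moreover have "regs s' (50 + x) = regs s x" "regs s' 2 = 1"
      using rel i Out one by (simp_all add: simulates_def)
    ultimately show ?thesis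
      using Out len l by (auto intro!: wp_next)
  next
    case (If x p q)
    moreover have "regs s' (50 + x) = regs s x"
      using rel i If by (simp add: simulates_def)
    ultimately show ?thesis
      using rel by (auto intro!: wp_next)
  next
    case (While x p)
    moreover have "regs s' (50 + x) = regs s x"
      using rel i While by (simp add: simulates_def)
    ultimately show ?thesis
      using rel by (auto simp: wp_While intro!: wp_next)
  qed
qed

lemma embeddable_step:
  assumes "\<forall>i\<in>set p. embeddable R i"
  shows "\<forall>i\<in>set (fst (step (p, s))). embeddable R i"
  using assms by (cases "(p, s)" rule: step.cases) auto

lemma wp_embed:
  assumes "after k (p, s) = ([], t)" "words_below W (p, s)" "length (outp t) < W" "1 < W"
    and "\<forall>i\<in>set p. embeddable R i" "simulates R s\<^sub>0 s s'" "regs s\<^sub>0 2 = 1"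
  shows "wp W (4 * k) (concat (map embed p)) (simulates R s\<^sub>0 t) s'"
  using assms
proof (induction k arbitrary: p s s')
  case 0
  then show ?case by (simp add: after_0)
next
  case (Suc k)
  show ?case
  proof (cases p)
    case Nil
    with Suc.prems show ?thesis by (simp add: after_Nil)
  next
    case (Cons i q)
    let ?c = "step (i # q, s)"
    have wb: "words_below W (fst ?c, snd ?c)"
      using words_below_step[OF Suc.prems(2)] Cons by simp
    have af: "after k (fst ?c, snd ?c) = ([], t)"
      using Suc.prems(1) Cons by (simp add: after_Suc)
    have "wp W (4 + 4 * k) (concat (map embed (i # q))) (simulates R s\<^sub>0 t) s'"
    proof (rule simulates_step[OF Suc.prems(6) _ Suc.prems(7)])
      show "ok W (snd ?c)" using words_below_ok[OF wb] .
      show "length (outp (snd ?c)) < W"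
        using outp_after_mono[of "snd ?c" k "fst ?c"] af Suc.prems(3) by simp
      show "wp W (4 * k) (concat (map embed (fst ?c))) (simulates R s\<^sub>0 t) t'"
        if "simulates R s\<^sub>0 (snd ?c) t'" for t'
        using Suc.IH[OF af wb Suc.prems(3,4) _ that Suc.prems(7)] embeddable_step[of "i # q" R s]
          Suc.prems(5) Cons by auto
    qed (use Suc.prems Cons in auto)
    then show ?thesis using Cons by simp
  qed
qed

section \<open>The reduction as a program\<close>

text \<open>Registers: 0 and 1 hold \<open>n\<close> and \<open>m\<close>, 2 and 8 the constants 1 and 0, 3 the bit length of
  \<open>n\<close>, 4 the number of stages left, 5 the number of the current call, 6 the number of vertices of
  the graph under construction, 7 the length of the subroutine's output; registers from 10 on are
  temporaries.  Arrays: 0 and 1 hold the input, 2 maps \<open>u * n + v\<close> to the index of the edge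
  \<open>uv\<close>, 3 the levels, 4 the edges found to lie in a triangle, 5 the codes, 6 and 7 the renaming
  of vertices and its inverse.\<close>

definition init_prog :: prog where
  "init_prog = [Const 2 1, Op Add 10 0 8] @ [While 10 [Op Shr 10 10 2, Op Add 3 3 2]]"

text \<open>Register 11 is the running product of the coins, so register 12 counts the leading ones
  without a branch. The inner loop does not stop at the first zero: every vertex consumes exactly as
  many coins as register 3 says, which gives it a fixed block of the tape.\<close>

definition levels_prog :: prog where
  "levels_prog = [Op Add 10 0 8] @ [While 10
     ([Op Sub 10 10 2, Op Add 11 2 8, Op Add 12 8 8, Op Add 13 3 8] @
      [While 13 [Op Sub 13 13 2, Coin 14, Op Mul 11 11 14, Op Add 12 12 11]] @ [Store 3 10 12])]"

text \<open>Both orientations are entered, since the lister may return the corners of a triangle in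
  any order. The final instructions leave \<open>Q\<close> in register 4.\<close>

definition index_prog :: prog where
  "index_prog = [Op Add 10 1 8] @ [While 10 [Op Sub 10 10 2, Load 11 0 10, Load 12 1 10,
     Op Mul 13 11 0, Op Add 13 13 12, Store 2 13 10, Op Mul 13 12 0, Op Add 13 13 11, Store 2 13 10]]
     @ [Op Add 15 3 3, Op Add 16 3 2, Op Mul 4 15 15, Op Mul 4 4 16]"

text \<open>The stage number is register 4 minus 1, read in mixed radix with lowest digit r in base
  \<open>B + 1\<close> and next digit k in base \<open>2 * B\<close>. As it counts down, r falls
  from \<open>B\<close> to 0 for each pair of bit tests k, l. The constants 3, 5, 6 are the
  admissible code sums; the 3 also serves as the length of a triple.\<close>

definition decode_prog :: prog where
  "decode_prog = [Op Sub 17 4 2, Op Mod 18 17 16, Op Div 17 17 16, Op Mod 19 17 15, Op Div 20 17 15,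
     Op Shr 25 19 2, Op Shr 26 20 2, Op Add 5 5 2, Const 21 3, Const 22 5, Const 23 6, Const 27 2]"

definition codes_prog :: prog where
  "codes_prog = [Op Add 10 0 8] @ [While 10 [Op Sub 10 10 2,
     Op Shr 11 10 25, Op Add 11 11 19, Op Mod 11 11 27,
     Op Shr 12 10 26, Op Add 12 12 20, Op Mod 12 12 27, Const 14 2,
     If 11 [Const 14 1, If 12 [Const 14 4, Load 13 3 10, Op Less 13 13 18, If 13 [Const 14 0] []] []] [],
     Store 5 10 14]]"

text \<open>Besides the n old vertices, two new ones per edge may need names. The inverse table
  stays uncleared because it is read only below register 6.\<close>

definition clear_prog :: prog where
  "clear_prog = [Op Add 10 1 1, Op Add 10 10 0] @ [While 10 [Op Sub 10 10 2, Store 6 10 8]]"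

text \<open>The three cases that keep an edge exclude one another, so adding their indicators in
  register 14 forms the disjunction.\<close>

definition select_prog :: prog where
  "select_prog = [Op Sub 10 10 2, Load 11 0 10, Load 12 1 10, Load 13 5 11, Load 14 5 12,
     Op Add 13 13 14, Load 14 4 10, Op Equal 14 14 8, Op Equal 28 13 21, Op Mul 14 14 28,
     Op Equal 28 13 22, Op Add 14 14 28, Op Equal 28 13 23, Op Add 14 14 28,
     If 14 [] [Op Add 11 10 10, Op Add 11 11 0, Op Add 12 11 2]]"

text \<open>The table holds the new name plus one, so that 0 can mean unnamed.\<close>

definition rename_prog :: "nat \<Rightarrow> prog" where
  "rename_prog u = [Load 13 6 u, If 13 [] [Store 7 6 u, Op Add 6 6 2, Store 6 u 6, Op Add 13 6 8],
     Op Sub 13 13 2]"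

text \<open>Arrays 10 and 12 are the lister's arrays 0 and 1, and 11 and 13 are their stamps: the
  edges are written straight into its input.\<close>

definition build_prog :: prog where
  "build_prog = [Const 6 0, Op Add 10 1 8] @ [While 10
     (select_prog @ rename_prog 11 @ [Store 10 10 13, Store 11 10 5] @
      rename_prog 12 @ [Store 12 10 13, Store 13 10 5])]"

definition call_prog :: "nat \<Rightarrow> prog \<Rightarrow> prog" where
  "call_prog R p = map (\<lambda>x. Const (50 + x) 0) [0..<R] @
     [Op Add 50 6 8, Op Add 51 1 8, Op Add 52 1 8, Const 7 0] @ concat (map embed p)"

definition mark_edge :: "nat \<Rightarrow> nat \<Rightarrow> prog" where
  "mark_edge u v = [Op Mul 14 u 0, Op Add 14 14 v, Load 14 2 14, Store 4 14 2]"

text \<open>Triples are taken from the end of the output. The final instructions pass to the next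
  stage exactly if fewer than \<open>3 * m\<close> words came out; a full answer may leave triangles
  unlisted, so the stage is then repeated.\<close>

definition mark_prog :: prog where
  "mark_prog = [Op Add 10 7 8] @ [While 10 ([Op Sub 10 10 21, Load 11 9 10,
     Op Add 12 10 2, Load 12 9 12, Op Add 13 10 27, Load 13 9 13,
     Load 11 7 11, Load 12 7 12, Load 13 7 13] @ mark_edge 11 12 @ mark_edge 12 13 @ mark_edge 11 13)]
     @ [Op Mul 10 1 21, Op Less 10 7 10, Op Sub 4 4 10]"

definition round_prog :: "nat \<Rightarrow> prog \<Rightarrow> prog" where
  "round_prog R p = decode_prog @ codes_prog @ clear_prog @ build_prog @ call_prog R p @ mark_prog"

text \<open>The counter falls, so its distance to m visits the edges in input order.\<close>

definition output_prog :: prog where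
  "output_prog = [Op Add 10 1 8] @ [While 10 [Op Sub 11 1 10, Load 11 4 11, Out 11, Op Sub 10 10 2]]"

definition detection_prog :: "nat \<Rightarrow> prog \<Rightarrow> prog" where
  "detection_prog R p =
     init_prog @ levels_prog @ index_prog @ [While 4 (round_prog R p)] @ output_prog"

section \<open>Correctness, cost and word size of the program parts\<close>

locale graph_input =
  fixes n :: nat and es :: "(nat \<times> nat) list" and E :: "nat set set" and W :: nat
  assumes represents: "represents n es E"
    and W_large: "64 * (n + length es + 4) ^ 4 \<le> W"
begin

abbreviation m :: nat where "m \<equiv> length es"
text \<open>\<open>floorlog 2\<close> is the bit length, with value 0 at n = 0. \<open>Q\<close>
  counts the pairs of bit tests, each test being one of \<open>B\<close> bits, plain or
  complemented, times the \<open>B + 1\<close> thresholds.\<close>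

definition B :: nat where "B = floorlog 2 n"
definition Q :: nat where "Q = 2 * B * (2 * B) * (B + 1)"

lemma n_less: "n < 2 ^ B"
  using floorlog_bounds[of n 2] unfolding B_def by (cases "n = 0") auto

lemma B_le: "B \<le> n"
  using floorlog_le_iff[of 2 n n] by (auto simp: B_def)

lemma W_ge_quartic: "64 * (n + m + 4) ^ 4 \<le> W" "64 * (n + m + 4) ^ 2 \<le> W" "64 * n + 64 * m + 256 \<le> W"
proof -
  have "(n + m + 4)\<^sup>2 \<le> (n + m + 4) ^ 4"
    by (rule power_increasing) simp_all
  moreover have "n + m + 4 \<le> (n + m + 4) ^ 4"
    by (rule self_le_power) simp_all
  ultimately have "64 * (n + m + 4) ^ 4 \<le> W" "64 * (n + m + 4) ^ 2 \<le> W" "64 * (n + m + 4) \<le> W"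
    using W_large by (meson le_trans mult_le_mono2)+
  then show "64 * (n + m + 4) ^ 4 \<le> W" "64 * (n + m + 4) ^ 2 \<le> W" "64 * n + 64 * m + 256 \<le> W"
    by (simp_all add: distrib_left)
qed

lemma key_less: "u < n \<Longrightarrow> v < n \<Longrightarrow> u * n + v < W"
proof -
  assume "u < n" "v < n"
  then have "u * n + v \<le> n * n + n"
    by (intro add_mono mult_mono) auto
  also have "\<dots> < W"
    using W_ge_quartic(2) by (simp add: power2_eq_square algebra_simps)
  finally show ?thesis .
qed

text \<open>The call counter can reach \<open>Q + full_rounds lev\<close>, which
  \<open>full_rounds_le\<close> bounds by \<open>Q * (n + 1) + 1\<close>. With \<open>Q\<close>
  cubic in \<open>B \<le> n\<close>, this is what the fourth power in the word bound is for.\<close>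

lemma Q_less: "Q * (n + 1) + 2 < W"
proof -
  have "Q * (n + 1) \<le> (2 * (n + m + 4)) * (2 * (n + m + 4)) * (n + m + 4) * (n + m + 4)"
    unfolding Q_def using B_le by (intro mult_mono) auto
  also have "\<dots> = 4 * (n + m + 4) ^ 4"
    by (simp only: power4_eq_xxxx ac_simps)
  finally have "Q * (n + 1) \<le> 4 * (n + m + 4) ^ 4" .
  moreover have "4 \<le> (n + m + 4) ^ 4"
    using power_increasing[of 1 4 "n + m + 4"] by simp
  ultimately show ?thesis
    using W_ge_quartic(1) by linarith
qed

lemma ends_less: "i < m \<Longrightarrow> fst (es ! i) < n" "i < m \<Longrightarrow> snd (es ! i) < n"
  and ends_neq: "i < m \<Longrightarrow> fst (es ! i) \<noteq> snd (es ! i)"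
  and ends_edge: "i < m \<Longrightarrow> ends_of (es ! i) \<in> E"
  and ends_inj: "i < m \<Longrightarrow> j < m \<Longrightarrow> ends_of (es ! i) = ends_of (es ! j) \<Longrightarrow> i = j"
  and edge_ends: "e \<in> E \<Longrightarrow> \<exists>i<m. e = ends_of (es ! i)"
proof -
  have *: "simple_graph {..<n} E" "distinct (map ends_of es)" "set (map ends_of es) = E"
    using represents by (auto simp: represents_def)
  show e: "ends_of (es ! i) \<in> E" if "i < m" for i
    using *(3) that by (metis in_set_conv_nth length_map nth_map)
  show "fst (es ! i) < n" "snd (es ! i) < n" "fst (es ! i) \<noteq> snd (es ! i)" if "i < m"
    using e[OF that] *(1) by (auto simp: simple_graph_def ends_of_def)
  show "ends_of (es ! i) = ends_of (es ! j) \<Longrightarrow> i = j" if "i < m" "j < m"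
    using *(2) that by (simp add: distinct_conv_nth) metis
  show "\<exists>i<m. e = ends_of (es ! i)" if "e \<in> E"
    using *(3) that by (metis in_set_conv_nth length_map nth_map)
qed

definition base :: "state \<Rightarrow> bool" where
  "base s \<longleftrightarrow> regs s 0 = n \<and> regs s 1 = m \<and> regs s 2 = 1 \<and> regs s 8 = 0 \<and> outp s = [] \<and>
     (\<forall>i<m. mem s 0 i = fst (es ! i)) \<and> (\<forall>i<m. mem s 1 i = snd (es ! i))"

definition fresh :: "state \<Rightarrow> bool" where
  "fresh s \<longleftrightarrow> regs s 5 = 0 \<and> (\<forall>a\<ge>4. mem s a = (\<lambda>_. 0))"

lemma init_wp:
  "wp W (3 * B + 3) init_prog (\<lambda>t. base t \<and> fresh t \<and> regs t 3 = B \<and> coins t = \<omega>) (input [n, m] es \<omega>)"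
proof -
  let ?I = "\<lambda>k s. base s \<and> fresh s \<and> coins s = \<omega> \<and> k = floorlog 2 (regs s 10) \<and> regs s 10 \<le> n \<and> regs s 3 + k = B"
  show ?thesis
    unfolding init_prog_def
  proof (rule wp_seq[where ?\<tau>1.0 = 2 and ?\<tau>2.0 = "B * (2 + 1) + 1"])
    show "wp W 2 [Const 2 1, Op Add 10 0 8] (?I B) (input [n, m] es \<omega>)"
      using W_ge_quartic(3) by (auto simp: input_def base_def fresh_def B_def)
    show "wp W (B * (2 + 1) + 1) [While 10 [Op Shr 10 10 2, Op Add 3 3 2]]
        (\<lambda>t. base t \<and> fresh t \<and> regs t 3 = B \<and> coins t = \<omega>) s" if "?I B s" for s
    proof (rule wp_mono[OF wp_loop[where I = ?I]])
      fix k s assume I: "?I k s" "k \<le> B" "regs s 10 \<noteq> 0"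
      define g h where "g = regs s 10" and "h = g div 2"
      then have k: "k = Suc (floorlog 2 h)"
        using compute_floorlog[of 2 g] I by simp
      have s: "base s" "fresh s" "coins s = \<omega>" "regs s 10 = g" "regs s 3 + Suc (floorlog 2 h) = B"
        using I k by (auto simp: g_def)
      have "h \<le> g" "g \<le> n" using I by (simp_all add: g_def h_def)
      then have lt: "h \<le> n" "h < W" "Suc (regs s 3) < W"
        using s(5) W_ge_quartic(3) B_le by linarith+
      have shift: "drop_bit (Suc 0) g = h" by (simp add: drop_bit_eq_div h_def)
      have "wp W 2 [Op Shr 10 10 2, Op Add 3 3 2] (?I (floorlog 2 h)) s"
        using s lt by (simp add: base_def fresh_def shift)
      with k show "\<exists>k'. k = Suc k' \<and> wp W 2 [Op Shr 10 10 2, Op Add 3 3 2] (?I k') s"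
        by blast
    qed (use that in \<open>auto simp: floorlog_def\<close>)
  qed simp
qed

lemma length_takeWhile_snoc:
  "length (takeWhile id (l @ [b])) = length (takeWhile id l) + of_bool ((\<forall>b\<in>set l. b) \<and> b)"
  by (induction l) auto

text \<open>Vertices are served from \<open>n - 1\<close> down to 0, hence the position of the block
  of \<open>v\<close>.\<close>

definition coin_level :: "bool stream \<Rightarrow> nat \<Rightarrow> nat" where
  "coin_level \<omega> v = length (takeWhile id (stake B (sdrop ((n - 1 - v) * B) \<omega>)))"

lemma flip_level_wp:
  assumes "regs s 2 = 1" "regs s 11 = 1" "regs s 12 = 0" "regs s 13 = B" "coins s = \<omega>"
  shows "wp W (B * (4 + 1) + 1) [While 13 [Op Sub 13 13 2, Coin 14, Op Mul 11 11 14, Op Add 12 12 11]]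
    (\<lambda>t. coins t = sdrop B \<omega> \<and> regs t 12 = length (takeWhile id (stake B \<omega>)) \<and>
      (\<forall>x. x \<notin> {11, 12, 13, 14} \<longrightarrow> regs t x = regs s x) \<and> mem t = mem s \<and> outp t = outp s) s"
proof -
  let ?I = "\<lambda>k (t::state). coins t = sdrop (B - k) \<omega> \<and>
      regs t 11 = of_bool (\<forall>b\<in>set (stake (B - k) \<omega>). b) \<and>
      regs t 12 = length (takeWhile id (stake (B - k) \<omega>)) \<and>
      (\<forall>x. x \<notin> {11, 12, 13, 14} \<longrightarrow> regs t x = regs s x) \<and> mem t = mem s \<and> outp t = outp s"
  have "wp W (B * (4 + 1) + 1) [While 13 [Op Sub 13 13 2, Coin 14, Op Mul 11 11 14, Op Add 12 12 11]]
    (?I 0) s"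
  proof (rule wp_count)
    fix k and t :: state
    assume I: "?I (Suc k) t" and k: "k < B" "regs t 13 = Suc k"
    have j: "B - k = Suc (B - Suc k)" using k by simp
    let ?l = "stake (B - Suc k) \<omega>" and ?b = "\<omega> !! (B - Suc k)"
    have tw: "length (takeWhile id (?l @ [?b])) =
        length (takeWhile id ?l) + of_bool ((\<forall>b\<in>set ?l. b) \<and> ?b)"
      by (rule length_takeWhile_snoc)
    have l: "length (takeWhile id ?l) \<le> B"
      using length_takeWhile_le[of id ?l] by simp
    have "regs t 2 = 1" using I assms(1) by simp
    then show "wp W 4 [Op Sub 13 13 2, Coin 14, Op Mul 11 11 14, Op Add 12 12 11]
        (\<lambda>t. ?I k t \<and> regs t 13 = k) t"
      using I k W_ge_quartic(3) B_le tw l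
      by (auto simp: j stake_Suc sdrop_simps simp del: stake.simps sdrop.simps)
  qed (use assms in auto)
  then show ?thesis by (rule wp_mono) auto
qed

lemma levels_wp:
  assumes "base s" "fresh s" "regs s 3 = B" "coins s = \<omega>"
  shows "wp W (n * (5 * B + 7) + 2) levels_prog
    (\<lambda>t. base t \<and> fresh t \<and> regs t 3 = B \<and> (\<forall>v<n. mem t 3 v = coin_level \<omega> v)) s"
proof -
  let ?I = "\<lambda>k (t::state). base t \<and> fresh t \<and> regs t 3 = B \<and> coins t = sdrop ((n - k) * B) \<omega> \<and>
    (\<forall>v<n. k \<le> v \<longrightarrow> mem t 3 v = coin_level \<omega> v)"
  show ?thesis
    unfolding levels_prog_def
  proof (rule wp_seq[where ?\<tau>1.0 = 1 and ?\<tau>2.0 = "n * ((5 * B + 6) + 1) + 1"])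
    show "wp W 1 [Op Add 10 0 8] (\<lambda>t. ?I n t \<and> regs t 10 = n) s"
      using assms W_ge_quartic(3) by (auto simp: base_def fresh_def)
    fix s assume s: "?I n s \<and> regs s 10 = n"
    show "wp W (n * ((5 * B + 6) + 1) + 1) [While 10
     ([Op Sub 10 10 2, Op Add 11 2 8, Op Add 12 8 8, Op Add 13 3 8] @
      [While 13 [Op Sub 13 13 2, Coin 14, Op Mul 11 11 14, Op Add 12 12 11]] @ [Store 3 10 12])]
      (\<lambda>t. base t \<and> fresh t \<and> regs t 3 = B \<and> (\<forall>v<n. mem t 3 v = coin_level \<omega> v)) s"
    proof (rule wp_mono[OF wp_count[where I = ?I and x = 10 and N = n]])
      fix k and t :: state assume I: "?I (Suc k) t" and k: "k < n" "regs t 10 = Suc k"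
      let ?\<omega> = "sdrop ((n - Suc k) * B) \<omega>"
      let ?P = "\<lambda>t::state. base t \<and> fresh t \<and> regs t 3 = B \<and> regs t 10 = k \<and> coins t = ?\<omega> \<and>
        (\<forall>v<n. Suc k \<le> v \<longrightarrow> mem t 3 v = coin_level \<omega> v)"
      let ?R = "\<lambda>t::state. base t \<and> fresh t \<and> regs t 3 = B \<and> regs t 10 = k \<and> coins t = sdrop B ?\<omega> \<and>
        regs t 12 = length (takeWhile id (stake B ?\<omega>)) \<and>
        (\<forall>v<n. Suc k \<le> v \<longrightarrow> mem t 3 v = coin_level \<omega> v)"
      show "wp W (5 * B + 6) ([Op Sub 10 10 2, Op Add 11 2 8, Op Add 12 8 8, Op Add 13 3 8] @
        [While 13 [Op Sub 13 13 2, Coin 14, Op Mul 11 11 14, Op Add 12 12 11]] @ [Store 3 10 12])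
          (\<lambda>t. ?I k t \<and> regs t 10 = k) t"
      proof (rule wp_seq[where ?\<tau>1.0 = 4 and ?\<tau>2.0 = "5 * B + 2"])
        show "wp W 4 [Op Sub 10 10 2, Op Add 11 2 8, Op Add 12 8 8, Op Add 13 3 8]
          (\<lambda>t. ?P t \<and> regs t 11 = 1 \<and> regs t 12 = 0 \<and> regs t 13 = B) t"
          using I k W_ge_quartic(3) B_le by (auto simp: base_def fresh_def)
        fix t assume t: "?P t \<and> regs t 11 = 1 \<and> regs t 12 = 0 \<and> regs t 13 = B"
        show "wp W (5 * B + 2) ([While 13 [Op Sub 13 13 2, Coin 14, Op Mul 11 11 14, Op Add 12 12 11]]
          @ [Store 3 10 12]) (\<lambda>t. ?I k t \<and> regs t 10 = k) t"
        proof (rule wp_seq[where ?\<tau>1.0 = "B * (4 + 1) + 1" and ?\<tau>2.0 = 1 and P = ?R])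
          show "wp W (B * (4 + 1) + 1)
            [While 13 [Op Sub 13 13 2, Coin 14, Op Mul 11 11 14, Op Add 12 12 11]] ?R t"
            by (rule wp_mono[OF flip_level_wp[of _ ?\<omega>]]) (use t in \<open>auto simp: base_def fresh_def\<close>)
          fix t assume t: "?R t"
          have "(n - k) * B = (n - Suc k) * B + B"
            using k by (metis Suc_diff_Suc add.commute mult_Suc)
          then have "sdrop B ?\<omega> = sdrop ((n - k) * B) \<omega>"
            by (simp add: sdrop_add)
          moreover have "length (takeWhile id (stake B ?\<omega>)) = coin_level \<omega> k"
            unfolding coin_level_def by simp
          ultimately have t': "base t" "fresh t" "regs t 3 = B" "regs t 10 = k"
            "coins t = sdrop ((n - k) * B) \<omega>" "regs t 12 = coin_level \<omega> k"
            "\<forall>v<n. k \<le> v \<longrightarrow> ((mem t 3)(k := coin_level \<omega> k)) v = coin_level \<omega> v"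
            using t by simp_all
          then show "wp W 1 [Store 3 10 12] (\<lambda>t. ?I k t \<and> regs t 10 = k) t"
            by (simp add: base_def fresh_def)
        qed simp
      qed simp
    qed (use s in auto)
  qed (simp add: algebra_simps)
qed

definition prepared :: "(nat \<Rightarrow> nat) \<Rightarrow> state \<Rightarrow> bool" where
  "prepared lev s \<longleftrightarrow> base s \<and> regs s 3 = B \<and> regs s 15 = 2 * B \<and> regs s 16 = B + 1 \<and>
     (\<forall>v<n. mem s 3 v = lev v) \<and>
     (\<forall>i<m. mem s 2 (fst (es ! i) * n + snd (es ! i)) = i \<and> mem s 2 (snd (es ! i) * n + fst (es ! i)) = i)"

lemma key_inj: "u < n \<Longrightarrow> v < n \<Longrightarrow> u' < n \<Longrightarrow> v' < n \<Longrightarrow> u * n + v = u' * n + v' \<longleftrightarrow> u = u' \<and> v = v'"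
  by (metis div_mult_self3 div_less mod_less mod_mult_self3 add.right_neutral not_less0)

lemma index_wp:
  assumes "base s" "fresh s" "regs s 3 = B" "\<forall>v<n. mem s 3 v = lev v"
  shows "wp W (10 * m + 6) index_prog (\<lambda>t. prepared lev t \<and> fresh t \<and> regs t 4 = Q) s"
proof -
  let ?P = "\<lambda>k (t::state). \<forall>i<m. k \<le> i \<longrightarrow> mem t 2 (fst (es ! i) * n + snd (es ! i)) = i \<and>
       mem t 2 (snd (es ! i) * n + fst (es ! i)) = i"
  let ?I = "\<lambda>k (t::state). base t \<and> fresh t \<and> regs t 3 = B \<and> (\<forall>v<n. mem t 3 v = lev v) \<and> ?P k t"
  let ?body = "[Op Sub 10 10 2, Load 11 0 10, Load 12 1 10,
     Op Mul 13 11 0, Op Add 13 13 12, Store 2 13 10, Op Mul 13 12 0, Op Add 13 13 11, Store 2 13 10]"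
  show ?thesis
    unfolding index_prog_def
  proof (rule wp_seq[where ?\<tau>1.0 = 1 and ?\<tau>2.0 = "m * (9 + 1) + 1 + 4"])
    show "wp W 1 [Op Add 10 1 8] (\<lambda>t. ?I m t \<and> regs t 10 = m) s"
      using assms W_ge_quartic(3) by (auto simp: base_def fresh_def)
    fix s assume s: "?I m s \<and> regs s 10 = m"
    show "wp W (m * (9 + 1) + 1 + 4) ([While 10 ?body] @
       [Op Add 15 3 3, Op Add 16 3 2, Op Mul 4 15 15, Op Mul 4 4 16])
       (\<lambda>t. prepared lev t \<and> fresh t \<and> regs t 4 = Q) s"
    proof (rule wp_seq[where P = "?I 0"])
      show "wp W (m * (9 + 1) + 1) [While 10 ?body] (?I 0) s"
      proof (rule wp_count)
        fix k and t :: state assume I: "?I (Suc k) t" and k: "k < m" "regs t 10 = Suc k"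
        let ?u = "fst (es ! k)" and ?v = "snd (es ! k)"
        let ?f = "(mem t 2)(?u * n + ?v := k, ?v * n + ?u := k)"
        have f: "\<forall>i<m. k \<le> i \<longrightarrow> ?f (fst (es ! i) * n + snd (es ! i)) = i \<and>
           ?f (snd (es ! i) * n + fst (es ! i)) = i"
        proof (intro allI impI)
          fix i assume i: "i < m" "k \<le> i"
          show "?f (fst (es ! i) * n + snd (es ! i)) = i \<and> ?f (snd (es ! i) * n + fst (es ! i)) = i"
          proof (cases "i = k")
            case False
            then have "ends_of (es ! i) \<noteq> ends_of (es ! k)" using ends_inj i k by blast
            moreover have "mem t 2 (fst (es ! i) * n + snd (es ! i)) = i"
              "mem t 2 (snd (es ! i) * n + fst (es ! i)) = i"
              using I i False by auto
            moreover have "fst (es ! i) * n + snd (es ! i) \<notin> {?u * n + ?v, ?v * n + ?u}"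
              "snd (es ! i) * n + fst (es ! i) \<notin> {?u * n + ?v, ?v * n + ?u}"
              using calculation(1) key_inj ends_less[OF i(1)] ends_less[OF k(1)]
              unfolding ends_of_def by (metis doubleton_eq_iff insertE singletonD)+
            ultimately show ?thesis
              by simp
          qed simp
        qed
        have "base t" "fresh t" "regs t 3 = B" "\<forall>v<n. mem t 3 v = lev v"
          using I by auto
        moreover have "?u * n < W" "?v * n < W" "?u * n + ?v < W" "?v * n + ?u < W"
          using key_less[of ?u ?v] key_less[of ?v ?u] ends_less[OF k(1)] by auto
        moreover have "k < W" using k W_ge_quartic(3) by linarith
        ultimately show "wp W 9 ?body (\<lambda>t. ?I k t \<and> regs t 10 = k) t"
          using k f by (auto simp: base_def fresh_def)
      qed (use s in auto)
      fix t assume t: "?I 0 t"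
      have "2 * B * (2 * B) \<le> Q" "Q \<le> Q * (n + 1)" by (simp_all add: Q_def)
      then have "2 * B * (2 * B) < W" "Q < W" using Q_less by linarith+
      then show "wp W 4 [Op Add 15 3 3, Op Add 16 3 2, Op Mul 4 15 15, Op Mul 4 4 16]
          (\<lambda>t. prepared lev t \<and> fresh t \<and> regs t 4 = Q) t"
        using t W_ge_quartic(3) B_le
        by (auto simp: base_def fresh_def prepared_def Q_def algebra_simps)
    qed simp
  qed simp
qed

section \<open>Stages, kept edges and the construction of the graph of a call\<close>

definition stage_r :: "nat \<Rightarrow> nat" where "stage_r x = x mod (B + 1)"
definition stage_k :: "nat \<Rightarrow> nat" where "stage_k x = x div (B + 1) mod (2 * B)"
definition stage_l :: "nat \<Rightarrow> nat" where "stage_l x = x div (B + 1) div (2 * B)"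

text \<open>Bit \<open>k div 2\<close> of \<open>v\<close>, complemented if \<open>k\<close> is odd.\<close>

definition wbit :: "nat \<Rightarrow> nat \<Rightarrow> nat" where
  "wbit k v = (drop_bit (k div 2) v + k) mod 2"

text \<open>The parts of the tripartition have codes 2, 1 and 4, the last one being the part from which
  only the vertices of level at least \<open>stage_r x\<close> are used; the sum of the codes of two ends
  then tells whether an edge joins different parts, and which.\<close>

definition code :: "nat \<Rightarrow> (nat \<Rightarrow> nat) \<Rightarrow> nat \<Rightarrow> nat" where
  "code x lev v = (if wbit (stage_k x) v = 0 then 2 else if wbit (stage_l x) v = 0 then 1
     else if lev v < stage_r x then 0 else 4)"

definition edge_code :: "nat \<Rightarrow> (nat \<Rightarrow> nat) \<Rightarrow> nat \<Rightarrow> nat" where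
  "edge_code x lev i = code x lev (fst (es ! i)) + code x lev (snd (es ! i))"

text \<open>Only targets, with code sum 3, are dropped once found. An edge to the apex part, with
  sum 5 or 6, may still be a side of a triangle through another target.\<close>

definition kept :: "nat \<Rightarrow> (nat \<Rightarrow> nat) \<Rightarrow> nat set \<Rightarrow> nat \<Rightarrow> bool" where
  "kept x lev F i \<longleftrightarrow> edge_code x lev i = 3 \<and> i \<notin> F \<or> edge_code x lev i = 5 \<or> edge_code x lev i = 6"

text \<open>A discarded edge is replaced by one between two new vertices, which keeps the number of edges.\<close>

definition slot :: "nat \<Rightarrow> (nat \<Rightarrow> nat) \<Rightarrow> nat set \<Rightarrow> nat \<Rightarrow> nat \<times> nat" where
  "slot x lev F i = (if kept x lev F i then es ! i else (n + 2 * i, n + 2 * i + 1))"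

lemma stage_bounds:
  assumes "x < Q"
  shows "stage_r x \<le> B" "stage_k x < 2 * B" "stage_l x < 2 * B" "0 < B"
proof -
  show "0 < B" using assms by (cases "B = 0") (auto simp: Q_def)
  then show "stage_r x \<le> B" "stage_k x < 2 * B"
    by (simp_all add: stage_r_def stage_k_def less_Suc_eq_le[symmetric])
  show "stage_l x < 2 * B"
    using assms unfolding stage_l_def Q_def
    by (simp add: less_mult_imp_div_less mult.assoc mult.commute mult.left_commute del: mult_Suc_right)
qed

definition core :: "(nat \<Rightarrow> nat) \<Rightarrow> nat set \<Rightarrow> nat \<Rightarrow> state \<Rightarrow> bool" where
  "core lev F q s \<longleftrightarrow> prepared lev s \<and> regs s 4 = q \<and> (\<forall>i<m. mem s 4 i = of_bool (i \<in> F))"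

text \<open>With no stamp above the call counter, raising the counter by one makes all arrays of the
  subroutine read as zero.\<close>

definition stamped :: "nat \<Rightarrow> state \<Rightarrow> bool" where
  "stamped c s \<longleftrightarrow> (\<forall>a j. mem s (11 + 2 * a) j \<le> c)"

definition between_rounds :: "(nat \<Rightarrow> nat) \<Rightarrow> nat set \<Rightarrow> nat \<Rightarrow> nat \<Rightarrow> state \<Rightarrow> bool" where
  "between_rounds lev F q c s \<longleftrightarrow> core lev F q s \<and> regs s 5 = c \<and> stamped c s"

definition in_round :: "(nat \<Rightarrow> nat) \<Rightarrow> nat set \<Rightarrow> nat \<Rightarrow> nat \<Rightarrow> state \<Rightarrow> bool" where
  "in_round lev F x c s \<longleftrightarrow> core lev F (Suc x) s \<and> regs s 5 = Suc c \<and>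
     regs s 18 = stage_r x \<and> regs s 19 = stage_k x \<and> regs s 20 = stage_l x \<and>
     regs s 21 = 3 \<and> regs s 22 = 5 \<and> regs s 23 = 6 \<and>
     regs s 25 = stage_k x div 2 \<and> regs s 26 = stage_l x div 2 \<and> regs s 27 = 2"

lemmas in_round_defs = in_round_def core_def prepared_def base_def

text \<open>Frame rule for the inside of a round: the excepted registers and all arrays from 5 on
  are scratch space.\<close>

lemma in_round_cong:
  assumes "in_round lev F x c s"
    and "\<And>y. y \<notin> {6, 7, 9, 10, 11, 12, 13, 14, 28} \<Longrightarrow> y < 50 \<Longrightarrow> regs t y = regs s y"
    and "\<And>a. a < 5 \<Longrightarrow> mem t a = mem s a" and "outp t = outp s"
  shows "in_round lev F x c t"
  using assms(1) by (simp add: in_round_defs assms(2-))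

lemma decode_wp:
  assumes "between_rounds lev F (Suc x) c s" "x < Q" "Suc c < W"
  shows "wp W 12 decode_prog (\<lambda>t. in_round lev F x c t \<and> stamped c t) s"
proof -
  have c: "core lev F (Suc x) s" "regs s 5 = c" "stamped c s"
    using assms by (simp_all add: between_rounds_def)
  have "Q \<le> Q * (n + 1)" by simp
  then have x: "x < W" using assms(2) Q_less by linarith
  have le: "y < W" if "y \<le> x" for y using that x by simp
  have lt: "x mod Suc B < W" "x div Suc B < W" "x div Suc B mod (2 * B) < W"
    "x div Suc B div (2 * B) < W" "drop_bit (Suc 0) (x div Suc B mod (2 * B)) < W"
    "drop_bit (Suc 0) (x div Suc B div (2 * B)) < W"
    unfolding drop_bit_eq_div by (meson le div_le_dividend mod_less_eq_dividend le_trans)+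
  have "1 < W" "2 < W" "3 < W" "5 < W" "6 < W" using W_ge_quartic(3) by linarith+
  with c x lt show ?thesis
    unfolding decode_prog_def
    by (simp add: in_round_defs stage_r_def stage_k_def stage_l_def drop_bit_eq_div stamped_def assms(3))
qed

lemma codes_wp:
  assumes "in_round lev F x c s" "stamped c s" "x < Q"
  shows "wp W (n * 18 + 2) codes_prog
    (\<lambda>t. in_round lev F x c t \<and> stamped c t \<and> (\<forall>v<n. mem t 5 v = code x lev v)) s"
proof -
  let ?I = "\<lambda>k (t::state). in_round lev F x c t \<and> stamped c t \<and> (\<forall>v<n. k \<le> v \<longrightarrow> mem t 5 v = code x lev v)"
  note st = stage_bounds[OF assms(3)]
  have W: "1 < W" "2 < W" "4 < W" "n < W" using W_ge_quartic(3) by linarith+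
  show ?thesis
    unfolding codes_prog_def
  proof (rule wp_seq[where ?\<tau>1.0 = 1 and ?\<tau>2.0 = "n * (17 + 1) + 1" and P = "\<lambda>t. ?I n t \<and> regs t 10 = n"])
    show "wp W 1 [Op Add 10 0 8] (\<lambda>t. ?I n t \<and> regs t 10 = n) s"
      using assms W by (simp add: in_round_defs stamped_def)
    fix t :: state assume t: "?I n t \<and> regs t 10 = n"
    show "wp W (n * (17 + 1) + 1) [While 10 [Op Sub 10 10 2,
     Op Shr 11 10 25, Op Add 11 11 19, Op Mod 11 11 27,
     Op Shr 12 10 26, Op Add 12 12 20, Op Mod 12 12 27, Const 14 2,
     If 11 [Const 14 1, If 12 [Const 14 4, Load 13 3 10, Op Less 13 13 18, If 13 [Const 14 0] []] []] [],
     Store 5 10 14]] (\<lambda>t. in_round lev F x c t \<and> stamped c t \<and> (\<forall>v<n. mem t 5 v = code x lev v)) t"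
    proof (rule wp_mono[OF wp_count[where I = ?I and x = 10 and N = n]])
      fix k and u :: state assume I: "?I (Suc k) u" and k: "k < n" "regs u 10 = Suc k"
      have le: "drop_bit j k \<le> k" for j by (simp add: drop_bit_eq_div)
      have lt: "k < W" "drop_bit (stage_k x div 2) k < W" "drop_bit (stage_l x div 2) k < W"
        "drop_bit (stage_k x div 2) k + stage_k x < W" "drop_bit (stage_l x div 2) k + stage_l x < W"
        using le[of "stage_k x div 2"] le[of "stage_l x div 2"] k(1) st B_le W_ge_quartic(3) by linarith+
      have md: "y mod 2 < W" for y using W by (meson mod_less_divisor less_trans pos2)
      have wb: "(drop_bit (j div 2) v + j) mod 2 = wbit j v" for j v by (simp add: wbit_def)
      have ob: "of_bool b < W" for b using W by (cases b) simp_all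
      have wb': "wbit j v < W" for j v using md by (simp add: wbit_def)
      have codes: "mem u 5 v = code x lev v" if "v < n" "k \<le> v" "v \<noteq> k" for v
        using I that by simp
      have I': "in_round lev F x c u" "stamped c u" using I by auto
      show "wp W 17 [Op Sub 10 10 2, Op Shr 11 10 25, Op Add 11 11 19, Op Mod 11 11 27,
        Op Shr 12 10 26, Op Add 12 12 20, Op Mod 12 12 27, Const 14 2,
        If 11 [Const 14 1, If 12 [Const 14 4, Load 13 3 10, Op Less 13 13 18, If 13 [Const 14 0] []] []] [],
        Store 5 10 14] (\<lambda>t. ?I k t \<and> regs t 10 = k) u"
        using I' k lt W
        by (simp add: in_round_defs stamped_def wb wb' ob codes code_def[of x lev k])
    qed (use t in auto)
  qed simp
qed

lemma clear_wp:
  assumes "in_round lev F x c s" "stamped c s" "\<forall>v<n. mem s 5 v = code x lev v"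
  shows "wp W (3 * (n + 2 * m) + 3) clear_prog
    (\<lambda>t. in_round lev F x c t \<and> stamped c t \<and> (\<forall>v<n. mem t 5 v = code x lev v) \<and>
       (\<forall>v<n + 2 * m. mem t 6 v = 0)) s"
proof -
  let ?I = "\<lambda>k (t::state). in_round lev F x c t \<and> stamped c t \<and> (\<forall>v<n. mem t 5 v = code x lev v) \<and>
    (\<forall>v<n + 2 * m. k \<le> v \<longrightarrow> mem t 6 v = 0)"
  have W: "1 < W" "m + m < W" "m + m + n < W" using W_ge_quartic(3) by linarith+
  show ?thesis
    unfolding clear_prog_def
  proof (rule wp_seq[where ?\<tau>1.0 = 2 and ?\<tau>2.0 = "(n + 2 * m) * (2 + 1) + 1"
        and P = "\<lambda>t. ?I (n + 2 * m) t \<and> regs t 10 = n + 2 * m"])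
    show "wp W 2 [Op Add 10 1 1, Op Add 10 10 0] (\<lambda>t. ?I (n + 2 * m) t \<and> regs t 10 = n + 2 * m) s"
      using assms W by (simp add: in_round_defs stamped_def)
    fix t :: state assume t: "?I (n + 2 * m) t \<and> regs t 10 = n + 2 * m"
    show "wp W ((n + 2 * m) * (2 + 1) + 1) [While 10 [Op Sub 10 10 2, Store 6 10 8]]
      (\<lambda>t. in_round lev F x c t \<and> stamped c t \<and> (\<forall>v<n. mem t 5 v = code x lev v) \<and>
       (\<forall>v<n + 2 * m. mem t 6 v = 0)) t"
    proof (rule wp_mono[OF wp_count[where I = ?I and x = 10 and N = "n + 2 * m"]])
      fix k and u :: state assume I: "?I (Suc k) u" and k: "k < n + 2 * m" "regs u 10 = Suc k"
      have "k < W" using k W_ge_quartic(3) by linarith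
      moreover have "\<forall>v<n + 2 * m. k \<le> v \<longrightarrow> ((mem u 6)(k := 0)) v = 0"
        using I by (auto simp: Suc_le_eq)
      ultimately show "wp W 2 [Op Sub 10 10 2, Store 6 10 8] (\<lambda>t. ?I k t \<and> regs t 10 = k) u"
        using I k by (simp add: in_round_defs stamped_def)
    qed (use t in auto)
  qed simp
qed

lemma select_wp:
  assumes "in_round lev F x c s" "\<forall>v<n. mem s 5 v = code x lev v" "i < m" "regs s 10 = Suc i"
  shows "wp W 20 select_prog (\<lambda>t. in_round lev F x c t \<and> regs t 6 = regs s 6 \<and> mem t = mem s \<and>
    regs t 10 = i \<and> regs t 11 = fst (slot x lev F i) \<and> regs t 12 = snd (slot x lev F i)) s"
proof -
  have W: "i < W" "i + i < W" "i + i + n < W" "Suc (i + i + n) < W" "1 < W" "2 < W" "3 < W"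
    using assms(3) W_ge_quartic(3) by linarith+
  have "code x lev v \<le> 4" for v by (simp add: code_def)
  from this[of "fst (es ! i)"] this[of "snd (es ! i)"] have "edge_code x lev i \<le> 8"
    unfolding edge_code_def by linarith
  then have ecW: "edge_code x lev i < W" using W_ge_quartic(3) by linarith
  have ec': "code x lev (fst (es ! i)) + code x lev (snd (es ! i)) = edge_code x lev i"
    by (simp add: edge_code_def)
  show ?thesis
    unfolding select_prog_def
    using assms W ecW
    by (simp add: in_round_defs ec' ends_less slot_def kept_def)
qed

text \<open>Arrays 6, shifted by one, and 7 are mutually inverse bijections between the set
  \<open>D\<close> of vertices named so far and the numbers below register 6.\<close>

definition names :: "nat set \<Rightarrow> state \<Rightarrow> bool" where
  "names D s \<longleftrightarrow> (\<forall>v\<in>D. \<exists>j<regs s 6. mem s 6 v = Suc j \<and> mem s 7 j = v) \<and>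
     (\<forall>v<n + 2 * m. v \<notin> D \<longrightarrow> mem s 6 v = 0) \<and>
     (\<forall>j<regs s 6. mem s 7 j \<in> D \<and> mem s 6 (mem s 7 j) = Suc j)"

lemma rename_wp:
  assumes "names D s" "regs s u = v" "v < n + 2 * m" "u \<noteq> 6" "u \<noteq> 13" "Suc (regs s 6) < W"
    "regs s 2 = 1" "regs s 8 = 0"
  shows "wp W 7 (rename_prog u) (\<lambda>t. names (insert v D) t \<and> regs t 13 < regs t 6 \<and>
    mem t 7 (regs t 13) = v \<and> regs s 6 \<le> regs t 6 \<and> regs t 6 \<le> Suc (regs s 6) \<and>
    (\<forall>j<regs s 6. mem t 7 j = mem s 7 j) \<and> (\<forall>x. x \<noteq> 6 \<longrightarrow> x \<noteq> 13 \<longrightarrow> regs t x = regs s x) \<and>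
    (\<forall>a. a \<noteq> 6 \<longrightarrow> a \<noteq> 7 \<longrightarrow> mem t a = mem s a) \<and> outp t = outp s) s"
proof (cases "v \<in> D")
  case True
  then obtain j where j: "j < regs s 6" "mem s 6 v = Suc j" "mem s 7 j = v"
    using assms(1) by (auto simp: names_def)
  have "names (insert v D) (set_reg 13 j (set_reg 13 (Suc j) s))"
    using assms(1) True by (simp add: names_def insert_absorb)
  then show ?thesis
    using assms j by (simp add: rename_prog_def)
next
  case False
  let ?N = "regs s 6"
  let ?t = "s\<lparr>mem := (mem s)(6 := (mem s 6)(v := Suc ?N), 7 := (mem s 7)(?N := v))\<rparr>"
  have 0: "mem s 6 v = 0" using assms(1,3) False by (simp add: names_def)
  have v: "mem s 7 j \<noteq> v" if "j < ?N" for j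
    using assms(1) False that by (auto simp: names_def)
  have D: "\<exists>j<?N. mem s 6 w = Suc j \<and> mem s 7 j = w" if "w \<in> D" for w
    using assms(1) that by (auto simp: names_def)
  have "names (insert v D) t" if "regs t 6 = Suc ?N" "mem t 6 = (mem s 6)(v := Suc ?N)"
      "mem t 7 = (mem s 7)(?N := v)" for t :: state
    unfolding names_def that
  proof (intro conjI ballI allI impI)
    fix w assume "w \<in> insert v D"
    then show "\<exists>j<Suc ?N. ((mem s 6)(v := Suc ?N)) w = Suc j \<and> ((mem s 7)(?N := v)) j = w"
    proof (cases "w = v")
      case False
      with \<open>w \<in> insert v D\<close> D obtain j where "j < ?N" "mem s 6 w = Suc j" "mem s 7 j = w" by blast
      with False show ?thesis by (intro exI[of _ j]) simp
    qed (intro exI[of _ ?N], simp)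
  next
    fix w assume "w < n + 2 * m" "w \<notin> insert v D"
    then show "((mem s 6)(v := Suc ?N)) w = 0"
      using assms(1) by (auto simp: names_def)
  next
    fix j assume j: "j < Suc ?N"
    show "((mem s 7)(?N := v)) j \<in> insert v D"
      "((mem s 6)(v := Suc ?N)) (((mem s 7)(?N := v)) j) = Suc j"
      using j assms(1) v[of j] by (auto simp: names_def less_Suc_eq)
  qed
  then show ?thesis
    using assms 0 by (simp add: rename_prog_def)
qed

lemma slot_less:
  assumes "i < m"
  shows "fst (slot x lev F i) < n + 2 * m" "snd (slot x lev F i) < n + 2 * m"
  using assms ends_less[OF assms] by (auto simp: slot_def)

text \<open>The edges from \<open>k\<close> on have been written. The last clause says exactly which
  cells carry the current stamp; all others read as zero, as \<open>input\<close> demands.\<close>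

definition built :: "nat \<Rightarrow> (nat \<Rightarrow> nat) \<Rightarrow> nat set \<Rightarrow> nat \<Rightarrow> nat \<Rightarrow> state \<Rightarrow> bool" where
  "built x lev F c k s \<longleftrightarrow> in_round lev F x c s \<and> (\<forall>v<n. mem s 5 v = code x lev v) \<and>
     names (\<Union>i\<in>{k..<m}. ends_of (slot x lev F i)) s \<and> regs s 6 \<le> 2 * (m - k) \<and>
     (\<forall>i<m. k \<le> i \<longrightarrow> mem s 10 i < regs s 6 \<and> mem s 7 (mem s 10 i) = fst (slot x lev F i) \<and>
        mem s 12 i < regs s 6 \<and> mem s 7 (mem s 12 i) = snd (slot x lev F i)) \<and>
     (\<forall>a j. mem s (11 + 2 * a) j \<le> Suc c) \<and>
     (\<forall>a j. mem s (11 + 2 * a) j = Suc c \<longleftrightarrow> a < 2 \<and> k \<le> j \<and> j < m)"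

lemma in_round_regs:
  assumes "in_round lev F x c s"
  shows "regs s 0 = n" "regs s 1 = m" "regs s (Suc 0) = m" "regs s 2 = 1" "regs s 8 = 0" "regs s 4 = Suc x"
    "regs s 5 = Suc c" "regs s 21 = 3" "regs s 27 = 2"
  using assms by (simp_all add: in_round_defs)

lemma build_step:
  assumes "built x lev F c (Suc k) s" "k < m" "regs s 10 = Suc k"
  shows "wp W 38 (select_prog @ rename_prog 11 @ [Store 10 10 13, Store 11 10 5] @
      rename_prog 12 @ [Store 12 10 13, Store 13 10 5])
    (\<lambda>t. built x lev F c k t \<and> regs t 10 = k) s"
proof -
  let ?u = "fst (slot x lev F k)" and ?v = "snd (slot x lev F k)"
  let ?D = "\<Union>i\<in>{Suc k..<m}. ends_of (slot x lev F i)" and ?N = "regs s 6"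
  have s: "in_round lev F x c s" "\<forall>v<n. mem s 5 v = code x lev v" "names ?D s" "?N \<le> 2 * (m - Suc k)"
    and arr: "\<And>i. i < m \<Longrightarrow> Suc k \<le> i \<Longrightarrow> mem s 10 i < ?N \<and> mem s 7 (mem s 10 i) = fst (slot x lev F i) \<and>
        mem s 12 i < ?N \<and> mem s 7 (mem s 12 i) = snd (slot x lev F i)"
    and le: "\<And>a j. mem s (11 + 2 * a) j \<le> Suc c"
    and stamp: "\<And>a j. mem s (11 + 2 * a) j = Suc c \<longleftrightarrow> a < 2 \<and> Suc k \<le> j \<and> j < m"
    using assms(1) by (auto simp: built_def)
  have N: "Suc (Suc ?N) \<le> 2 * (m - k)" using s(4) assms(2) by linarith
  then have NW: "Suc (Suc ?N) < W" using W_ge_quartic(3) by linarith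
  \<comment> \<open>\<open>P1\<close> to \<open>P4\<close> describe the states after selecting the
    edge, naming its first end, storing it, and naming its second end. The first name survives the
    second renaming because array 7 only grows beyond its used part.\<close>
  define P1 where "P1 = (\<lambda>t::state. in_round lev F x c t \<and> mem t = mem s \<and> regs t 6 = ?N \<and>
    regs t 10 = k \<and> regs t 11 = ?u \<and> regs t 12 = ?v)"
  define P2 where "P2 = (\<lambda>t::state. in_round lev F x c t \<and> names (insert ?u ?D) t \<and>
    regs t 13 < regs t 6 \<and> mem t 7 (regs t 13) = ?u \<and> ?N \<le> regs t 6 \<and> regs t 6 \<le> Suc ?N \<and>
    (\<forall>j<?N. mem t 7 j = mem s 7 j) \<and> regs t 10 = k \<and> regs t 12 = ?v \<and>
    (\<forall>a. a \<noteq> 6 \<longrightarrow> a \<noteq> 7 \<longrightarrow> mem t a = mem s a))"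
  define P3 where "P3 = (\<lambda>t::state. in_round lev F x c t \<and> names (insert ?u ?D) t \<and>
    ?N \<le> regs t 6 \<and> regs t 6 \<le> Suc ?N \<and> (\<forall>j<?N. mem t 7 j = mem s 7 j) \<and> regs t 10 = k \<and> regs t 12 = ?v \<and>
    (\<exists>a<regs t 6. mem t 7 a = ?u \<and> mem t 10 = (mem s 10)(k := a)) \<and> mem t 11 = (mem s 11)(k := Suc c) \<and>
    (\<forall>a. a \<noteq> 6 \<longrightarrow> a \<noteq> 7 \<longrightarrow> a \<noteq> 10 \<longrightarrow> a \<noteq> 11 \<longrightarrow> mem t a = mem s a))"
  define P4 where "P4 = (\<lambda>t::state. in_round lev F x c t \<and> names (insert ?v (insert ?u ?D)) t \<and>
    regs t 13 < regs t 6 \<and> mem t 7 (regs t 13) = ?v \<and> ?N \<le> regs t 6 \<and> regs t 6 \<le> Suc (Suc ?N) \<and>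
    (\<forall>j<?N. mem t 7 j = mem s 7 j) \<and> regs t 10 = k \<and>
    (\<exists>a<regs t 6. mem t 7 a = ?u \<and> mem t 10 = (mem s 10)(k := a)) \<and> mem t 11 = (mem s 11)(k := Suc c) \<and>
    (\<forall>a. a \<noteq> 6 \<longrightarrow> a \<noteq> 7 \<longrightarrow> a \<noteq> 10 \<longrightarrow> a \<noteq> 11 \<longrightarrow> mem t a = mem s a))"
  show ?thesis
  proof (rule wp_seq[where ?\<tau>1.0 = 20 and ?\<tau>2.0 = 18 and P = P1])
    show "wp W 20 select_prog P1 s"
      using select_wp[OF s(1,2) assms(2,3)] by (rule wp_mono) (auto simp: P1_def)
    fix t1 assume t1: "P1 t1"
    show "wp W 18 (rename_prog 11 @ [Store 10 10 13, Store 11 10 5] @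
      rename_prog 12 @ [Store 12 10 13, Store 13 10 5])
      (\<lambda>t. built x lev F c k t \<and> regs t 10 = k) t1"
    proof (rule wp_seq[where ?\<tau>1.0 = 7 and ?\<tau>2.0 = 11 and P = P2])
      have r: "regs t1 2 = 1" "regs t1 8 = 0" "in_round lev F x c t1"
        "regs t1 11 = ?u" "regs t1 12 = ?v" "regs t1 10 = k" "regs t1 6 = ?N" "mem t1 = mem s"
        using t1 in_round_regs(4,5)[of lev F x c t1] by (simp_all add: P1_def)
      have nm: "names ?D t1" using s(3) r by (simp add: names_def)
      show "wp W 7 (rename_prog 11) P2 t1"
      proof (rule wp_mono[OF rename_wp[OF nm r(4) slot_less(1)[OF assms(2)]]])
        fix t :: state
        assume *: "names (insert ?u ?D) t \<and> regs t 13 < regs t 6 \<and>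
          mem t 7 (regs t 13) = ?u \<and> regs t1 6 \<le> regs t 6 \<and> regs t 6 \<le> Suc (regs t1 6) \<and>
          (\<forall>j<regs t1 6. mem t 7 j = mem t1 7 j) \<and> (\<forall>x. x \<noteq> 6 \<longrightarrow> x \<noteq> 13 \<longrightarrow> regs t x = regs t1 x) \<and>
          (\<forall>a. a \<noteq> 6 \<longrightarrow> a \<noteq> 7 \<longrightarrow> mem t a = mem t1 a) \<and> outp t = outp t1"
        then have "in_round lev F x c t"
          by (intro in_round_cong[OF r(3)]) auto
        with * r show "P2 t" by (simp add: P2_def)
      qed (use r NW in auto)
      fix t2 assume t2: "P2 t2"
      show "wp W 11 ([Store 10 10 13, Store 11 10 5] @ rename_prog 12 @ [Store 12 10 13, Store 13 10 5])
        (\<lambda>t. built x lev F c k t \<and> regs t 10 = k) t2"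
      proof (rule wp_seq[where ?\<tau>1.0 = 2 and ?\<tau>2.0 = 9 and P = P3])
        have r: "regs t2 5 = Suc c" using t2 by (simp add: P2_def in_round_def)
        define t3 where "t3 = t2\<lparr>mem := (mem t2)(10 := (mem t2 10)(k := regs t2 13), 11 := (mem t2 11)(k := Suc c))\<rparr>"
        have t3: "regs t3 = regs t2" "mem t3 10 = (mem s 10)(k := regs t2 13)"
          "mem t3 11 = (mem s 11)(k := Suc c)" "outp t3 = outp t2"
          "\<And>a. a \<noteq> 10 \<Longrightarrow> a \<noteq> 11 \<Longrightarrow> mem t3 a = mem t2 a"
          using t2 by (simp_all add: t3_def P2_def)
        have "in_round lev F x c t3"
          by (rule in_round_cong[of lev F x c t2]) (use t2 in \<open>auto simp: P2_def t3\<close>)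
        moreover have "names (insert ?u ?D) t3"
          using t2 by (simp add: P2_def names_def t3)
        ultimately have "P3 t3"
          using t2 unfolding P2_def P3_def by (auto simp: t3)
        then show "wp W 2 [Store 10 10 13, Store 11 10 5] P3 t2"
          using t2 r by (simp add: P2_def t3_def)
        fix t3 assume t3: "P3 t3"
        show "wp W 9 (rename_prog 12 @ [Store 12 10 13, Store 13 10 5])
          (\<lambda>t. built x lev F c k t \<and> regs t 10 = k) t3"
        proof (rule wp_seq[where ?\<tau>1.0 = 7 and ?\<tau>2.0 = 2 and P = P4])
          have r: "regs t3 2 = 1" "regs t3 8 = 0" "in_round lev F x c t3"
            "regs t3 12 = ?v" "regs t3 10 = k" "?N \<le> regs t3 6" "regs t3 6 \<le> Suc ?N" "names (insert ?u ?D) t3"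
            using t3 in_round_regs(4,5)[of lev F x c t3] by (simp_all add: P3_def)
          obtain a where a: "a < regs t3 6" "mem t3 7 a = ?u" "mem t3 10 = (mem s 10)(k := a)"
            using t3 by (auto simp: P3_def)
          show "wp W 7 (rename_prog 12) P4 t3"
          proof (rule wp_mono[OF rename_wp[OF r(8) r(4) slot_less(2)[OF assms(2)]]])
            fix t :: state
            assume *: "names (insert ?v (insert ?u ?D)) t \<and> regs t 13 < regs t 6 \<and>
              mem t 7 (regs t 13) = ?v \<and> regs t3 6 \<le> regs t 6 \<and> regs t 6 \<le> Suc (regs t3 6) \<and>
              (\<forall>j<regs t3 6. mem t 7 j = mem t3 7 j) \<and> (\<forall>x. x \<noteq> 6 \<longrightarrow> x \<noteq> 13 \<longrightarrow> regs t x = regs t3 x) \<and>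
              (\<forall>a. a \<noteq> 6 \<longrightarrow> a \<noteq> 7 \<longrightarrow> mem t a = mem t3 a) \<and> outp t = outp t3"
            then have "in_round lev F x c t"
              by (intro in_round_cong[OF r(3)]) auto
            moreover have "\<exists>a<regs t 6. mem t 7 a = ?u \<and> mem t 10 = (mem s 10)(k := a)"
              using a * by (intro exI[of _ a]) simp
            ultimately show "P4 t" using * t3 r(5-7) by (simp add: P3_def P4_def)
          qed (use r NW in auto)
          fix t4 assume t4: "P4 t4"
          then obtain a where a: "a < regs t4 6" "mem t4 7 a = ?u" "mem t4 10 = (mem s 10)(k := a)"
            by (auto simp: P4_def)
          have r: "regs t4 5 = Suc c" "regs t4 10 = k" using t4 by (simp_all add: P4_def in_round_def)
          define b where "b = regs t4 13"
          have b: "b < regs t4 6" "mem t4 7 b = ?v" using t4 by (simp_all add: P4_def b_def)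
          have u: "?N \<le> regs t4 6" "regs t4 6 \<le> Suc (Suc ?N)" "\<And>j. j < ?N \<Longrightarrow> mem t4 7 j = mem s 7 j"
            "mem t4 11 = (mem s 11)(k := Suc c)"
            "\<And>a. a \<noteq> 6 \<Longrightarrow> a \<noteq> 7 \<Longrightarrow> a \<noteq> 10 \<Longrightarrow> a \<noteq> 11 \<Longrightarrow> mem t4 a = mem s a"
            "names (insert ?v (insert ?u ?D)) t4"
            using t4 by (simp_all add: P4_def)
          define t where "t = t4\<lparr>mem := (mem t4)(12 := (mem t4 12)(k := b), 13 := (mem t4 13)(k := Suc c))\<rparr>"
          have t: "regs t = regs t4" "mem t 10 = (mem s 10)(k := a)" "mem t 11 = (mem s 11)(k := Suc c)"
            "mem t 12 = (mem s 12)(k := b)" "mem t 13 = (mem s 13)(k := Suc c)" "outp t = outp t4"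
            "mem t 7 = mem t4 7" "mem t 6 = mem t4 6"
            "\<And>a. a \<noteq> 12 \<Longrightarrow> a \<noteq> 13 \<Longrightarrow> mem t a = mem t4 a"
            using u by (simp_all add: t_def a)
          have 1: "in_round lev F x c t"
            by (rule in_round_cong[of lev F x c t4]) (use t4 in \<open>auto simp: P4_def t\<close>)
          have "{k..<m} = insert k {Suc k..<m}" using assms(2) by auto
          then have "(\<Union>i\<in>{k..<m}. ends_of (slot x lev F i)) = insert ?v (insert ?u ?D)"
            by (simp add: ends_of_def insert_commute)
          then have 2: "names (\<Union>i\<in>{k..<m}. ends_of (slot x lev F i)) t"
            using u(6) by (simp add: names_def t)
          have 3: "mem t 10 i < regs t 6 \<and> mem t 7 (mem t 10 i) = fst (slot x lev F i) \<and>
             mem t 12 i < regs t 6 \<and> mem t 7 (mem t 12 i) = snd (slot x lev F i)" if "i < m" "k \<le> i" for i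
          proof (cases "i = k")
            case True
            then show ?thesis using a b by (simp add: t)
          next
            case False
            then have "mem s 10 i < ?N" "mem s 7 (mem s 10 i) = fst (slot x lev F i)"
              "mem s 12 i < ?N" "mem s 7 (mem s 12 i) = snd (slot x lev F i)"
              using arr[of i] that by auto
            then show ?thesis using False u(1,3) by (simp add: t)
          qed
          have st: "mem t (11 + 2 * a) j = (if a < 2 \<and> j = k then Suc c else mem s (11 + 2 * a) j)" for a j
          proof (cases "a < 2")
            case True
            then have "a = 0 \<or> a = 1" by auto
            then show ?thesis by (auto simp: t)
          next
            case False
            then have "mem t (11 + 2 * a) = mem s (11 + 2 * a)"
              by (subst t(9)) (auto simp: u(5))
            with False show ?thesis by simp
          qed
          have "built x lev F c k t"
            unfolding built_def
          proof (intro conjI allI impI)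
            show "mem t 5 v = code x lev v" if "v < n" for v using s(2) that by (simp add: t(9) u(5))
            show "regs t 6 \<le> 2 * (m - k)" using u(2) N by (simp add: t)
            show "mem t (11 + 2 * a) j \<le> Suc c" for a j using le by (simp add: st)
            show "mem t (11 + 2 * a) j = Suc c \<longleftrightarrow> a < 2 \<and> k \<le> j \<and> j < m" for a j
              using assms(2) by (auto simp: st stamp)
          qed (use 1 2 3 in auto)
          then show "wp W 2 [Store 12 10 13, Store 13 10 5] (\<lambda>t. built x lev F c k t \<and> regs t 10 = k) t4"
            using r by (simp add: t_def b_def)
        qed simp
      qed simp
    qed simp
  qed simp
qed

lemma build_wp:
  assumes "in_round lev F x c s" "stamped c s" "\<forall>v<n. mem s 5 v = code x lev v"
    "\<forall>v<n + 2 * m. mem s 6 v = 0"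
  shows "wp W (39 * m + 3) build_prog (built x lev F c 0) s"
  unfolding build_prog_def
proof (rule wp_seq[where ?\<tau>1.0 = 2 and ?\<tau>2.0 = "m * (38 + 1) + 1"])
  have W: "0 < W" "m < W" using W_ge_quartic(3) by linarith+
  define t where "t = set_reg 10 m (set_reg 6 0 s)"
  have "in_round lev F x c t"
    by (rule in_round_cong[OF assms(1)]) (auto simp: t_def)
  moreover have "mem t (11 + 2 * a) j \<noteq> Suc c" for a j
    using assms(2) unfolding stamped_def t_def by (metis mem_set_reg not_less_eq_eq order_refl)
  ultimately have "built x lev F c m t"
    using assms(2-4) by (auto simp: built_def names_def t_def stamped_def intro: le_SucI)
  then show "wp W 2 [Const 6 0, Op Add 10 1 8] (\<lambda>t. built x lev F c m t \<and> regs t 10 = m) s"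
    using assms(1) W by (simp add: t_def in_round_defs)
  show "wp W (m * (38 + 1) + 1) [While 10 (select_prog @ rename_prog 11 @ [Store 10 10 13, Store 11 10 5] @
      rename_prog 12 @ [Store 12 10 13, Store 13 10 5])] (built x lev F c 0) t"
    if "built x lev F c m t \<and> regs t 10 = m" for t
    by (rule wp_count) (use that build_step in auto)
qed simp

definition call_edges :: "state \<Rightarrow> (nat \<times> nat) list" where
  "call_edges s = map (\<lambda>i. (mem s 10 i, mem s 12 i)) [0..<m]"

definition stage_graph :: "nat \<Rightarrow> (nat \<Rightarrow> nat) \<Rightarrow> nat set \<Rightarrow> nat set set" where
  "stage_graph x lev F = {ends_of (es ! i) |i. i < m \<and> kept x lev F i}"

lemma built_names:
  assumes "built x lev F c 0 s"
  shows "inj_on (mem s 7) {..<regs s 6}"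
    and "j < regs s 6 \<Longrightarrow> \<exists>i<m. mem s 7 j \<in> ends_of (slot x lev F i)"
    and "i < m \<Longrightarrow> mem s 10 i < regs s 6 \<and> mem s 7 (mem s 10 i) = fst (slot x lev F i) \<and>
      mem s 12 i < regs s 6 \<and> mem s 7 (mem s 12 i) = snd (slot x lev F i)"
proof -
  have *: "names (\<Union>i\<in>{0..<m}. ends_of (slot x lev F i)) s" using assms by (simp add: built_def)
  then show "inj_on (mem s 7) {..<regs s 6}"
    unfolding names_def inj_on_def by (metis lessThan_iff old.nat.inject)
  show "\<exists>i<m. mem s 7 j \<in> ends_of (slot x lev F i)" if "j < regs s 6"
    using * that by (fastforce simp: names_def)
  show "i < m \<Longrightarrow> mem s 10 i < regs s 6 \<and> mem s 7 (mem s 10 i) = fst (slot x lev F i) \<and>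
      mem s 12 i < regs s 6 \<and> mem s 7 (mem s 12 i) = snd (slot x lev F i)"
    using assms by (simp add: built_def)
qed

lemma slot_neq: "i < m \<Longrightarrow> fst (slot x lev F i) \<noteq> snd (slot x lev F i)"
  using ends_neq by (simp add: slot_def)

lemma slot_inj:
  assumes "i < m" "j < m" "ends_of (slot x lev F i) = ends_of (slot x lev F j)"
  shows "i = j"
proof -
  have new: "n + 2 * i' \<notin> ends_of (es ! j')" if "j' < m" for i' j'
    using ends_less[OF that] by (auto simp: ends_of_def)
  have "n + 2 * i' \<in> ends_of (n + 2 * i', n + 2 * i' + 1)" for i'
    by (simp add: ends_of_def)
  then have ne: "ends_of (n + 2 * i', n + 2 * i' + 1) \<noteq> ends_of (es ! j')" if "j' < m" for i' j'
    using new[OF that] by metis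
  have "ends_of (n + 2 * i, n + 2 * i + 1) = ends_of (n + 2 * j, n + 2 * j + 1) \<Longrightarrow> i = j"
    by (auto simp: ends_of_def doubleton_eq_iff)
  then show ?thesis
    using assms(3) ends_inj[OF assms(1,2)] ne[OF assms(1)] ne[OF assms(2)]
    unfolding slot_def by (cases "kept x lev F i"; cases "kept x lev F j") force+
qed

lemma call_edges_nth:
  "i < m \<Longrightarrow> built x lev F c 0 s \<Longrightarrow> mem s 7 ` ends_of (call_edges s ! i) = ends_of (slot x lev F i)"
  "i < m \<Longrightarrow> built x lev F c 0 s \<Longrightarrow> ends_of (call_edges s ! i) \<subseteq> {..<regs s 6}"
  using built_names(3)[of x lev F c s i] by (auto simp: call_edges_def ends_of_def)

lemma call_represents:
  assumes "built x lev F c 0 s"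
  shows "represents (regs s 6) (call_edges s) (set (map ends_of (call_edges s)))"
    and "card (set (map ends_of (call_edges s))) = m"
proof -
  note nm = built_names[OF assms]
  have len: "length (call_edges s) = m" by (simp add: call_edges_def)
  have inj: "i = j" if "i < m" "j < m" "ends_of (call_edges s ! i) = ends_of (call_edges s ! j)" for i j
    using that slot_inj call_edges_nth(1)[OF _ assms] by metis
  then have d: "distinct (map ends_of (call_edges s))"
    by (auto simp: distinct_conv_nth len)
  then show "card (set (map ends_of (call_edges s))) = m"
    by (metis distinct_card len length_map)
  have ex: "\<exists>i<m. e = ends_of (call_edges s ! i)" if "e \<in> set (map ends_of (call_edges s))" for e
    using that len by (metis (no_types, lifting) in_set_conv_nth length_map nth_map)
  have "card e = 2" if e: "e \<in> set (map ends_of (call_edges s))" for e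
  proof -
    obtain i where i: "i < m" "e = {mem s 10 i, mem s 12 i}"
      using ex[OF e] by (auto simp: call_edges_def ends_of_def)
    then have "mem s 10 i \<noteq> mem s 12 i"
      using nm(3)[of i] slot_neq[of i] by metis
    then show ?thesis using i by simp
  qed
  then have "simple_graph {..<regs s 6} (set (map ends_of (call_edges s)))"
    unfolding simple_graph_def using ex call_edges_nth(2)[OF _ assms] by blast
  \<comment> \<open>Only ends of slots receive names, so every name lies on an edge.\<close>
  moreover have "no_isolated {..<regs s 6} (set (map ends_of (call_edges s)))"
    unfolding no_isolated_def
  proof
    fix j assume "j \<in> {..<regs s 6}"
    then have j: "j < regs s 6" by simp
    then obtain i where i: "i < m" "mem s 7 j \<in> ends_of (slot x lev F i)"
      using nm(2) by blast
    then obtain j' where j': "j' \<in> ends_of (call_edges s ! i)" "mem s 7 j = mem s 7 j'"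
      using call_edges_nth(1)[OF i(1) assms] by (metis imageE)
    then have "j = j'"
      using nm(1) j call_edges_nth(2)[OF i(1) assms] by (metis inj_onD lessThan_iff subsetD)
    with i j' len show "\<exists>e\<in>set (map ends_of (call_edges s)). j \<in> e"
      by (metis image_eqI list.set_map nth_mem)
  qed
  ultimately show "represents (regs s 6) (call_edges s) (set (map ends_of (call_edges s)))"
    using d by (simp add: represents_def)
qed

end

section \<open>Triangles under renaming, and reading triples back\<close>

lemma triangles_pairs:
  assumes "{a, b, c} \<in> triangles E"
  shows "a \<noteq> b" "b \<noteq> c" "a \<noteq> c" "{a, b} \<in> E" "{b, c} \<in> E" "{a, c} \<in> E"
proof -
  obtain x y z where xyz: "{a, b, c} = {x, y, z}" "x \<noteq> y" "y \<noteq> z" "x \<noteq> z"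
    "{x, y} \<in> E" "{y, z} \<in> E" "{x, z} \<in> E"
    using assms by (auto simp: triangles_def)
  then have "card {a, b, c} = 3" by simp
  then show ne: "a \<noteq> b" "b \<noteq> c" "a \<noteq> c"
    by (auto simp: card_insert_if split: if_splits)
  have "a \<in> {x, y, z}" "b \<in> {x, y, z}" "c \<in> {x, y, z}"
    using xyz(1) by blast+
  with ne xyz(5-7) show "{a, b} \<in> E" "{b, c} \<in> E" "{a, c} \<in> E"
    by (auto simp: insert_commute)
qed

lemma trianglesI:
  "a \<noteq> b \<Longrightarrow> b \<noteq> c \<Longrightarrow> a \<noteq> c \<Longrightarrow> {a, b} \<in> E \<Longrightarrow> {b, c} \<in> E \<Longrightarrow> {a, c} \<in> E \<Longrightarrow> {a, b, c} \<in> triangles E"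
  by (auto simp: triangles_def)

lemma triangles_cases:
  assumes "\<Delta> \<in> triangles E"
  obtains a b c where "\<Delta> = {a, b, c}" "a \<noteq> b" "b \<noteq> c" "a \<noteq> c" "{a, b} \<in> E" "{b, c} \<in> E" "{a, c} \<in> E"
  using assms by (auto simp: triangles_def)

lemma triangles_mono: "E \<subseteq> E' \<Longrightarrow> triangles E \<subseteq> triangles E'"
  unfolding triangles_def by blast

lemma triangles_subset_Pow: "triangles E \<subseteq> Pow (\<Union>E)"
  unfolding triangles_def by auto

lemma triangles_image:
  assumes "inj_on g (\<Union>E)"
  shows "triangles ((`) g ` E) = (`) g ` triangles E"
proof (intro equalityI subsetI)
  fix \<Delta> assume "\<Delta> \<in> (`) g ` triangles E"
  then obtain a b c where \<Delta>: "\<Delta> = g ` {a, b, c}" and abc: "a \<noteq> b" "b \<noteq> c" "a \<noteq> c"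
    "{a, b} \<in> E" "{b, c} \<in> E" "{a, c} \<in> E"
    by (auto elim!: triangles_cases)
  then have "a \<in> \<Union>E" "b \<in> \<Union>E" "c \<in> \<Union>E" by blast+
  then have "g a \<noteq> g b" "g b \<noteq> g c" "g a \<noteq> g c"
    using abc(1-3) assms by (auto dest: inj_onD)
  moreover have "{g a, g b} \<in> (`) g ` E" "{g b, g c} \<in> (`) g ` E" "{g a, g c} \<in> (`) g ` E"
    using imageI[OF abc(4), of "(`) g"] imageI[OF abc(5), of "(`) g"] imageI[OF abc(6), of "(`) g"] by simp_all
  ultimately show "\<Delta> \<in> triangles ((`) g ` E)"
    unfolding \<Delta> by (simp add: trianglesI)
next
  fix \<Delta> assume "\<Delta> \<in> triangles ((`) g ` E)"
  then obtain a b c where \<Delta>: "\<Delta> = {a, b, c}" and abc: "a \<noteq> b" "b \<noteq> c" "a \<noteq> c"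
    "{a, b} \<in> (`) g ` E" "{b, c} \<in> (`) g ` E" "{a, c} \<in> (`) g ` E"
    by (auto elim!: triangles_cases)
  let ?h = "inv_into (\<Union>E) g"
  have edge: "{?h x, ?h y} \<in> E" if xy: "{x, y} \<in> (`) g ` E" for x y
  proof -
    obtain e where e: "e \<in> E" "{x, y} = g ` e" using xy by auto
    then have "?h ` g ` e = e" by (intro inv_into_image_cancel[OF assms]) blast
    then have "?h ` {x, y} = e" using e by simp
    then have "{?h x, ?h y} = e" by simp
    with e show ?thesis by simp
  qed
  have "g ` \<Union>E = \<Union>((`) g ` E)" by blast
  with abc(4,5) have img: "a \<in> g ` \<Union>E" "b \<in> g ` \<Union>E" "c \<in> g ` \<Union>E" by blast+
  then have gh: "g (?h a) = a" "g (?h b) = b" "g (?h c) = c"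
    by (simp_all only: f_inv_into_f)
  then have "?h a \<noteq> ?h b" "?h b \<noteq> ?h c" "?h a \<noteq> ?h c"
    using abc(1-3) by metis+
  then have "{?h a, ?h b, ?h c} \<in> triangles E"
    using edge[OF abc(4)] edge[OF abc(5)] edge[OF abc(6)] by (rule trianglesI)
  moreover have "\<Delta> = g ` {?h a, ?h b, ?h c}" using gh \<Delta> by simp
  ultimately show "\<Delta> \<in> (`) g ` triangles E" by blast
qed

lemma nth_concat_triples:
  assumes "j < length ts"
  shows "concat (map (\<lambda>(a, b, c). [a, b, c]) ts) ! (3 * j) = fst (ts ! j)"
    "concat (map (\<lambda>(a, b, c). [a, b, c]) ts) ! (3 * j + 1) = fst (snd (ts ! j))"
    "concat (map (\<lambda>(a, b, c). [a, b, c]) ts) ! (3 * j + 2) = snd (snd (ts ! j))"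
  using assms
proof (induction ts arbitrary: j)
  case (Cons x ts)
  obtain a b c where x: "x = (a, b, c)" by (cases x)
  { case 1 with Cons.IH(1) x show ?case by (cases j) auto }
  { case 2 with Cons.IH(2) x show ?case by (cases j) auto }
  { case 3 with Cons.IH(3) x show ?case by (cases j) auto }
qed auto

lemma length_concat_triples: "length (concat (map (\<lambda>(a, b, c). [a, b, c]) ts)) = 3 * length ts"
  by (induction ts) auto

lemma clear_regs_wp:
  assumes "0 < W"
  shows "wp W R (map (\<lambda>x. Const (50 + x) 0) [0..<R]) (\<lambda>t. (\<forall>x<R. regs t (50 + x) = 0) \<and>
    (\<forall>x<50. regs t x = regs s x) \<and> mem t = mem s \<and> outp t = outp s) s"
proof (induction R)
  case (Suc R)
  have "wp W (R + 1) (map (\<lambda>x. Const (50 + x) 0) [0..<R] @ [Const (50 + R) 0])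
    (\<lambda>t. (\<forall>x<Suc R. regs t (50 + x) = 0) \<and> (\<forall>x<50. regs t x = regs s x) \<and> mem t = mem s \<and> outp t = outp s) s"
    by (rule wp_seq[OF Suc, where ?\<tau>2.0 = 1]) (use assms in \<open>auto simp: less_Suc_eq\<close>)
  then show ?case by simp
qed simp

section \<open>The lister's graph has the triangles of the stage graph\<close>

context graph_input
begin

lemma slot_shared:
  assumes "i < m" "j < m" "i \<noteq> j" "v \<in> ends_of (slot x lev F i)" "v \<in> ends_of (slot x lev F j)"
  shows "kept x lev F i"
proof (rule ccontr)
  assume i: "\<not> kept x lev F i"
  then have v: "v = n + 2 * i \<or> v = n + 2 * i + 1" using assms(4) by (auto simp: slot_def ends_of_def)
  show False
  proof (cases "kept x lev F j")
    case True
    then have "v < n" using assms(5) ends_less[OF assms(2)] by (auto simp: slot_def ends_of_def)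
    with v show False by linarith
  next
    case False
    then have "v = n + 2 * j \<or> v = n + 2 * j + 1" using assms(5) by (auto simp: slot_def ends_of_def)
    with v assms(3) show False by presburger
  qed
qed

text \<open>Each side of a triangle shares an end with another side, whereas a replacement edge
  meets no other edge; so padding adds no triangle.\<close>

lemma slot_triangles:
  "triangles {ends_of (slot x lev F i) |i. i < m} = triangles (stage_graph x lev F)"
proof
  have "stage_graph x lev F \<subseteq> {ends_of (slot x lev F i) |i. i < m}"
    unfolding stage_graph_def by (auto simp: slot_def)
  then show "triangles (stage_graph x lev F) \<subseteq> triangles {ends_of (slot x lev F i) |i. i < m}"
    by (rule triangles_mono)
  have kept: "e \<in> stage_graph x lev F"
    if e: "e \<in> {ends_of (slot x lev F i) |i. i < m}" "e' \<in> {ends_of (slot x lev F i) |i. i < m}" "e \<noteq> e'"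
      "v \<in> e" "v \<in> e'" for e e' v
  proof -
    obtain i j where ij: "i < m" "j < m" "e = ends_of (slot x lev F i)" "e' = ends_of (slot x lev F j)"
      using e(1,2) by auto
    with e have "kept x lev F i" using slot_shared[of i j] by auto
    with ij show ?thesis by (auto simp: stage_graph_def slot_def)
  qed
  show "triangles {ends_of (slot x lev F i) |i. i < m} \<subseteq> triangles (stage_graph x lev F)"
  proof
    fix \<Delta> assume "\<Delta> \<in> triangles {ends_of (slot x lev F i) |i. i < m}"
    then obtain a b c where \<Delta>: "\<Delta> = {a, b, c}" "a \<noteq> b" "b \<noteq> c" "a \<noteq> c"
      and E: "{a, b} \<in> {ends_of (slot x lev F i) |i. i < m}" "{b, c} \<in> {ends_of (slot x lev F i) |i. i < m}"
        "{a, c} \<in> {ends_of (slot x lev F i) |i. i < m}"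
      by (rule triangles_cases)
    have ne: "{a, b} \<noteq> {b, c}" "{b, c} \<noteq> {a, c}" "{a, c} \<noteq> {a, b}"
      using \<Delta>(2-4) by (auto simp: doubleton_eq_iff)
    show "\<Delta> \<in> triangles (stage_graph x lev F)"
      unfolding \<Delta>(1)
      by (rule trianglesI[OF \<Delta>(2-4) kept[OF E(1,2) ne(1), of b] kept[OF E(2,3) ne(2), of c]
            kept[OF E(3,1) ne(3), of a]]) auto
  qed
qed

text \<open>Injectivity on triangles matters as well: distinct listed triangles must stay distinct
  after translation, so that a full call accounts for m of them.\<close>

lemma call_triangles:
  assumes "built x lev F c 0 s"
  shows "(`) (mem s 7) ` triangles (set (map ends_of (call_edges s))) = triangles (stage_graph x lev F)"
    and "inj_on ((`) (mem s 7)) (triangles (set (map ends_of (call_edges s))))"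
proof -
  let ?E = "set (map ends_of (call_edges s))"
  have "\<Union>?E \<subseteq> {..<regs s 6}"
    using call_represents(1)[OF assms] by (auto simp: represents_def simple_graph_def)
  then have inj: "inj_on (mem s 7) (\<Union>?E)"
    using built_names(1)[OF assms] inj_on_subset by blast
  have len: "length (call_edges s) = m" by (simp add: call_edges_def)
  have "(`) (mem s 7) ` ?E = {ends_of (slot x lev F i) |i. i < m}"
  proof -
    have "?E = (\<lambda>i. ends_of (call_edges s ! i)) ` {..<m}"
      unfolding set_conv_nth using len by (auto simp del: set_map) (metis nth_map)
    then show ?thesis
      using call_edges_nth(1)[OF _ assms] by (auto simp: image_image)
  qed
  then show "(`) (mem s 7) ` triangles ?E = triangles (stage_graph x lev F)"
    using triangles_image[OF inj] slot_triangles by simp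
  have "inj_on ((`) (mem s 7)) (Pow (\<Union>?E))"
    using inj by (rule inj_on_image_Pow)
  then show "inj_on ((`) (mem s 7)) (triangles ?E)"
    using triangles_subset_Pow by (rule inj_on_subset)
qed

lemma stage_graph_subset: "stage_graph x lev F \<subseteq> E"
  using ends_edge by (auto simp: stage_graph_def)

lemma finite_stage_triangles: "finite (triangles (stage_graph x lev F))"
proof (rule finite_subset[OF triangles_subset_Pow])
  have "stage_graph x lev F = (\<lambda>i. ends_of (es ! i)) ` {i. i < m \<and> kept x lev F i}"
    by (auto simp: stage_graph_def)
  then show "finite (Pow (\<Union>(stage_graph x lev F)))" by (auto simp: ends_of_def)
qed

text \<open>All that the counting argument knows of a round: \<open>\<T>\<close> is what the lister
  returned, by whatever choice, and \<open>q\<close> is register 4 afterwards. If there are exactly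
  m triangles, the answer is complete but the program still repeats the stage.\<close>

definition round_step :: "nat \<Rightarrow> (nat \<Rightarrow> nat) \<Rightarrow> nat set \<Rightarrow> nat set \<Rightarrow> nat \<Rightarrow> bool" where
  "round_step x lev F F' q \<longleftrightarrow> (\<exists>\<T>\<subseteq>triangles (stage_graph x lev F).
     F' = F \<union> {i. i < m \<and> (\<exists>\<Delta>\<in>\<T>. ends_of (es ! i) \<subseteq> \<Delta>)} \<and>
     (card \<T> = m \<and> q = Suc x \<or> \<T> = triangles (stage_graph x lev F) \<and> q = x))"

lemma mark_edge_wp:
  assumes "in_round lev F x c s" "i < m" "ends_of (es ! i) = {regs s u, regs s v}" "v \<noteq> 14"
  shows "wp W 4 (mark_edge u v) (\<lambda>t. in_round lev (insert i F) x c t \<and>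
    (\<forall>y. y \<noteq> 14 \<longrightarrow> regs t y = regs s y) \<and> (\<forall>a. a \<noteq> 4 \<longrightarrow> mem t a = mem s a)) s"
proof -
  have uv: "fst (es ! i) = regs s u \<and> snd (es ! i) = regs s v \<or> fst (es ! i) = regs s v \<and> snd (es ! i) = regs s u"
    using assms(3) by (auto simp: ends_of_def doubleton_eq_iff)
  then have lt: "regs s u < n" "regs s v < n" using ends_less[OF assms(2)] by auto
  have "mem s 2 (fst (es ! i) * n + snd (es ! i)) = i \<and> mem s 2 (snd (es ! i) * n + fst (es ! i)) = i"
    using assms(1,2) by (simp add: in_round_defs)
  then have ix: "mem s 2 (regs s u * n + regs s v) = i" using uv by auto
  have W: "regs s u * n + regs s v < W" "regs s u * n < W"
    using key_less[OF lt] by simp_all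
  define t where "t = (set_reg 14 i s)\<lparr>mem := (mem s)(4 := (mem s 4)(i := 1))\<rparr>"
  have "in_round lev (insert i F) x c t"
    using assms(1) by (simp add: in_round_defs t_def)
  then show ?thesis
    using assms(4) W ix in_round_regs(1,4)[OF assms(1)] by (simp add: mark_edge_def t_def set_reg_def)
qed

end

text \<open>\<open>K\<close> bounds the steps of the lister on graphs with exactly m edges. One
  fixed tape suffices, as an embeddable program never reads it.\<close>

locale listing_round = graph_input +
  fixes p :: prog and R K :: nat
  assumes embeddable: "\<forall>i\<in>set p. embeddable R i"
    and lister: "\<And>N es' E'. represents N es' E' \<Longrightarrow> card E' = m \<Longrightarrow>
      \<exists>k\<le>K. \<exists>t. after k (p, input [N, m, m] es' undefined) = ([], t) \<and> listing_correct E' m (outp t) \<and>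
        words_below W (p, input [N, m, m] es' undefined)"
begin

definition called :: "nat \<Rightarrow> (nat \<Rightarrow> nat) \<Rightarrow> nat set \<Rightarrow> nat \<Rightarrow> (nat \<times> nat \<times> nat) list \<Rightarrow> state \<Rightarrow> bool" where
  "called x lev F c ts t \<longleftrightarrow> in_round lev F x c t \<and> stamped (Suc c) t \<and>
     map (mem t 9) [0..<regs t 7] = concat (map (\<lambda>(a, b, c). [a, b, c]) ts) \<and>
     (\<forall>T\<in>set ts. mem t 7 ` tri_of T \<in> triangles (stage_graph x lev F)) \<and>
     distinct (map (\<lambda>T. mem t 7 ` tri_of T) ts) \<and>
     (length ts = m \<or> length ts < m \<and>
        (\<lambda>T. mem t 7 ` tri_of T) ` set ts = triangles (stage_graph x lev F))"

lemma call_wp: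
  assumes "built x lev F c 0 s"
  shows "wp W (R + 4 + 4 * K) (call_prog R p) (\<lambda>t. \<exists>ts. called x lev F c ts t) s"
proof -
  let ?es = "call_edges s" and ?N = "regs s 6"
  let ?E = "set (map ends_of ?es)" and ?s = "input [?N, m, m] ?es undefined"
  obtain k t where k: "k \<le> K" and t: "after k (p, ?s) = ([], t)" and lc: "listing_correct ?E m (outp t)"
    and wb: "words_below W (p, ?s)"
    using lister[OF call_represents[OF assms]] by auto
  obtain ts where ts: "outp t = concat (map (\<lambda>(a, b, c). [a, b, c]) ts)" "distinct (map tri_of ts)"
    "set (map tri_of ts) \<subseteq> triangles ?E"
    "length ts = m \<or> card (triangles ?E) < m \<and> set (map tri_of ts) = triangles ?E"
    using lc unfolding listing_correct_def by auto
  \<comment> \<open>Distinctness turns the lister's statement about the number of triangles into one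
    about the length of its output, which the program can test.\<close>
  have "card (set (map tri_of ts)) = length ts"
    using distinct_card[OF ts(2)] by simp
  then have ts4: "length ts = m \<or> length ts < m \<and> set (map tri_of ts) = triangles ?E"
    using ts(4) by auto
  then have len: "length (outp t) \<le> 3 * m"
    unfolding ts(1) length_concat_triples by auto
  have W: "3 * m < W" "1 < W" "0 < W" "m < W" using W_ge_quartic(3) by linarith+
  have N: "?N \<le> 2 * m" using assms by (simp add: built_def)
  then have NW: "?N < W" using W_ge_quartic(3) by linarith
  have ir: "in_round lev F x c s" using assms by (simp add: built_def)
  let ?P1 = "\<lambda>t::state. (\<forall>x<R. regs t (50 + x) = 0) \<and> (\<forall>x<50. regs t x = regs s x) \<and> mem t = mem s \<and> outp t = outp s"
  let ?P2 = "\<lambda>t::state. (\<forall>x<R. regs t (50 + x) = regs ?s x) \<and> (\<forall>x<50. x \<noteq> 7 \<longrightarrow> regs t x = regs s x) \<and>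
    regs t 7 = 0 \<and> mem t = mem s \<and> outp t = outp s"
  let ?pre = "[Op Add 50 6 8, Op Add 51 1 8, Op Add 52 1 8, Const 7 0]"
  show ?thesis
    unfolding call_prog_def
  proof (rule wp_seq[where ?\<tau>1.0 = R and ?\<tau>2.0 = "4 + 4 * K" and P = ?P1])
    show "wp W R (map (\<lambda>x. Const (50 + x) 0) [0..<R]) ?P1 s"
      using clear_regs_wp[OF W(3)] .
    fix t1 assume t1: "?P1 t1"
    show "wp W (4 + 4 * K) (?pre @ concat (map embed p)) (\<lambda>t. \<exists>ts. called x lev F c ts t) t1"
    proof (rule wp_seq[where ?\<tau>1.0 = 4 and ?\<tau>2.0 = "4 * K" and P = ?P2])
      have r: "regs t1 6 = ?N" "regs t1 8 = 0" "regs t1 1 = m" "regs t1 (Suc 0) = m"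
        using t1 in_round_regs[OF ir] by auto
      define t2 where "t2 = set_reg 7 0 (set_reg 52 m (set_reg 51 m (set_reg 50 ?N t1)))"
      have "?P2 t2"
      proof (intro conjI allI impI)
        fix y assume "y < R"
        then have "regs t1 (50 + y) = 0" using t1 by simp
        moreover have "y = 0 \<or> y = 1 \<or> y = 2 \<or> y \<ge> 3" by linarith
        ultimately show "regs t2 (50 + y) = regs ?s y"
          by (auto simp: t2_def input_def)
      qed (use t1 in \<open>auto simp: t2_def\<close>)
      then show "wp W 4 ?pre ?P2 t1"
        using r NW W by (simp add: t2_def)
      fix s0 :: state assume s0: "?P2 s0"
      have ir0: "in_round lev F x c s0"
        by (rule in_round_cong[OF ir]) (use s0 in auto)
      have five: "regs s0 5 = Suc c" "regs s0 2 = 1" using in_round_regs[OF ir0] by auto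
      have stamp: "mem s0 (11 + 2 * a) j = Suc c \<longleftrightarrow> a < 2 \<and> j < m"
        and stamp_le: "mem s0 (11 + 2 * a) j \<le> Suc c" for a j
        using assms s0 by (simp_all add: built_def)
      have "simulates R s0 ?s s0"
        unfolding simulates_def
      proof (intro conjI allI impI)
        fix a i :: nat
        \<comment> \<open>In arrays 0 and 1 exactly the cells below m carry the current stamp; in no
          other array does any cell carry it.\<close>
        consider "a = 0" | "a = 1" | "a \<ge> 2" by linarith
        then show "mem ?s a i = (if mem s0 (11 + 2 * a) i = regs s0 5 then mem s0 (10 + 2 * a) i else 0)"
          unfolding five stamp
          by cases (auto simp: input_def call_edges_def s0)
      qed (use s0 stamp_le five in \<open>auto simp: input_def\<close>)
      then have "wp W (4 * k) (concat (map embed p)) (simulates R s0 t) s0"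
        by (intro wp_embed[OF t wb _ _ embeddable _ five(2)]) (use len W in auto)
      then show "wp W (4 * K) (concat (map embed p)) (\<lambda>t. \<exists>ts. called x lev F c ts t) s0"
      proof (rule wp_mono)
        fix u assume u: "simulates R s0 t u"
        have "in_round lev F x c u"
          by (rule in_round_cong[OF ir0]) (use u in \<open>auto simp: simulates_def\<close>)
        moreover have "regs u 5 = Suc c"
          using u five by (simp add: simulates_def)
        then have "stamped (Suc c) u"
          using u unfolding stamped_def simulates_def by metis
        moreover have "map (mem u 9) [0..<regs u 7] = concat (map (\<lambda>(a, b, c). [a, b, c]) ts)"
          using u ts(1) by (simp add: simulates_def)
        moreover have 7: "mem u 7 = mem s 7"
          using u s0 by (simp add: simulates_def)
        moreover have "\<forall>T\<in>set ts. mem s 7 ` tri_of T \<in> triangles (stage_graph x lev F)"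
          using ts(3) call_triangles(1)[OF assms] by auto
        moreover have "distinct (map (\<lambda>T. mem s 7 ` tri_of T) ts)"
        proof -
          have "inj_on ((`) (mem s 7)) (set (map tri_of ts))"
            using call_triangles(2)[OF assms] ts(3) by (rule inj_on_subset)
          then have "distinct (map ((`) (mem s 7)) (map tri_of ts))"
            using ts(2) by (simp only: distinct_map)
          then show ?thesis by (simp add: comp_def)
        qed
        moreover have "(\<lambda>T. mem s 7 ` tri_of T) ` set ts = (`) (mem s 7) ` set (map tri_of ts)"
          by auto
        then have "length ts = m \<or> length ts < m \<and>
          (\<lambda>T. mem s 7 ` tri_of T) ` set ts = triangles (stage_graph x lev F)"
          using ts4 call_triangles(1)[OF assms] by metis
        ultimately show "\<exists>ts. called x lev F c ts u"
          unfolding called_def by (intro exI[of _ ts]) simp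
      qed (use k in simp)
    qed simp
  qed simp
qed

end

context graph_input
begin

text \<open>Two distinct points of a three-element set form one of its three pairs, so marking the
  three sides marks all edges inside the triangle.\<close>

lemma ends_of_subset_triple:
  assumes "i < m" "i1 < m" "i2 < m" "i3 < m" "a \<noteq> b" "b \<noteq> c" "a \<noteq> c"
    "ends_of (es ! i1) = {a, b}" "ends_of (es ! i2) = {b, c}" "ends_of (es ! i3) = {a, c}"
  shows "ends_of (es ! i) \<subseteq> {a, b, c} \<longleftrightarrow> i = i1 \<or> i = i2 \<or> i = i3"
proof
  assume sub: "ends_of (es ! i) \<subseteq> {a, b, c}"
  have "fst (es ! i) \<noteq> snd (es ! i)" using ends_neq[OF assms(1)] .
  with sub have "ends_of (es ! i) = {a, b} \<or> ends_of (es ! i) = {b, c} \<or> ends_of (es ! i) = {a, c}"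
    by (auto simp: ends_of_def)
  with assms(8-10) show "i = i1 \<or> i = i2 \<or> i = i3"
    using ends_inj[OF assms(1,2)] ends_inj[OF assms(1,3)] ends_inj[OF assms(1,4)] by metis
qed (use assms(8-10) in auto)

end

context listing_round
begin

lemma mark_body_wp:
  assumes "in_round lev F x c s" "stamped (Suc c) s" "regs s 10 = 3 * Suc k" "3 * k + 2 < W"
    and out: "mem s 9 (3 * k) = a" "mem s 9 (3 * k + 1) = b" "mem s 9 (3 * k + 2) = d"
    and tri: "{mem s 7 a, mem s 7 b, mem s 7 d} \<in> triangles E"
  shows "wp W 21 ([Op Sub 10 10 21, Load 11 9 10,
     Op Add 12 10 2, Load 12 9 12, Op Add 13 10 27, Load 13 9 13,
     Load 11 7 11, Load 12 7 12, Load 13 7 13] @ mark_edge 11 12 @ mark_edge 12 13 @ mark_edge 11 13)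
    (\<lambda>t. in_round lev (F \<union> {i. i < m \<and> ends_of (es ! i) \<subseteq> {mem s 7 a, mem s 7 b, mem s 7 d}}) x c t \<and>
      stamped (Suc c) t \<and> regs t 10 = 3 * k \<and> regs t 7 = regs s 7 \<and> mem t 7 = mem s 7 \<and> mem t 9 = mem s 9) s"
proof -
  let ?a = "mem s 7 a" and ?b = "mem s 7 b" and ?d = "mem s 7 d"
  note tri' = triangles_pairs[OF tri]
  obtain i1 i2 i3 where i: "i1 < m" "{?a, ?b} = ends_of (es ! i1)" "i2 < m" "{?b, ?d} = ends_of (es ! i2)"
    "i3 < m" "{?a, ?d} = ends_of (es ! i3)"
    using edge_ends[OF tri'(4)] edge_ends[OF tri'(5)] edge_ends[OF tri'(6)] by auto
  define P where "P = (\<lambda>F' (t::state). in_round lev F' x c t \<and> stamped (Suc c) t \<and> regs t 10 = 3 * k \<and>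
    regs t 7 = regs s 7 \<and> mem t 7 = mem s 7 \<and> mem t 9 = mem s 9 \<and>
    regs t 11 = ?a \<and> regs t 12 = ?b \<and> regs t 13 = ?d)"
  have mark: "wp W 4 (mark_edge u v) (P (insert i F')) t"
    if "P F' t" "i < m" "ends_of (es ! i) = {regs t u, regs t v}" "v \<noteq> 14" for F' t i u v
  proof (rule wp_mono[OF mark_edge_wp[of lev F' x c t i u v]])
    fix t' :: state
    assume t': "in_round lev (insert i F') x c t' \<and> (\<forall>y. y \<noteq> 14 \<longrightarrow> regs t' y = regs t y) \<and>
        (\<forall>a. a \<noteq> 4 \<longrightarrow> mem t' a = mem t a)"
    then have "stamped (Suc c) t'"
      using that(1) by (simp add: P_def stamped_def)
    with t' that(1) show "P (insert i F') t'" by (simp add: P_def)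
  qed (use that in \<open>auto simp: P_def\<close>)
  have regs: "regs t 11 = ?a" "regs t 12 = ?b" "regs t 13 = ?d" if "P F' t" for F' t
    using that by (simp_all add: P_def)
  have F: "insert i3 (insert i2 (insert i1 F)) =
      F \<union> {i. i < m \<and> ends_of (es ! i) \<subseteq> {?a, ?b, ?d}}"
    using ends_of_subset_triple[OF _ i(1,3,5) tri'(1-3) i(2)[symmetric] i(4)[symmetric] i(6)[symmetric]] i(1,3,5) by auto
  show ?thesis
  proof (rule wp_seq[where ?\<tau>1.0 = 9 and ?\<tau>2.0 = 12 and P = "P F"])
    define t where "t = set_reg 13 ?d (set_reg 12 ?b (set_reg 11 ?a (set_reg 10 (3 * k) s)))"
    have "in_round lev F x c t"
      by (rule in_round_cong[OF assms(1)]) (auto simp: t_def)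
    then have "P F t" using assms(2) by (simp add: P_def t_def stamped_def)
    moreover have "set_reg 13 ?d (set_reg 13 d (set_reg 13 (3 * k + 2) u)) = set_reg 13 ?d u"
      "set_reg 12 ?b (set_reg 12 b (set_reg 12 (3 * k + 1) u)) = set_reg 12 ?b u" for u
      by (simp_all add: set_reg_def)
    ultimately show "wp W 9 [Op Sub 10 10 21, Load 11 9 10,
     Op Add 12 10 2, Load 12 9 12, Op Add 13 10 27, Load 13 9 13,
     Load 11 7 11, Load 12 7 12, Load 13 7 13] (P F) s"
      using in_round_regs(4,8,9)[OF assms(1)] assms(2-4) out assms(1)
      by (simp add: P_def stamped_def in_round_defs)
    fix t assume t: "P F t"
    show "wp W 12 (mark_edge 11 12 @ mark_edge 12 13 @ mark_edge 11 13)
      (\<lambda>t. in_round lev (F \<union> {i. i < m \<and> ends_of (es ! i) \<subseteq> {?a, ?b, ?d}}) x c t \<and>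
      stamped (Suc c) t \<and> regs t 10 = 3 * k \<and> regs t 7 = regs s 7 \<and> mem t 7 = mem s 7 \<and> mem t 9 = mem s 9) t"
    proof (rule wp_seq[where ?\<tau>1.0 = 4 and ?\<tau>2.0 = 8 and P = "P (insert i1 F)"])
      show "wp W 4 (mark_edge 11 12) (P (insert i1 F)) t"
        by (rule mark[OF t i(1)]) (use regs[OF t] i(2) in auto)
      fix t assume t: "P (insert i1 F) t"
      show "wp W 8 (mark_edge 12 13 @ mark_edge 11 13)
        (\<lambda>t. in_round lev (F \<union> {i. i < m \<and> ends_of (es ! i) \<subseteq> {?a, ?b, ?d}}) x c t \<and>
        stamped (Suc c) t \<and> regs t 10 = 3 * k \<and> regs t 7 = regs s 7 \<and> mem t 7 = mem s 7 \<and> mem t 9 = mem s 9) t"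
      proof (rule wp_seq[where ?\<tau>1.0 = 4 and ?\<tau>2.0 = 4 and P = "P (insert i2 (insert i1 F))"])
        show "wp W 4 (mark_edge 12 13) (P (insert i2 (insert i1 F))) t"
          by (rule mark[OF t i(3)]) (use regs[OF t] i(4) in auto)
        fix t assume t: "P (insert i2 (insert i1 F)) t"
        have "wp W 4 (mark_edge 11 13) (P (insert i3 (insert i2 (insert i1 F)))) t"
          by (rule mark[OF t i(5)]) (use regs[OF t] i(6) in auto)
        then show "wp W 4 (mark_edge 11 13)
          (\<lambda>t. in_round lev (F \<union> {i. i < m \<and> ends_of (es ! i) \<subseteq> {?a, ?b, ?d}}) x c t \<and>
          stamped (Suc c) t \<and> regs t 10 = 3 * k \<and> regs t 7 = regs s 7 \<and> mem t 7 = mem s 7 \<and> mem t 9 = mem s 9) t"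
          unfolding F by (rule wp_mono) (simp_all add: P_def)
      qed simp
    qed simp
  qed simp
qed

lemma mark_wp:
  assumes "called x lev F c ts s" "x < Q"
  shows "wp W (22 * m + 5) mark_prog
    (\<lambda>t. \<exists>F' q. round_step x lev F F' q \<and> between_rounds lev F' q (Suc c) t) s"
proof -
  let ?L = "length ts" and ?g = "mem s 7"
  \<comment> \<open>The triples are processed from the last to the first: \<open>S k\<close> is the
    set of found edges once those from \<open>k\<close> on are done.\<close>
  define S where "S = (\<lambda>k. F \<union> {i. i < m \<and> (\<exists>j<?L. k \<le> j \<and> ends_of (es ! i) \<subseteq> ?g ` tri_of (ts ! j))})"
  have ir: "in_round lev F x c s" and st: "stamped (Suc c) s"
    and out: "map (mem s 9) [0..<regs s 7] = concat (map (\<lambda>(a, b, c). [a, b, c]) ts)"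
    and tri: "\<forall>T\<in>set ts. ?g ` tri_of T \<in> triangles (stage_graph x lev F)"
    and dist: "distinct (map (\<lambda>T. ?g ` tri_of T) ts)"
    and full: "?L = m \<or> ?L < m \<and> (\<lambda>T. ?g ` tri_of T) ` set ts = triangles (stage_graph x lev F)"
    using assms(1) unfolding called_def by blast+
  have len: "regs s 7 = 3 * ?L"
    using arg_cong[OF out, of length] by (simp add: length_concat_triples)
  have Lm: "?L \<le> m" using full by auto
  have W: "3 * m < W" "1 < W" using W_ge_quartic(3) by linarith+
  have out': "mem s 9 j = concat (map (\<lambda>(a, b, c). [a, b, c]) ts) ! j" if "j < 3 * ?L" for j
    unfolding out[symmetric] len using that by simp
  define I where "I = (\<lambda>k (t::state). in_round lev (S k) x c t \<and> stamped (Suc c) t \<and> regs t 10 = 3 * k \<and>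
    regs t 7 = 3 * ?L \<and> mem t 7 = ?g \<and> mem t 9 = mem s 9)"
  define \<T> where "\<T> = (\<lambda>T. ?g ` tri_of T) ` set ts"
  have card: "card \<T> = ?L" unfolding \<T>_def using distinct_card[OF dist] by simp
  have S0: "S 0 = F \<union> {i. i < m \<and> (\<exists>\<Delta>\<in>\<T>. ends_of (es ! i) \<subseteq> \<Delta>)}"
    unfolding S_def \<T>_def set_conv_nth by blast
  have step: "round_step x lev F (S 0) (if ?L = m then Suc x else x)"
    unfolding round_step_def
    by (rule exI[of _ \<T>]) (use tri full card S0 in \<open>auto simp: \<T>_def\<close>)
  show ?thesis
    unfolding mark_prog_def
  proof (rule wp_seq[where ?\<tau>1.0 = 1 and ?\<tau>2.0 = "m * (21 + 1) + 1 + 3" and P = "I ?L"])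
    have "in_round lev F x c (set_reg 10 (3 * ?L) s)"
      by (rule in_round_cong[OF ir]) auto
    moreover have "S ?L = F" by (auto simp: S_def)
    ultimately have "I ?L (set_reg 10 (3 * ?L) s)"
      using st len by (simp add: I_def stamped_def)
    then show "wp W 1 [Op Add 10 7 8] (I ?L) s"
      using in_round_regs[OF ir] len Lm W by simp
    fix t assume t: "I ?L t"
    let ?body = "[Op Sub 10 10 21, Load 11 9 10,
     Op Add 12 10 2, Load 12 9 12, Op Add 13 10 27, Load 13 9 13,
     Load 11 7 11, Load 12 7 12, Load 13 7 13] @ mark_edge 11 12 @ mark_edge 12 13 @ mark_edge 11 13"
    show "wp W (m * (21 + 1) + 1 + 3) ([While 10 ?body] @ [Op Mul 10 1 21, Op Less 10 7 10, Op Sub 4 4 10])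
       (\<lambda>t. \<exists>F' q. round_step x lev F F' q \<and> between_rounds lev F' q (Suc c) t) t"
    proof (rule wp_seq[where ?\<tau>1.0 = "?L * (21 + 1) + 1" and ?\<tau>2.0 = 3])
      show "wp W (?L * (21 + 1) + 1) [While 10 ?body] (\<lambda>t. (\<exists>k. I k t) \<and> regs t 10 = 0) t"
      proof (rule wp_loop[where I = I])
        fix k' t assume *: "I k' t" "k' \<le> ?L" "regs t 10 \<noteq> 0"
        then have "k' \<noteq> 0" by (auto simp: I_def)
        then obtain k where k: "k' = Suc k" by (cases k') auto
        have I: "in_round lev (S (Suc k)) x c t" "stamped (Suc c) t" "regs t 10 = 3 * Suc k"
          "regs t 7 = 3 * ?L" "mem t 7 = ?g" "mem t 9 = mem s 9"
          using *(1) unfolding k I_def by auto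
        have kL: "k < ?L" using * k by simp
        obtain a b d where T: "ts ! k = (a, b, d)" by (cases "ts ! k")
        have nth: "mem t 9 (3 * k) = a" "mem t 9 (3 * k + 1) = b" "mem t 9 (3 * k + 2) = d"
          using kL nth_concat_triples[OF kL] by (simp_all add: I(6) out' T)
        have g: "?g ` tri_of (ts ! k) = {?g a, ?g b, ?g d}" by (simp add: T tri_of_def)
        have "{?g a, ?g b, ?g d} \<in> triangles (stage_graph x lev F)"
          unfolding g[symmetric] using tri kL by simp
        then have tr: "{mem t 7 a, mem t 7 b, mem t 7 d} \<in> triangles E"
          unfolding I(5) using triangles_mono[OF stage_graph_subset] by blast
        have "(\<exists>j<?L. k \<le> j \<and> ends_of (es ! i) \<subseteq> ?g ` tri_of (ts ! j)) \<longleftrightarrow>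
            (\<exists>j<?L. Suc k \<le> j \<and> ends_of (es ! i) \<subseteq> ?g ` tri_of (ts ! j)) \<or>
            ends_of (es ! i) \<subseteq> {?g a, ?g b, ?g d}" for i
          unfolding g[symmetric] using kL by (metis Suc_leI le_eq_less_or_eq less_or_eq_imp_le Suc_le_lessD)
        then have S: "S (Suc k) \<union> {i. i < m \<and> ends_of (es ! i) \<subseteq> {mem t 7 a, mem t 7 b, mem t 7 d}} = S k"
          unfolding S_def I(5) by blast
        have "3 * k + 2 < W" using kL Lm W by linarith
        then have "wp W 21 ?body (I k) t"
          by (intro wp_mono[OF mark_body_wp[OF I(1-3) _ nth tr]]) (unfold S, simp_all add: I_def I)
        with k show "\<exists>k. k' = Suc k \<and> wp W 21 ?body (I k) t" by blast
      qed (rule t)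
      fix t assume "(\<exists>k. I k t) \<and> regs t 10 = 0"
      then have I: "I 0 t" by (auto simp: I_def)
      then have ir: "in_round lev (S 0) x c t" by (simp add: I_def)
      let ?q = "if ?L = m then Suc x else x"
      define t' where "t' = set_reg 4 ?q (set_reg 10 (of_bool (?L < m)) (set_reg 10 (m * 3) t))"
      have br: "between_rounds lev (S 0) ?q (Suc c) t'"
        using I by (simp add: I_def t'_def between_rounds_def in_round_defs stamped_def)
      have "Suc x - of_bool (?L < m) = ?q" using Lm by auto
      moreover have "Q \<le> Q * (n + 1)" by simp
      with assms(2) Q_less have "Suc x < W" by linarith
      then have "?q < W" by simp
      moreover have "of_bool (?L < m) < W" using W by simp
      moreover have "3 * ?L < m * 3 \<longleftrightarrow> ?L < m" by auto
      moreover have "regs t 7 = 3 * ?L" using I by (simp add: I_def)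
      ultimately have "wp W 3 [Op Mul 10 1 21, Op Less 10 7 10, Op Sub 4 4 10] (\<lambda>u. u = t') t"
        using in_round_regs[OF ir] W(1) by (simp add: t'_def)
      then show "wp W 3 [Op Mul 10 1 21, Op Less 10 7 10, Op Sub 4 4 10]
        (\<lambda>t. \<exists>F' q. round_step x lev F F' q \<and> between_rounds lev F' q (Suc c) t) t"
        by (rule wp_mono) (use br step in blast)+
    qed (use Lm in simp)
  qed simp
qed

text \<open>The sum over the six phases: 21 = 18 + 3 for the passes over the vertices, 67 = 6 + 39 +
  22 for those over the edges, and \<open>4 * K\<close> for the simulated run.\<close>

definition round_time :: nat where
  "round_time = 21 * n + 67 * m + R + 4 * K + 29"

lemma round_wp:
  assumes "between_rounds lev F (Suc x) c s" "x < Q" "Suc c < W"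
  shows "wp W round_time (round_prog R p)
    (\<lambda>t. \<exists>F' q. round_step x lev F F' q \<and> between_rounds lev F' q (Suc c) t) s"
proof -
  show ?thesis
    unfolding round_prog_def round_time_def
    apply (rule wp_seq[OF decode_wp[OF assms], where ?\<tau>2.0 = "21 * n + 67 * m + R + 4 * K + 17"])
     apply (elim conjE)
     apply (rule wp_seq[OF codes_wp[OF _ _ assms(2)], where ?\<tau>2.0 = "3 * n + 67 * m + R + 4 * K + 15"])
        apply assumption+
      apply (elim conjE)
      apply (rule wp_seq[OF clear_wp, where ?\<tau>2.0 = "61 * m + R + 4 * K + 12"])
          apply assumption+
       apply (elim conjE)
       apply (rule wp_seq[OF build_wp, where ?\<tau>2.0 = "22 * m + R + 4 * K + 9"])
            apply assumption+
        apply (rule wp_seq[OF call_wp, where ?\<tau>2.0 = "22 * m + 5"])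
          apply assumption
         apply (elim exE)
         apply (rule mark_wp[OF _ assms(2)])
         apply assumption
        apply simp_all
    done
qed

end

section \<open>Stages\<close>

context graph_input
begin

definition role :: "nat \<Rightarrow> nat \<Rightarrow> nat" where
  "role x v = (if wbit (stage_k x) v = 0 then 2 else if wbit (stage_l x) v = 0 then 1 else 4)"

definition apexes :: "nat \<Rightarrow> nat \<Rightarrow> nat set" where
  "apexes x i = {c. c < n \<and> role x c = 4 \<and> role x (fst (es ! i)) + role x (snd (es ! i)) = 3 \<and>
     {fst (es ! i), c} \<in> E \<and> {snd (es ! i), c} \<in> E}"

definition stage_complete :: "nat \<Rightarrow> (nat \<Rightarrow> nat) \<Rightarrow> nat set \<Rightarrow> bool" where
  "stage_complete x lev F \<longleftrightarrow> (\<forall>i<m. \<forall>c\<in>apexes x i. stage_r x \<le> lev c \<longrightarrow> i \<in> F)"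

text \<open>If the stage before \<open>x\<close>, which uses the apexes of level above \<open>stage_r x\<close>, is complete, then
  the edges still in play have no such apex, so only the following apexes of maximal level matter.\<close>

definition top_apexes :: "nat \<Rightarrow> (nat \<Rightarrow> nat) \<Rightarrow> nat \<Rightarrow> nat set" where
  "top_apexes x lev i = {c \<in> apexes x i. stage_r x \<le> lev c \<and>
     (stage_r x < B \<longrightarrow> (\<forall>c'\<in>apexes x i. lev c' \<le> stage_r x))}"

definition stage_load :: "nat \<Rightarrow> (nat \<Rightarrow> nat) \<Rightarrow> nat" where
  "stage_load x lev = (\<Sum>i<m. card (top_apexes x lev i))"

lemma code_role: "code x lev v = (if role x v = 4 \<and> lev v < stage_r x then 0 else role x v)"
  by (simp add: code_def role_def)

lemma role_cases: "role x v = 1 \<or> role x v = 2 \<or> role x v = 4"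
  by (simp add: role_def)

lemma finite_apexes: "finite (apexes x i)" "apexes x i \<subseteq> {..<n}"
  by (auto simp: apexes_def)

lemma edge_less: "{u, v} \<in> E \<Longrightarrow> u < n" "{u, v} \<in> E \<Longrightarrow> v < n"
  using represents by (auto simp: represents_def simple_graph_def)

lemma stage_graph_edge:
  assumes "{u, v} \<in> stage_graph x lev F"
  shows "\<exists>i<m. {u, v} = ends_of (es ! i) \<and>
    (code x lev u + code x lev v = 3 \<and> i \<notin> F \<or> code x lev u + code x lev v = 5 \<or> code x lev u + code x lev v = 6)"
proof -
  obtain i where i: "i < m" "{u, v} = ends_of (es ! i)" "kept x lev F i"
    using assms by (auto simp: stage_graph_def)
  then have "edge_code x lev i = code x lev u + code x lev v"
    by (auto simp: ends_of_def edge_code_def doubleton_eq_iff)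
  with i show ?thesis by (auto simp: kept_def)
qed

text \<open>Code 4 at \<open>c\<close> needs codes 1 or 2 at \<open>a\<close> and \<open>b\<close>,
  as the sums must be 5 or 6. Then \<open>{a, b}\<close> has sum at most 4, which leaves 3: it is a
  target not yet found.\<close>

lemma stage_triangle_apex:
  assumes "{a, b} \<in> stage_graph x lev F" "{b, c} \<in> stage_graph x lev F" "{a, c} \<in> stage_graph x lev F"
    and "code x lev c = 4"
  shows "\<exists>i<m. i \<notin> F \<and> c \<in> apexes x i \<and> stage_r x \<le> lev c \<and> {a, b} = ends_of (es ! i)"
proof -
  have code: "code x lev v = 0 \<or> code x lev v = 1 \<or> code x lev v = 2 \<or> code x lev v = 4" for v
    by (simp add: code_def)
  have "code x lev a \<in> {1, 2}" "code x lev b \<in> {1, 2}"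
    using stage_graph_edge[OF assms(2)] stage_graph_edge[OF assms(3)] assms(4) code[of a] code[of b] by auto
  moreover obtain i where i: "i < m" "{a, b} = ends_of (es ! i)"
    "code x lev a + code x lev b = 3 \<and> i \<notin> F \<or> code x lev a + code x lev b = 5 \<or> code x lev a + code x lev b = 6"
    using stage_graph_edge[OF assms(1)] by blast
  ultimately have *: "code x lev a + code x lev b = 3" "i \<notin> F" by auto
  then have "role x a + role x b = 3"
    using code_role[of x lev a] code_role[of x lev b] role_cases[of x a] role_cases[of x b] by (auto split: if_splits)
  then have "role x (fst (es ! i)) + role x (snd (es ! i)) = 3"
    using i(2) by (auto simp: ends_of_def doubleton_eq_iff add.commute)
  moreover have "role x c = 4" "stage_r x \<le> lev c"
    using assms(4) code_role[of x lev c] by (auto split: if_splits)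
  moreover have "{a, c} \<in> E" "{b, c} \<in> E"
    using assms(2,3) stage_graph_subset by blast+
  then have "{fst (es ! i), c} \<in> E" "{snd (es ! i), c} \<in> E" "c < n"
    using i(2) edge_less by (auto simp: ends_of_def doubleton_eq_iff)
  ultimately have "c \<in> apexes x i" "stage_r x \<le> lev c" by (simp_all add: apexes_def)
  with i * show ?thesis by blast
qed

lemma stage_triangle:
  assumes "\<Delta> \<in> triangles (stage_graph x lev F)"
  shows "\<exists>i<m. \<exists>c\<in>apexes x i. i \<notin> F \<and> stage_r x \<le> lev c \<and> \<Delta> = insert c (ends_of (es ! i))"
proof -
  obtain a b c where \<Delta>: "\<Delta> = {a, b, c}" and
    E: "{a, b} \<in> stage_graph x lev F" "{b, c} \<in> stage_graph x lev F" "{a, c} \<in> stage_graph x lev F"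
    using assms by (rule triangles_cases)
  have code: "code x lev v = 4 \<or> code x lev v \<le> 2" for v
    by (simp add: code_def)
  have sum: "code x lev u + code x lev v \<in> {3, 5, 6}" if "{u, v} \<in> stage_graph x lev F" for u v
    using stage_graph_edge[OF that] by blast
  have "code x lev a = 4 \<or> code x lev b = 4 \<or> code x lev c = 4"
  proof (rule ccontr)
    assume "\<not> ?thesis"
    then have "code x lev a \<le> 2" "code x lev b \<le> 2" "code x lev c \<le> 2"
      using code by blast+
    then have "code x lev a + code x lev b = 3" "code x lev b + code x lev c = 3"
      "code x lev a + code x lev c = 3"
      using sum[OF E(1)] sum[OF E(2)] sum[OF E(3)] by auto
    \<comment> \<open>Adding the three equations gives an even number equal to 9.\<close>
    moreover have "i + j = 3 \<Longrightarrow> j + k = 3 \<Longrightarrow> i + k = 3 \<Longrightarrow> False" for i j k :: nat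
      by presburger
    ultimately show False by blast
  qed
  moreover have E': "{b, a} \<in> stage_graph x lev F" "{c, b} \<in> stage_graph x lev F" "{c, a} \<in> stage_graph x lev F"
    using E by (simp_all add: insert_commute)
  moreover have "\<Delta> = insert a {b, c}" "\<Delta> = insert b {a, c}" "\<Delta> = insert c {a, b}"
    using \<Delta> by auto
  ultimately show ?thesis
    using stage_triangle_apex[OF E(2) E'(3,1)] stage_triangle_apex[OF E(3) E'(2) E(1)]
      stage_triangle_apex[OF E(1,2,3)] by metis
qed

text \<open>The sides at the apex have code sums 5 and 6 and are never dropped, so the triangle
  persists until its target is found.\<close>

lemma stage_triangleI:
  assumes "i < m" "c \<in> apexes x i" "i \<notin> F" "stage_r x \<le> lev c"
  shows "insert c (ends_of (es ! i)) \<in> triangles (stage_graph x lev F)"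
proof -
  let ?u = "fst (es ! i)" and ?v = "snd (es ! i)"
  have c: "role x c = 4" "role x ?u + role x ?v = 3" "{?u, c} \<in> E" "{?v, c} \<in> E"
    using assms(2) by (auto simp: apexes_def)
  then have uv: "role x ?u \<in> {1, 2}" "role x ?v \<in> {1, 2}"
    using role_cases[of x ?u] role_cases[of x ?v] by auto
  have code: "code x lev c = 4" "code x lev ?u = role x ?u" "code x lev ?v = role x ?v"
    using c(1) assms(4) uv by (auto simp: code_role)
  have "kept x lev F i"
    using c(2) code assms(3) by (simp add: kept_def edge_code_def)
  then have "{?u, ?v} \<in> stage_graph x lev F"
    using assms(1) by (auto simp: stage_graph_def ends_of_def)
  moreover have "{w, c} \<in> stage_graph x lev F" if w: "{w, c} \<in> E" "code x lev w \<in> {1, 2}" for w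
  proof -
    obtain j where j: "j < m" "{w, c} = ends_of (es ! j)" using edge_ends[OF w(1)] by blast
    then have "edge_code x lev j = code x lev w + 4"
      using code(1) by (auto simp: ends_of_def edge_code_def doubleton_eq_iff)
    then have "kept x lev F j" using w(2) by (auto simp: kept_def)
    with j show ?thesis by (auto simp: stage_graph_def)
  qed
  then have "{?v, c} \<in> stage_graph x lev F" "{?u, c} \<in> stage_graph x lev F"
    using c(3,4) code uv by simp_all
  moreover have "?u \<noteq> ?v" "?v \<noteq> c" "?u \<noteq> c"
    using ends_neq[OF assms(1)] uv c(1) by auto
  ultimately have "{?u, ?v, c} \<in> triangles (stage_graph x lev F)" by (intro trianglesI)
  then show ?thesis by (simp add: ends_of_def insert_commute)
qed

text \<open>Below the top threshold the successor causes no carry: it is the preceding stage of the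
  same tripartition, with threshold one higher.\<close>

lemma stage_Suc:
  assumes "stage_r x < B"
  shows "apexes (Suc x) = apexes x" "stage_r (Suc x) = Suc (stage_r x)"
proof -
  have "Suc x div (B + 1) = x div (B + 1)" "Suc x mod (B + 1) = Suc (x mod (B + 1))"
    using assms by (simp_all add: stage_r_def mod_Suc div_Suc)
  then show "apexes (Suc x) = apexes x" "stage_r (Suc x) = Suc (stage_r x)"
    by (auto simp: fun_eq_iff apexes_def role_def stage_k_def stage_l_def stage_r_def)
qed

text \<open>A target still in play has no apex above the threshold, as the preceding stage would
  have found it; so the apexes of its triangles are top apexes. The bound no longer mentions
  \<open>F\<close>, which makes it a function of the levels only.\<close>

lemma card_stage_triangles_le:
  assumes "stage_r x < B \<Longrightarrow> stage_complete (Suc x) lev F"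
  shows "card (triangles (stage_graph x lev F)) \<le> stage_load x lev"
proof -
  have "triangles (stage_graph x lev F) \<subseteq>
    (\<lambda>(i, c). insert c (ends_of (es ! i))) ` (SIGMA i:{..<m}. top_apexes x lev i)"
  proof
    fix \<Delta> assume "\<Delta> \<in> triangles (stage_graph x lev F)"
    then obtain i c where i: "i < m" "c \<in> apexes x i" "i \<notin> F" "stage_r x \<le> lev c"
      "\<Delta> = insert c (ends_of (es ! i))"
      using stage_triangle by blast
    have "lev c' \<le> stage_r x" if "stage_r x < B" "c' \<in> apexes x i" for c'
      using assms[OF that(1)] that i(1,3) stage_Suc[OF that(1)]
      by (auto simp: stage_complete_def not_less_eq_eq[symmetric])
    then have "c \<in> top_apexes x lev i" using i by (auto simp: top_apexes_def)
    with i show "\<Delta> \<in> (\<lambda>(i, c). insert c (ends_of (es ! i))) ` (SIGMA i:{..<m}. top_apexes x lev i)"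
      by force
  qed
  moreover have fin: "finite (top_apexes x lev i)" for i
    using finite_apexes(1) by (simp add: top_apexes_def)
  ultimately have "card (triangles (stage_graph x lev F)) \<le> card (SIGMA i:{..<m}. top_apexes x lev i)"
    by (meson card_image_le card_mono finite_SigmaI finite_imageI finite_lessThan le_trans)
  then show ?thesis using fin by (simp add: stage_load_def card_SigmaI)
qed

lemma stage_load_le: "stage_load x lev \<le> m * n"
proof -
  have "card (top_apexes x lev i) \<le> n" for i
    using card_mono[of "{..<n}" "top_apexes x lev i"] finite_apexes(2)[of x i] by (auto simp: top_apexes_def)
  then have "stage_load x lev \<le> (\<Sum>i<m. n)"
    unfolding stage_load_def by (intro sum_mono)
  then show ?thesis by simp
qed

section \<open>Sound and complete sets of found edges\<close>

definition sound :: "nat set \<Rightarrow> bool" where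
  "sound F \<longleftrightarrow> (\<forall>i\<in>F. i < m \<and> (\<exists>\<Delta>\<in>triangles E. ends_of (es ! i) \<subseteq> \<Delta>))"

lemma round_step_mono: "round_step x lev F F' q \<Longrightarrow> F \<subseteq> F'"
  by (auto simp: round_step_def)

lemma round_step_sound: "round_step x lev F F' q \<Longrightarrow> sound F \<Longrightarrow> sound F'"
  unfolding round_step_def sound_def using triangles_mono[OF stage_graph_subset] by blast

text \<open>Every triangle of the new stage graph contains a target outside \<open>F'\<close>, but
  all edges of a listed triangle are in \<open>F'\<close>. So listed and remaining triangles are
  disjoint subsets of the old ones.\<close>

lemma round_step_cases:
  assumes "round_step x lev F F' q"
  shows "q = Suc x \<and> card (triangles (stage_graph x lev F')) + m \<le> card (triangles (stage_graph x lev F)) \<or>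
    q = x \<and> stage_complete x lev F'"
proof -
  obtain \<T> where \<T>: "\<T> \<subseteq> triangles (stage_graph x lev F)"
    "F' = F \<union> {i. i < m \<and> (\<exists>\<Delta>\<in>\<T>. ends_of (es ! i) \<subseteq> \<Delta>)}"
    "card \<T> = m \<and> q = Suc x \<or> \<T> = triangles (stage_graph x lev F) \<and> q = x"
    using assms unfolding round_step_def by blast
  note fin = finite_stage_triangles[of x lev F]
  have "F \<subseteq> F'" using \<T>(2) by blast
  then have "stage_graph x lev F' \<subseteq> stage_graph x lev F"
    by (auto simp: stage_graph_def kept_def)
  then have sub: "triangles (stage_graph x lev F') \<subseteq> triangles (stage_graph x lev F)"
    by (rule triangles_mono)
  have "\<T> \<inter> triangles (stage_graph x lev F') = {}"
  proof (rule ccontr)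
    assume "\<T> \<inter> triangles (stage_graph x lev F') \<noteq> {}"
    then obtain \<Delta> where \<Delta>: "\<Delta> \<in> \<T>" "\<Delta> \<in> triangles (stage_graph x lev F')" by blast
    then obtain i c where "i < m" "i \<notin> F'" "\<Delta> = insert c (ends_of (es ! i))"
      using stage_triangle by blast
    with \<Delta>(1) \<T>(2) show False by blast
  qed
  then have disj: "card \<T> + card (triangles (stage_graph x lev F')) = card (\<T> \<union> triangles (stage_graph x lev F'))"
    using \<T>(1) sub fin by (metis card_Un_disjoint finite_subset)
  have "card (\<T> \<union> triangles (stage_graph x lev F')) \<le> card (triangles (stage_graph x lev F))"
    using \<T>(1) sub by (intro card_mono[OF fin]) blast
  with disj have card: "card (triangles (stage_graph x lev F')) + card \<T> \<le> card (triangles (stage_graph x lev F))"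
    by linarith
  from \<T>(3) show ?thesis
  proof
    assume *: "\<T> = triangles (stage_graph x lev F) \<and> q = x"
    have "stage_complete x lev F'"
      unfolding stage_complete_def
    proof (intro allI ballI impI)
      fix i c assume i: "i < m" "c \<in> apexes x i" "stage_r x \<le> lev c"
      show "i \<in> F'"
      proof (cases "i \<in> F")
        case False
        then have "insert c (ends_of (es ! i)) \<in> \<T>" using stage_triangleI i * by blast
        with i(1) \<T>(2) show ?thesis by blast
      qed (use \<T>(2) in blast)
    qed
    with * show ?thesis by blast
  qed (use card in auto)
qed

lemma stage_complete_mono: "stage_complete x lev F \<Longrightarrow> F \<subseteq> F' \<Longrightarrow> stage_complete x lev F'"
  unfolding stage_complete_def by blast

lemma m_pos: "0 < B \<Longrightarrow> 0 < m"
proof -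
  assume "0 < B"
  then have "0 < n" using B_le by linarith
  then obtain e where "e \<in> E"
    using represents unfolding represents_def no_isolated_def by blast
  then show "0 < m" using edge_ends by fastforce
qed

subsection \<open>The tripartitions separate every triangle\<close>

lemma wbit_bit: "wbit (2 * j) v = of_bool (bit v j)" "wbit (2 * j + 1) v = of_bool (\<not> bit v j)"
  by (auto simp: wbit_def bit_iff_odd_drop_bit mod2_eq_if)

lemma ex_bit_neq:
  assumes "a < n" "b < n" "a \<noteq> b"
  shows "\<exists>j<B. bit a j \<noteq> bit b j"
proof -
  obtain j where j: "bit a j \<noteq> bit b j" using assms(3) by (auto simp: bit_eq_iff)
  have "\<not> bit v j" if "v < n" "B \<le> j" for v
  proof -
    have "v < 2 ^ j" using that n_less power_increasing[OF that(2), of "2::nat"] by linarith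
    then show ?thesis by (simp add: bit_iff_odd)
  qed
  with j assms(1,2) show ?thesis by (metis not_le)
qed

text \<open>Take a bit in which \<open>a\<close> and \<open>b\<close> differ, complemented if
  \<open>c\<close> has a 0 there. This is why both polarities are among the \<open>2 * B\<close>
  tests.\<close>

lemma ex_wbit:
  assumes "a < n" "b < n" "a \<noteq> b"
  shows "\<exists>k<2 * B. wbit k c \<noteq> 0 \<and> (wbit k a = 0) \<noteq> (wbit k b = 0)"
proof -
  obtain j where j: "j < B" "bit a j \<noteq> bit b j" using ex_bit_neq[OF assms] by blast
  show ?thesis
  proof (cases "bit c j")
    case True
    with j show ?thesis by (intro exI[of _ "2 * j"]) (auto simp: wbit_bit)
  next
    case False
    with j show ?thesis by (intro exI[of _ "2 * j + 1"]) (auto simp only: wbit_bit, auto)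
  qed
qed

lemma ex_stage_of:
  assumes "k < 2 * B" "l < 2 * B"
  shows "\<exists>x<Q. stage_r x = 0 \<and> stage_k x = k \<and> stage_l x = l"
proof (intro exI conjI)
  let ?x = "(l * (2 * B) + k) * (B + 1)"
  have "l * (2 * B) + k < Suc l * (2 * B)" using assms(1) by simp
  also have "\<dots> \<le> 2 * B * (2 * B)" using assms(2) by (intro mult_right_mono) simp_all
  finally show "?x < Q" unfolding Q_def by (intro mult_strict_right_mono) simp_all
  have div: "?x div (B + 1) = l * (2 * B) + k" by (rule nonzero_mult_div_cancel_right) simp
  show "stage_r ?x = 0" unfolding stage_r_def by (rule mod_mult_self2_is_0)
  show "stage_k ?x = k" "stage_l ?x = l"
    unfolding stage_k_def stage_l_def div using assms by auto
qed

text \<open>The first test puts one of \<open>a\<close>, \<open>b\<close> into part 2 and keeps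
  \<open>c\<close> out of it; the second separates the other one, \<open>w\<close>, from
  \<open>c\<close>, giving it code 1 and \<open>c\<close> code 4.\<close>

lemma ex_stage:
  assumes "a < n" "b < n" "c < n" "a \<noteq> b" "b \<noteq> c" "a \<noteq> c"
  shows "\<exists>x<Q. stage_r x = 0 \<and> role x c = 4 \<and> role x a + role x b = 3"
proof -
  obtain k where k: "k < 2 * B" "wbit k c \<noteq> 0" "(wbit k a = 0) \<noteq> (wbit k b = 0)"
    using ex_wbit[OF assms(1,2,4)] by blast
  define w where "w = (if wbit k a = 0 then b else a)"
  have "w < n" "w \<noteq> c" using assms by (auto simp: w_def)
  then obtain l where l: "l < 2 * B" "wbit l c \<noteq> 0" "wbit l w = 0"
    using ex_wbit[of w c c] assms(3) by auto
  obtain x where x: "x < Q" "stage_r x = 0" "stage_k x = k" "stage_l x = l"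
    using ex_stage_of[OF k(1) l(1)] by blast
  have "role x c = 4 \<and> role x a + role x b = 3"
    using k l x(3,4) by (auto simp: role_def w_def split: if_splits)
  with x show ?thesis by blast
qed

text \<open>Threshold 0 admits every apex, so completeness of the last stage of each tripartition
  suffices.\<close>

lemma complete_found:
  assumes "\<And>x. x < Q \<Longrightarrow> stage_complete x lev F" "sound F"
  shows "i < m \<Longrightarrow> i \<in> F \<longleftrightarrow> (\<exists>\<Delta>\<in>triangles E. ends_of (es ! i) \<subseteq> \<Delta>)"
proof
  assume i: "i < m" and "\<exists>\<Delta>\<in>triangles E. ends_of (es ! i) \<subseteq> \<Delta>"
  then obtain \<Delta> where \<Delta>: "\<Delta> \<in> triangles E" "ends_of (es ! i) \<subseteq> \<Delta>" by blast
  let ?u = "fst (es ! i)" and ?v = "snd (es ! i)"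
  have uv: "?u \<noteq> ?v" "?u \<in> \<Delta>" "?v \<in> \<Delta>" using ends_neq[OF i] \<Delta>(2) by (auto simp: ends_of_def)
  have "\<exists>c. \<Delta> = {?u, ?v, c}"
  proof -
    obtain x y z where \<Delta>: "\<Delta> = {x, y, z}"
      using \<Delta>(1) by (rule triangles_cases)
    then have "{x, y, z} = {?u, ?v, x} \<or> {x, y, z} = {?u, ?v, y} \<or> {x, y, z} = {?u, ?v, z}"
      using uv by auto
    with \<Delta> show ?thesis by blast
  qed
  then obtain c where c: "c \<noteq> ?u" "c \<noteq> ?v" "{?u, c} \<in> E" "{?v, c} \<in> E"
    using triangles_pairs[of ?u ?v _ E] \<Delta>(1) by metis
  then have "c < n" using edge_less by blast
  with c uv(1) ends_less[OF i] obtain x where "x < Q" "stage_r x = 0" "role x c = 4" "role x ?u + role x ?v = 3"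
    using ex_stage[of ?u ?v c] by metis
  with c \<open>c < n\<close> assms(1)[of x] i show "i \<in> F"
    by (auto simp: stage_complete_def apexes_def)
qed (use assms(2) in \<open>auto simp: sound_def\<close>)

text \<open>The total load in units of m, with the successor covering the remainder lost in the
  division.\<close>

definition full_rounds :: "(nat \<Rightarrow> nat) \<Rightarrow> nat" where
  "full_rounds lev = (\<Sum>x<Q. stage_load x lev) div m + 1"

text \<open>A round that finds \<open>m\<close> triangles pays for itself out of the budget \<open>m * g\<close>, since the
  triangles it lists do not survive it; every other round completes a stage.\<close>

definition progress :: "(nat \<Rightarrow> nat) \<Rightarrow> nat \<Rightarrow> nat \<Rightarrow> nat set \<Rightarrow> bool" where
  "progress lev g q F \<longleftrightarrow> q \<le> Q \<and> sound F \<and> (\<forall>x<Q. q \<le> x \<longrightarrow> stage_complete x lev F) \<and>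
     (\<forall>x. q = Suc x \<longrightarrow>
        card (triangles (stage_graph x lev F)) + (\<Sum>y<x. stage_load y lev) \<le> m * g)"

lemma progress_init: "progress lev (full_rounds lev) Q {}"
  unfolding progress_def
proof (intro conjI allI impI)
  fix x assume x: "Q = Suc x"
  have "0 < B" using x by (cases "B = 0") (auto simp: Q_def)
  then have "0 < m" by (rule m_pos)
  \<comment> \<open>\<open>Q\<close> is a multiple of \<open>B + 1\<close>, so the first stage has
    the top threshold and presupposes no earlier one.\<close>
  have "(B + 1) dvd Suc x" unfolding x[symmetric] Q_def by (rule dvd_triv_right)
  then have "stage_r x = B"
    unfolding stage_r_def by (metis add.commute mod_0_imp_dvd mod_Suc dvd_imp_mod_0 nat.distinct(1) plus_1_eq_Suc nat.inject)
  then have "card (triangles (stage_graph x lev {})) \<le> stage_load x lev"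
    by (intro card_stage_triangles_le) simp
  then have "card (triangles (stage_graph x lev {})) + (\<Sum>y<x. stage_load y lev) \<le> (\<Sum>y<Q. stage_load y lev)"
    by (simp add: x)
  also have "\<dots> \<le> m * full_rounds lev"
    unfolding full_rounds_def using \<open>0 < m\<close> by (simp add: dividend_less_times_div less_imp_le)
  finally show "card (triangles (stage_graph x lev {})) + (\<Sum>y<x. stage_load y lev) \<le> m * full_rounds lev" .
qed (auto simp: sound_def)

lemma progress_step:
  assumes "progress lev g (Suc x) F" "round_step x lev F F' q"
  shows "(q = Suc x \<and> (\<exists>g'. g = Suc g' \<and> progress lev g' q F')) \<or> (q = x \<and> progress lev g q F')"
proof -
  have pr: "x < Q" "sound F" "\<And>y. y < Q \<Longrightarrow> Suc x \<le> y \<Longrightarrow> stage_complete y lev F"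
    "card (triangles (stage_graph x lev F)) + (\<Sum>y<x. stage_load y lev) \<le> m * g"
    using assms(1) by (auto simp: progress_def)
  have "0 < m" using m_pos stage_bounds(4)[OF pr(1)] by blast
  have sound: "sound F'" using round_step_sound[OF assms(2) pr(2)] .
  have compl: "stage_complete y lev F'" if "y < Q" "Suc x \<le> y" for y
    using stage_complete_mono[OF pr(3)[OF that] round_step_mono[OF assms(2)]] .
  from round_step_cases[OF assms(2)] show ?thesis
  proof
    assume *: "q = Suc x \<and> card (triangles (stage_graph x lev F')) + m \<le> card (triangles (stage_graph x lev F))"
    with pr(4) have "m \<le> m * g" by linarith
    then obtain g' where g': "g = Suc g'" using \<open>0 < m\<close> by (cases g) auto
    have "card (triangles (stage_graph x lev F')) + (\<Sum>y<x. stage_load y lev) \<le> m * g'"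
      using * pr(4) g' by simp
    then have "progress lev g' (Suc x) F'"
      using pr(1) sound compl by (auto simp: progress_def)
    with * g' show ?thesis by blast
  next
    assume *: "q = x \<and> stage_complete x lev F'"
    have "progress lev g x F'"
      unfolding progress_def
    proof (intro conjI allI impI)
      show "stage_complete y lev F'" if "y < Q" "x \<le> y" for y
        using compl[of y] that * by (cases "x = y") auto
      fix z assume z: "x = Suc z"
      \<comment> \<open>The triangles of the next stage are paid for by its own summand
        \<open>stage_load z lev\<close>, set aside so far.\<close>
      have "card (triangles (stage_graph z lev F')) \<le> stage_load z lev"
        using * z by (intro card_stage_triangles_le) auto
      then show "card (triangles (stage_graph z lev F')) + (\<Sum>y<z. stage_load y lev) \<le> m * g"
        using pr(4) by (simp add: z)
    qed (use pr(1) sound in auto)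
    with * show ?thesis by blast
  qed
qed

text \<open>Crude but valid for all levels: the call counter must fit into a word on every tape, not
  just on average.\<close>

lemma full_rounds_le: "full_rounds lev \<le> Q * n + 1"
proof -
  have "(\<Sum>x<Q. stage_load x lev) \<le> (\<Sum>x<Q. m * n)"
    by (intro sum_mono stage_load_le)
  also have "\<dots> = (Q * n) * m" by simp
  finally have "(\<Sum>x<Q. stage_load x lev) div m \<le> (Q * n) * m div m"
    by (rule div_le_mono)
  also have "\<dots> \<le> Q * n" by (cases "m = 0") simp_all
  finally show ?thesis by (simp add: full_rounds_def)
qed

lemma output_wp:
  assumes "base s" "\<And>i. i < m \<Longrightarrow> mem s 4 i = f i"
  shows "wp W (5 * m + 2) output_prog (\<lambda>t. outp t = map f [0..<m]) s"
proof -
  let ?I = "\<lambda>k (t::state). regs t 1 = m \<and> regs t 2 = 1 \<and> mem t 4 = mem s 4 \<and> k \<le> m \<and> outp t = map f [0..<m - k]"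
  have W: "m < W" "1 < W" using W_ge_quartic(3) by linarith+
  have b: "regs s 1 = m" "regs s (Suc 0) = m" "regs s 2 = 1" "regs s 8 = 0" "outp s = []"
    using assms(1) by (simp_all add: base_def)
  show ?thesis
    unfolding output_prog_def
  proof (rule wp_seq[where ?\<tau>1.0 = 1 and ?\<tau>2.0 = "m * (4 + 1) + 1" and P = "\<lambda>t. ?I m t \<and> regs t 10 = m"])
    show "wp W 1 [Op Add 10 1 8] (\<lambda>t. ?I m t \<and> regs t 10 = m) s"
      using b W by simp
    fix t :: state assume t: "?I m t \<and> regs t 10 = m"
    show "wp W (m * (4 + 1) + 1) [While 10 [Op Sub 11 1 10, Load 11 4 11, Out 11, Op Sub 10 10 2]]
      (\<lambda>t. outp t = map f [0..<m]) t"
    proof (rule wp_mono[OF wp_count[where I = ?I and x = 10 and N = m]])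
      fix k and u :: state assume I: "?I (Suc k) u" and k: "k < m" "regs u 10 = Suc k"
      have "mem u 4 (m - Suc k) = f (m - Suc k)" using I k assms(2) by simp
      moreover have "m - k = Suc (m - Suc k)" using k by simp
      moreover have "m - Suc k < W" "k < W" using k W by linarith+
      ultimately show "wp W 4 [Op Sub 11 1 10, Load 11 4 11, Out 11, Op Sub 10 10 2] (\<lambda>t. ?I k t \<and> regs t 10 = k) u"
        using I k by simp
    qed (use t in auto)
  qed simp
qed

end

section \<open>The complete detection program\<close>

context listing_round
begin

lemma loop_wp:
  assumes "between_rounds lev {} Q 0 s"
  shows "wp W ((Q + full_rounds lev) * (round_time + 1) + 1) [While 4 (round_prog R p)]
    (\<lambda>t. base t \<and> (\<forall>i<m. mem t 4 i = of_bool (\<exists>\<Delta>\<in>triangles E. ends_of (es ! i) \<subseteq> \<Delta>))) s"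
proof -
  \<comment> \<open>The variant is stages left plus full calls still paid for. It loses one per
    round while the call counter \<open>c\<close> gains one, and their constant sum keeps
    \<open>c\<close> below the word bound.\<close>
  define I where "I = (\<lambda>k (t::state). \<exists>g q F c. k = q + g \<and> progress lev g q F \<and> between_rounds lev F q c t \<and>
    c + k = Q + full_rounds lev)"
  have "wp W ((Q + full_rounds lev) * (round_time + 1) + 1) [While 4 (round_prog R p)]
    (\<lambda>t. (\<exists>k. I k t) \<and> regs t 4 = 0) s"
  proof (rule wp_loop[where I = I])
    show "I (Q + full_rounds lev) s"
      using assms progress_init unfolding I_def by (metis add_0)
    fix k t assume "I k t" "regs t 4 \<noteq> 0"
    then obtain g q F c where k: "k = q + g" "c + k = Q + full_rounds lev"
      and pr: "progress lev g q F" and br: "between_rounds lev F q c t"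
      unfolding I_def by blast
    then have "q \<noteq> 0" using \<open>regs t 4 \<noteq> 0\<close> by (simp add: between_rounds_def core_def)
    then obtain x where x: "q = Suc x" by (cases q) auto
    have xQ: "x < Q" using pr x by (simp add: progress_def)
    obtain k' where k': "k = Suc k'" using k(1) x by simp
    have "Suc c < W" using k(2) k' full_rounds_le[of lev] Q_less by simp
    then have "wp W round_time (round_prog R p)
        (\<lambda>t. \<exists>F' q. round_step x lev F F' q \<and> between_rounds lev F' q (Suc c) t) t"
      using round_wp br xQ x by blast
    then have "wp W round_time (round_prog R p) (I k') t"
    proof (rule wp_mono)
      fix u assume "\<exists>F' q. round_step x lev F F' q \<and> between_rounds lev F' q (Suc c) u"
      then obtain F' q' where u: "round_step x lev F F' q'" "between_rounds lev F' q' (Suc c) u" by blast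
      have c: "Suc c + k' = Q + full_rounds lev" using k(2) k' by simp
      have "\<exists>g'. k' = q' + g' \<and> progress lev g' q' F'"
        using progress_step[OF pr[unfolded x] u(1)] k(1) k' x by auto
      with u(2) c show "I k' u" unfolding I_def by blast
    qed simp
    with k' show "\<exists>k'. k = Suc k' \<and> wp W round_time (round_prog R p) (I k') t" by blast
  qed
  then show ?thesis
  proof (rule wp_mono)
    fix t assume "(\<exists>k. I k t) \<and> regs t 4 = 0"
    then obtain g q F c where pr: "progress lev g q F" "between_rounds lev F q c t" "regs t 4 = 0"
      unfolding I_def by blast
    then have q: "q = 0" by (simp add: between_rounds_def core_def)
    have "i \<in> F \<longleftrightarrow> (\<exists>\<Delta>\<in>triangles E. ends_of (es ! i) \<subseteq> \<Delta>)" if "i < m" for i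
      using complete_found[OF _ _ that] pr(1) unfolding q progress_def by blast
    moreover have "base t" "\<forall>i<m. mem t 4 i = of_bool (i \<in> F)"
      using pr(2) by (auto simp: between_rounds_def core_def prepared_def)
    ultimately show "base t \<and> (\<forall>i<m. mem t 4 i = of_bool (\<exists>\<Delta>\<in>triangles E. ends_of (es ! i) \<subseteq> \<Delta>))"
      by auto
  qed simp
qed

text \<open>The coins enter only through the number of full rounds, and linearly, so its expectation
  is all that is needed.\<close>

definition detection_time :: "(nat \<Rightarrow> nat) \<Rightarrow> nat" where
  "detection_time lev = 3 * B + n * (5 * B + 7) + 15 * m + 14 + (Q + full_rounds lev) * (round_time + 1)"

lemma detection_wp:
  "wp W (detection_time (coin_level \<omega>)) (detection_prog R p) (\<lambda>t. outp t = detection_output es E)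
    (input [n, m] es \<omega>)"
proof -
  let ?lev = "coin_level \<omega>"
  let ?T = "(Q + full_rounds ?lev) * (round_time + 1) + 1"
  let ?f = "\<lambda>i. of_bool (\<exists>\<Delta>\<in>triangles E. ends_of (es ! i) \<subseteq> \<Delta>) :: nat"
  have out: "map ?f [0..<m] = detection_output es E"
    unfolding detection_output_def by (rule nth_equalityI) simp_all
  have out_wp: "wp W (5 * m + 2) output_prog (\<lambda>t. outp t = detection_output es E) t"
    if "base t \<and> (\<forall>i<m. mem t 4 i = ?f i)" for t
    using output_wp[of t ?f] that unfolding out by blast
  show ?thesis
    unfolding detection_prog_def detection_time_def
  proof (rule wp_seq[OF init_wp, where ?\<tau>2.0 = "(n * (5 * B + 7) + 2) + ((10 * m + 6) + (?T + (5 * m + 2)))"])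
    fix s assume s: "base s \<and> fresh s \<and> regs s 3 = B \<and> coins s = \<omega>"
    show "wp W ((n * (5 * B + 7) + 2) + ((10 * m + 6) + (?T + (5 * m + 2))))
      (levels_prog @ index_prog @ [While 4 (round_prog R p)] @ output_prog)
      (\<lambda>t. outp t = detection_output es E) s"
    proof (rule wp_seq[OF levels_wp, where ?\<tau>2.0 = "(10 * m + 6) + (?T + (5 * m + 2))"])
      fix s assume s: "base s \<and> fresh s \<and> regs s 3 = B \<and> (\<forall>v<n. mem s 3 v = ?lev v)"
      show "wp W ((10 * m + 6) + (?T + (5 * m + 2))) (index_prog @ [While 4 (round_prog R p)] @ output_prog)
        (\<lambda>t. outp t = detection_output es E) s"
      proof (rule wp_seq[OF index_wp, where ?\<tau>2.0 = "?T + (5 * m + 2)"])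
        fix s assume s: "prepared ?lev s \<and> fresh s \<and> regs s 4 = Q"
        have "between_rounds ?lev {} Q 0 s"
          using s by (simp add: between_rounds_def core_def fresh_def stamped_def)
        then show "wp W (?T + (5 * m + 2)) ([While 4 (round_prog R p)] @ output_prog)
          (\<lambda>t. outp t = detection_output es E) s"
          by (rule wp_seq[OF loop_wp out_wp order_refl])
      qed (use s in auto)
    qed (use s in auto)
  qed simp
qed

end

section \<open>Expected number of rounds\<close>

lemma le_length_takeWhile:
  "r \<le> length xs \<Longrightarrow> r \<le> length (takeWhile P xs) \<longleftrightarrow> (\<forall>t<r. P (xs ! t))"
proof (induction xs arbitrary: r)
  case (Cons x xs)
  then show ?case by (cases r) (auto simp: All_less_Suc2)
qed simp

definition coin_lists :: "nat \<Rightarrow> bool list set" where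
  "coin_lists N = {bs. length bs = N}"

lemma finite_coin_lists: "finite (coin_lists N)"
  and card_coin_lists: "card (coin_lists N) = 2 ^ N"
  using finite_lists_length_eq[of "UNIV :: bool set" N] card_lists_length_eq[of "UNIV :: bool set" N]
  by (simp_all add: coin_lists_def)

lemma coin_lists_Suc: "sum f (coin_lists (Suc N)) = (\<Sum>bs\<in>coin_lists N. f (True # bs)) + (\<Sum>bs\<in>coin_lists N. f (False # bs))"
proof -
  have "coin_lists (Suc N) = (#) True ` coin_lists N \<union> (#) False ` coin_lists N"
    by (auto simp: coin_lists_def length_Suc_conv image_iff)
  moreover have "(#) True ` coin_lists N \<inter> (#) False ` coin_lists N = {}" by auto
  ultimately show ?thesis
    by (simp add: sum.union_disjoint finite_coin_lists sum.reindex inj_on_def)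
qed

lemma stake_measurable: "stake N \<in> coin_tape \<rightarrow>\<^sub>M count_space UNIV"
proof -
  have "sets coin_tape = sets (stream_space (count_space UNIV))"
    unfolding coin_tape_def by (rule sets_stream_space_cong) simp
  then show ?thesis
    by (subst measurable_cong_sets[OF _ refl]) (auto intro: measurable_stake)
qed

text \<open>The first N coins are uniform on the lists of length N; induction splits off the first
  coin. The factor stands on the left to avoid division in \<open>ennreal\<close>.\<close>

lemma nn_integral_coin_tape:
  "2 ^ N * (\<integral>\<^sup>+ \<omega>. f (stake N \<omega>) \<partial>coin_tape) = (\<Sum>bs\<in>coin_lists N. f bs :: ennreal)"
proof (induction N arbitrary: f)
  case 0
  interpret prob_space coin_tape
    unfolding coin_tape_def by (rule prob_space.prob_space_stream_space) (rule measure_pmf.prob_space_axioms)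
  show ?case by (simp add: coin_lists_def emeasure_space_1)
next
  case (Suc N)
  have "(\<lambda>\<omega>. f (stake (Suc N) \<omega>)) \<in> borel_measurable coin_tape"
    by (rule measurable_compose[OF stake_measurable]) simp
  then have "(\<integral>\<^sup>+ \<omega>. f (stake (Suc N) \<omega>) \<partial>coin_tape) =
      (\<integral>\<^sup>+ b. (\<integral>\<^sup>+ \<omega>. f (b # stake N \<omega>) \<partial>coin_tape) \<partial>measure_pmf (bernoulli_pmf (1/2)))"
    unfolding coin_tape_def
    by (subst prob_space.nn_integral_stream_space[OF measure_pmf.prob_space_axioms]) simp_all
  also have "\<dots> = (\<integral>\<^sup>+ \<omega>. f (True # stake N \<omega>) \<partial>coin_tape) * ennreal (1/2) +
      (\<integral>\<^sup>+ \<omega>. f (False # stake N \<omega>) \<partial>coin_tape) * ennreal (1/2)"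
    by (subst nn_integral_bernoulli_pmf) simp_all
  finally have eq: "(\<integral>\<^sup>+ \<omega>. f (stake (Suc N) \<omega>) \<partial>coin_tape) =
    ((\<integral>\<^sup>+ \<omega>. f (True # stake N \<omega>) \<partial>coin_tape) + (\<integral>\<^sup>+ \<omega>. f (False # stake N \<omega>) \<partial>coin_tape)) * ennreal (1/2)"
    by (simp add: distrib_right)
  have half: "2 * ennreal (1/2) = 1"
    by (subst ennreal_numeral[symmetric], subst ennreal_mult'[symmetric]) simp_all
  have "2 ^ Suc N * (\<integral>\<^sup>+ \<omega>. f (stake (Suc N) \<omega>) \<partial>coin_tape) =
    (2 * ennreal (1/2)) * (2 ^ N * (\<integral>\<^sup>+ \<omega>. f (True # stake N \<omega>) \<partial>coin_tape) +
      2 ^ N * (\<integral>\<^sup>+ \<omega>. f (False # stake N \<omega>) \<partial>coin_tape))"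
    unfolding eq by (simp add: algebra_simps)
  then show ?case
    unfolding half coin_lists_Suc Suc.IH[of "\<lambda>bs. f (True # bs)", symmetric]
      Suc.IH[of "\<lambda>bs. f (False # bs)", symmetric] by simp
qed

section \<open>Levels as functions of finite coin lists\<close>

context graph_input
begin

definition list_level :: "bool list \<Rightarrow> nat \<Rightarrow> nat" where
  "list_level bs v = length (takeWhile id (take B (drop ((n - 1 - v) * B) bs)))"

definition coin_pos :: "nat \<Rightarrow> nat \<Rightarrow> nat" where
  "coin_pos v t = (n - 1 - v) * B + t"

definition flip :: "nat \<Rightarrow> nat \<Rightarrow> bool list \<Rightarrow> bool list" where
  "flip c r bs = bs[coin_pos c r := \<not> bs ! coin_pos c r]"

lemma coin_pos_block: "v < n \<Longrightarrow> (n - 1 - v) * B + B \<le> n * B"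
proof -
  assume "v < n"
  then have "Suc (n - 1 - v) * B \<le> n * B" by (intro mult_right_mono) simp_all
  then show ?thesis by simp
qed

lemma coin_pos_less: "v < n \<Longrightarrow> t < B \<Longrightarrow> coin_pos v t < n * B"
  using coin_pos_block[of v] by (simp add: coin_pos_def)

lemma coin_pos_inj:
  assumes "v < n" "v' < n" "t < B" "t' < B" "coin_pos v t = coin_pos v' t'"
  shows "v = v'" "t = t'"
proof -
  have div: "coin_pos v t div B = n - 1 - v" "coin_pos v t mod B = t" if "t < B" for v t
    using that by (simp_all add: coin_pos_def)
  have "n - 1 - v = n - 1 - v'" "t = t'" using assms(3-5) div by metis+
  with assms(1,2) show "v = v'" "t = t'" by linarith+
qed

lemma le_list_level:
  assumes "bs \<in> coin_lists (n * B)" "v < n" "r \<le> B"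
  shows "r \<le> list_level bs v \<longleftrightarrow> (\<forall>t<r. bs ! coin_pos v t)"
proof -
  have "B \<le> length (drop ((n - 1 - v) * B) bs)"
    using assms(1) coin_pos_block[OF assms(2)] by (simp add: coin_lists_def)
  then have "r \<le> list_level bs v \<longleftrightarrow> (\<forall>t<r. take B (drop ((n - 1 - v) * B) bs) ! t)"
    unfolding list_level_def using assms(3) by (subst le_length_takeWhile) simp_all
  also have "\<dots> \<longleftrightarrow> (\<forall>t<r. bs ! coin_pos v t)"
    using assms coin_pos_block[OF assms(2)] by (auto simp: coin_pos_def coin_lists_def)
  finally show ?thesis .
qed

lemma flip_coin_lists: "bs \<in> coin_lists N \<Longrightarrow> flip c r bs \<in> coin_lists N"
  by (simp add: coin_lists_def flip_def)

lemma inj_flip: "coin_pos c r < N \<Longrightarrow> inj_on (flip c r) (coin_lists N)"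
proof -
  assume "coin_pos c r < N"
  then have "flip c r (flip c r bs) = bs" if "bs \<in> coin_lists N" for bs
    using that by (simp add: flip_def coin_lists_def)
  then show ?thesis by (metis inj_onI)
qed

text \<open>For r < B the level of \<open>c\<close> is r iff its first r coins are heads and the
  next is tails. Flipping that coin exchanges level r with all levels above r, and the blocks of
  other vertices are untouched.\<close>

lemma flip_level:
  assumes "bs \<in> coin_lists (n * B)" "c < n" "r < B"
  shows "v < n \<Longrightarrow> v \<noteq> c \<Longrightarrow> k \<le> B \<Longrightarrow> k \<le> list_level (flip c r bs) v \<longleftrightarrow> k \<le> list_level bs v"
    and "list_level bs c = r \<longleftrightarrow> Suc r \<le> list_level (flip c r bs) c"
    and "list_level (flip c r bs) c = r \<longleftrightarrow> Suc r \<le> list_level bs c"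
proof -
  note f = flip_coin_lists[OF assms(1), of c r]
  have len: "length bs = n * B" using assms(1) by (simp add: coin_lists_def)
  have nth: "flip c r bs ! coin_pos v t = (if v = c \<and> t = r then \<not> bs ! coin_pos v t else bs ! coin_pos v t)"
    if "v < n" "t < B" for v t
    using coin_pos_inj[OF that(1) assms(2) that(2) assms(3)] coin_pos_less[OF assms(2,3)]
    by (auto simp: flip_def nth_list_update len)
  show "k \<le> list_level (flip c r bs) v \<longleftrightarrow> k \<le> list_level bs v" if "v < n" "v \<noteq> c" "k \<le> B"
    using that by (auto simp: le_list_level[OF assms(1)] le_list_level[OF f] nth)
  have eq: "list_level bs' c = r \<longleftrightarrow> (\<forall>t<r. bs' ! coin_pos c t) \<and> \<not> bs' ! coin_pos c r"
    and le: "Suc r \<le> list_level bs' c \<longleftrightarrow> (\<forall>t<r. bs' ! coin_pos c t) \<and> bs' ! coin_pos c r"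
    if "bs' \<in> coin_lists (n * B)" for bs'
  proof -
    show *: "Suc r \<le> list_level bs' c \<longleftrightarrow> (\<forall>t<r. bs' ! coin_pos c t) \<and> bs' ! coin_pos c r"
      using le_list_level[OF that assms(2), of "Suc r"] assms(3) by (auto simp: less_Suc_eq)
    have "r \<le> list_level bs' c \<longleftrightarrow> (\<forall>t<r. bs' ! coin_pos c t)"
      using le_list_level[OF that assms(2), of r] assms(3) by simp
    with * show "list_level bs' c = r \<longleftrightarrow> (\<forall>t<r. bs' ! coin_pos c t) \<and> \<not> bs' ! coin_pos c r"
      by (metis le_antisym not_less_eq_eq)
  qed
  have "flip c r bs ! coin_pos c r \<longleftrightarrow> \<not> bs ! coin_pos c r"
    "\<And>t. t < r \<Longrightarrow> flip c r bs ! coin_pos c t \<longleftrightarrow> bs ! coin_pos c t"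
    using nth[OF assms(2)] assms(3) by auto
  then show "list_level bs c = r \<longleftrightarrow> Suc r \<le> list_level (flip c r bs) c"
    "list_level (flip c r bs) c = r \<longleftrightarrow> Suc r \<le> list_level bs c"
    unfolding eq[OF assms(1)] eq[OF f] le[OF assms(1)] le[OF f] by auto
qed

lemma sum_card_swap:
  assumes "finite A" "finite C"
  shows "(\<Sum>a\<in>A. card {c \<in> C. P a c}) = (\<Sum>c\<in>C. card {a \<in> A. P a c})"
proof -
  have "(\<Sum>a\<in>A. \<Sum>c\<in>C. of_bool (P a c)) = (\<Sum>c\<in>C. \<Sum>a\<in>A. of_bool (P a c) :: nat)"
    by (rule sum.swap)
  then show ?thesis using assms by (simp add: sum_of_bool_eq Int_def)
qed

text \<open>Flipping the coin that stopped the level of \<open>c\<close> at \<open>r\<close> turns \<open>c\<close> from one of possibly many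
  maxima into the unique one, so on average there is at most one maximum at level \<open>r\<close>.\<close>

lemma sum_maxima_le:
  assumes "C \<subseteq> {..<n}" "r < B"
  shows "(\<Sum>bs\<in>coin_lists (n * B).
    card {c \<in> C. r \<le> list_level bs c \<and> (\<forall>c'\<in>C. list_level bs c' \<le> r)}) \<le> 2 ^ (n * B)"
proof -
  let ?L = "coin_lists (n * B)"
  have finC: "finite C" using assms(1) finite_subset by blast
  \<comment> \<open>In \<open>U c\<close> the vertex \<open>c\<close> is the only one of
    \<open>C\<close> above r. These sets are disjoint, so their sizes add up to at most the number
    of all lists.\<close>
  define U where "U = (\<lambda>c. {bs \<in> ?L. Suc r \<le> list_level bs c \<and> (\<forall>c'\<in>C - {c}. list_level bs c' \<le> r)})"
  have fin: "finite (U c)" for c by (simp add: U_def finite_coin_lists)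
  have le: "card {bs \<in> ?L. r \<le> list_level bs c \<and> (\<forall>c'\<in>C. list_level bs c' \<le> r)} \<le> card (U c)" if c: "c \<in> C" for c
  proof (rule card_inj_on_le)
    have cn: "c < n" using c assms(1) by blast
    show "inj_on (flip c r) {bs \<in> ?L. r \<le> list_level bs c \<and> (\<forall>c'\<in>C. list_level bs c' \<le> r)}"
      by (rule inj_on_subset[OF inj_flip[OF coin_pos_less[OF cn assms(2)]]]) blast
    show "flip c r ` {bs \<in> ?L. r \<le> list_level bs c \<and> (\<forall>c'\<in>C. list_level bs c' \<le> r)} \<subseteq> U c"
    proof (intro image_subsetI)
      fix bs assume "bs \<in> {bs \<in> ?L. r \<le> list_level bs c \<and> (\<forall>c'\<in>C. list_level bs c' \<le> r)}"
      then have bs: "bs \<in> ?L" "list_level bs c = r" "\<forall>c'\<in>C. list_level bs c' \<le> r"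
        using c by (auto intro: le_antisym)
      have "list_level (flip c r bs) c' \<le> r" if "c' \<in> C - {c}" for c'
        using flip_level(1)[OF bs(1) cn assms(2), of c' "Suc r"] that bs(3) assms by (auto simp: not_less_eq_eq[symmetric])
      moreover have "Suc r \<le> list_level (flip c r bs) c"
        using flip_level(2)[OF bs(1) cn assms(2)] bs(2) by simp
      ultimately show "flip c r bs \<in> U c"
        using flip_coin_lists[OF bs(1)] by (simp add: U_def)
    qed
  qed (rule fin)
  have "(\<Sum>bs\<in>?L. card {c \<in> C. r \<le> list_level bs c \<and> (\<forall>c'\<in>C. list_level bs c' \<le> r)}) =
      (\<Sum>c\<in>C. card {bs \<in> ?L. r \<le> list_level bs c \<and> (\<forall>c'\<in>C. list_level bs c' \<le> r)})"
    by (rule sum_card_swap[OF finite_coin_lists finC])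
  also have "\<dots> \<le> (\<Sum>c\<in>C. card (U c))"
    by (intro sum_mono le)
  also have "\<dots> = card (\<Union>c\<in>C. U c)"
  proof (rule card_UN_disjoint[symmetric])
    show "\<forall>c\<in>C. \<forall>c'\<in>C. c \<noteq> c' \<longrightarrow> U c \<inter> U c' = {}"
    proof (intro ballI impI)
      fix c c' assume c: "c \<in> C" "c' \<in> C" "c \<noteq> c'"
      have "bs \<notin> U c'" if "bs \<in> U c" for bs
      proof
        assume "bs \<in> U c'"
        then have "list_level bs c \<le> r" using c by (simp add: U_def)
        moreover have "Suc r \<le> list_level bs c" using that by (simp add: U_def)
        ultimately show False by simp
      qed
      then show "U c \<inter> U c' = {}" by blast
    qed
  qed (use finC fin in auto)
  also have "\<dots> \<le> card ?L"
    by (rule card_mono[OF finite_coin_lists]) (auto simp: U_def)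
  finally show ?thesis by (simp add: card_coin_lists)
qed

text \<open>A level is at least r with probability at most 2 ^ -r: flipping coin r injects the lists
  with level above r into those with level r, so each further level at least halves the
  count.\<close>

lemma card_high_level:
  assumes "c < n" "r \<le> B"
  shows "2 ^ r * card {bs \<in> coin_lists (n * B). r \<le> list_level bs c} \<le> 2 ^ (n * B)"
  using assms(2)
proof (induction r)
  case 0
  then show ?case by (simp add: card_coin_lists)
next
  case (Suc r)
  let ?L = "coin_lists (n * B)"
  have r: "r < B" using Suc by simp
  have "card {bs \<in> ?L. Suc r \<le> list_level bs c} \<le> card {bs \<in> ?L. list_level bs c = r}"
  proof (rule card_inj_on_le)
    show "inj_on (flip c r) {bs \<in> ?L. Suc r \<le> list_level bs c}"
      by (rule inj_on_subset[OF inj_flip[OF coin_pos_less[OF assms(1) r]]]) blast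
    show "flip c r ` {bs \<in> ?L. Suc r \<le> list_level bs c} \<subseteq> {bs \<in> ?L. list_level bs c = r}"
      using flip_level(3)[OF _ assms(1) r] flip_coin_lists by blast
  qed (simp add: finite_coin_lists)
  moreover have "card {bs \<in> ?L. r \<le> list_level bs c} =
      card {bs \<in> ?L. list_level bs c = r} + card {bs \<in> ?L. Suc r \<le> list_level bs c}"
    by (subst card_Un_disjoint[symmetric]) (auto simp: finite_coin_lists intro!: arg_cong[where f = card])
  ultimately have "2 * card {bs \<in> ?L. Suc r \<le> list_level bs c} \<le> card {bs \<in> ?L. r \<le> list_level bs c}"
    by linarith
  then have "2 ^ r * (2 * card {bs \<in> ?L. Suc r \<le> list_level bs c}) \<le> 2 ^ r * card {bs \<in> ?L. r \<le> list_level bs c}"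
    by (rule mult_le_mono2)
  also have "\<dots> \<le> 2 ^ (n * B)" using Suc.IH r by simp
  finally show ?case by (simp add: mult_ac)
qed

text \<open>No coin stops a level at the cap \<open>B\<close>, so the flipping argument is replaced
  by a union bound over at most n < 2 ^ B vertices.\<close>

lemma sum_top_le:
  assumes "C \<subseteq> {..<n}"
  shows "(\<Sum>bs\<in>coin_lists (n * B). card {c \<in> C. B \<le> list_level bs c}) \<le> 2 ^ (n * B)"
proof -
  let ?L = "coin_lists (n * B)"
  have finC: "finite C" using assms finite_subset by blast
  have "2 ^ B * (\<Sum>bs\<in>?L. card {c \<in> C. B \<le> list_level bs c}) =
      (\<Sum>c\<in>C. 2 ^ B * card {bs \<in> ?L. B \<le> list_level bs c})"
    unfolding sum_card_swap[OF finite_coin_lists finC] by (rule sum_distrib_left)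
  also have "\<dots> \<le> (\<Sum>c\<in>C. 2 ^ (n * B))"
    using assms by (intro sum_mono card_high_level) auto
  also have "\<dots> = card C * 2 ^ (n * B)" by simp
  also have "\<dots> \<le> 2 ^ B * 2 ^ (n * B)"
    using card_mono[OF _ assms] n_less by (intro mult_right_mono) auto
  finally show ?thesis by simp
qed

lemma sum_stage_load_le:
  "(\<Sum>bs\<in>coin_lists (n * B). stage_load x (list_level bs)) \<le> m * 2 ^ (n * B)"
proof -
  have "(\<Sum>bs\<in>coin_lists (n * B). card (top_apexes x (list_level bs) i)) \<le> 2 ^ (n * B)" for i
  proof (cases "stage_r x < B")
    case True
    then show ?thesis
      using sum_maxima_le[OF finite_apexes(2)[of x i] True] by (simp add: top_apexes_def)
  next
    case False
    moreover have "stage_r x \<le> B" by (simp add: stage_r_def less_Suc_eq_le[symmetric])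
    ultimately show ?thesis
      using sum_top_le[OF finite_apexes(2)[of x i]] by (simp add: top_apexes_def)
  qed
  then have "(\<Sum>i<m. \<Sum>bs\<in>coin_lists (n * B). card (top_apexes x (list_level bs) i)) \<le> (\<Sum>i<m. 2 ^ (n * B))"
    by (intro sum_mono)
  then show ?thesis
    unfolding stage_load_def by (subst sum.swap) simp
qed

lemma sum_full_rounds_le:
  "(\<Sum>bs\<in>coin_lists (n * B). full_rounds (list_level bs)) \<le> 2 ^ (n * B) * (Q + 1)"
proof -
  let ?L = "coin_lists (n * B)" and ?S = "\<lambda>bs. \<Sum>x<Q. stage_load x (list_level bs)"
  have "m * (\<Sum>bs\<in>?L. ?S bs div m) \<le> (\<Sum>bs\<in>?L. ?S bs)"
    unfolding sum_distrib_left by (intro sum_mono) simp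
  also have "\<dots> \<le> (\<Sum>x<Q. m * 2 ^ (n * B))"
    by (subst sum.swap) (intro sum_mono sum_stage_load_le)
  finally have "m * (\<Sum>bs\<in>?L. ?S bs div m) \<le> m * (2 ^ (n * B) * Q)"
    by (simp add: mult_ac)
  then have "(\<Sum>bs\<in>?L. ?S bs div m) \<le> 2 ^ (n * B) * Q"
    \<comment> \<open>For m = 0 each quotient is 0, as division by zero yields 0.\<close>
    by (cases "m = 0") simp_all
  then show ?thesis
    unfolding full_rounds_def sum.distrib by (simp add: card_coin_lists distrib_left)
qed

lemma full_rounds_cong:
  assumes "\<And>v. v < n \<Longrightarrow> lev v = lev' v"
  shows "full_rounds lev = full_rounds lev'"
proof -
  have "top_apexes x lev i = top_apexes x lev' i" for x i
    using finite_apexes(2)[of x i] assms by (auto simp: top_apexes_def subset_iff)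
  then show ?thesis by (simp add: full_rounds_def stage_load_def)
qed

lemma coin_level_list: "v < n \<Longrightarrow> coin_level \<omega> v = list_level (stake (n * B) \<omega>) v"
proof -
  assume "v < n"
  then have "B \<le> n * B - (n - Suc v) * B" using coin_pos_block[of v] by simp
  then show ?thesis
    by (simp add: coin_level_def list_level_def drop_stake take_stake min_def)
qed

lemma expected_full_rounds:
  "(\<integral>\<^sup>+ \<omega>. of_nat (full_rounds (coin_level \<omega>)) \<partial>coin_tape) \<le> of_nat (Q + 1)"
proof -
  let ?N = "n * B"
  let ?J = "\<integral>\<^sup>+ \<omega>. of_nat (full_rounds (list_level (stake ?N \<omega>))) \<partial>coin_tape"
  have "full_rounds (coin_level \<omega>) = full_rounds (list_level (stake ?N \<omega>))" for \<omega>
    by (rule full_rounds_cong[OF coin_level_list])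
  then have "(\<integral>\<^sup>+ \<omega>. of_nat (full_rounds (coin_level \<omega>)) \<partial>coin_tape) = ?J" by simp
  moreover have "2 ^ ?N * ?J = of_nat (\<Sum>bs\<in>coin_lists ?N. full_rounds (list_level bs))"
    by (subst nn_integral_coin_tape) simp
  then have "2 ^ ?N * ?J \<le> of_nat (2 ^ ?N * (Q + 1))"
    using sum_full_rounds_le by (simp only: of_nat_le_iff)
  then have "2 ^ ?N * ?J \<le> 2 ^ ?N * of_nat (Q + 1)" by (simp add: distrib_left)
  then have "?J \<le> of_nat (Q + 1)"
    by (subst (asm) ennreal_mult_le_mult_iff) (auto simp: power_eq_top_ennreal)
  ultimately show ?thesis by simp
qed

end

section \<open>Running time\<close>

lemma after_add: "after (j + k) c = after k (after j c)"
  by (simp add: after_def funpow_add add.commute[of j k])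

lemma halted_after_le:
  assumes "after k c = ([], t)" "k \<le> j"
  shows "after j c = ([], t)"
  using assms after_add[of k "j - k" c] by (simp add: after_Nil)

lemma halted_unique:
  assumes "after k c = ([], t)" "halted (after j c)"
  shows "after j c = ([], t)"
proof (cases "k \<le> j")
  case True
  then show ?thesis using halted_after_le[OF assms(1)] by simp
next
  case False
  obtain u where u: "after j c = ([], u)"
    using assms(2) by (cases "after j c") (auto simp: halted_def)
  then have "after k c = ([], u)" using halted_after_le[OF u] False by simp
  with u assms(1) show ?thesis by simp
qed

lemma run_time_le: "halted (after k c) \<Longrightarrow> run_time c \<le> enat k"
  unfolding run_time_def by (rule INF_lower) simp

context graph_input
begin

text \<open>The absence of isolated vertices turns all bounds in n into bounds in m.\<close>

lemma n_le: "n \<le> 2 * m"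
proof -
  have "{..<n} \<subseteq> (\<Union>i<m. ends_of (es ! i))"
  proof
    fix v assume "v \<in> {..<n}"
    then obtain e where "e \<in> E" "v \<in> e"
      using represents unfolding represents_def no_isolated_def by blast
    with edge_ends show "v \<in> (\<Union>i<m. ends_of (es ! i))" by blast
  qed
  then have "card {..<n} \<le> card (\<Union>i<m. ends_of (es ! i))"
    by (rule card_mono[rotated]) (simp add: ends_of_def)
  also have "\<dots> \<le> (\<Sum>i<m. card (ends_of (es ! i)))" by (rule card_UN_le) simp
  also have "\<dots> \<le> (\<Sum>i<m. 2)" by (intro sum_mono) (simp add: ends_of_def card_insert_if)
  finally show ?thesis by simp
qed

lemma input_ok: "ok W (input [n, m] es \<omega>)"
proof -
  have "n < W" "m < W" "0 < W" using W_ge_quartic(3) by linarith+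
  moreover have "fst (es ! i) < W" "snd (es ! i) < W" if "i < m" for i
    using ends_less[OF that] \<open>n < W\<close> by linarith+
  ultimately show ?thesis
    by (auto simp: ok_def input_def nth_Cons split: nat.split)
qed

lemma full_rounds_measurable:
  "(\<lambda>\<omega>. of_nat (full_rounds (coin_level \<omega>)) :: ennreal) \<in> borel_measurable coin_tape"
proof -
  have "full_rounds (coin_level \<omega>) = full_rounds (list_level (stake (n * B) \<omega>))" for \<omega>
    by (rule full_rounds_cong[OF coin_level_list])
  then show ?thesis
    by (simp only:) (rule measurable_compose[OF stake_measurable], simp)
qed

end

text \<open>The expected \<open>detection_time\<close> with n and \<open>B\<close> bounded in terms
  of m: 109 = 2 * 21 + 67 and 30 = 29 + 1 come from \<open>round_time\<close>, and twice the number
  of stages plus one from \<open>Q\<close> calls that end a stage and an expected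
  \<open>Q + 1\<close> full ones.\<close>

definition time_bound :: "nat \<Rightarrow> nat \<Rightarrow> nat \<Rightarrow> nat" where
  "time_bound R K m = (let b = floorlog 2 (2 * m) in
     3 * b + 2 * m * (5 * b + 7) + 15 * m + 14 +
     (2 * (2 * b * (2 * b) * (b + 1)) + 1) * (109 * m + R + 4 * K + 30))"

lemma floorlog_mono: "n \<le> n' \<Longrightarrow> floorlog 2 n \<le> floorlog 2 n'"
  by (auto simp: floorlog_def intro!: floor_mono nat_mono)

context listing_round
begin

lemma expected_detection_time:
  "(\<integral>\<^sup>+ \<omega>. of_nat (detection_time (coin_level \<omega>)) \<partial>coin_tape) \<le> of_nat (time_bound R K m)"
proof -
  interpret prob_space coin_tape
    unfolding coin_tape_def by (rule prob_space.prob_space_stream_space) (rule measure_pmf.prob_space_axioms)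
  let ?A = "3 * B + n * (5 * B + 7) + 15 * m + 14 + Q * (round_time + 1)"
  have "(\<integral>\<^sup>+ \<omega>. of_nat (detection_time (coin_level \<omega>)) \<partial>coin_tape) =
    (\<integral>\<^sup>+ \<omega>. of_nat ?A + of_nat (round_time + 1) * of_nat (full_rounds (coin_level \<omega>)) \<partial>coin_tape)"
    by (intro nn_integral_cong) (simp add: detection_time_def algebra_simps)
  also have "\<dots> = of_nat ?A + of_nat (round_time + 1) *
      (\<integral>\<^sup>+ \<omega>. of_nat (full_rounds (coin_level \<omega>)) \<partial>coin_tape)"
    using full_rounds_measurable
    by (subst nn_integral_add) (auto simp: nn_integral_cmult emeasure_space_1)
  also have "\<dots> \<le> of_nat ?A + of_nat (round_time + 1) * of_nat (Q + 1)"
    by (intro add_left_mono mult_left_mono expected_full_rounds) simp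
  also have "\<dots> = of_nat (?A + (round_time + 1) * (Q + 1))"
    by (simp only: of_nat_add of_nat_mult)
  also have "?A + (round_time + 1) * (Q + 1) = 3 * B + n * (5 * B + 7) + 15 * m + 14 + (2 * Q + 1) * (round_time + 1)"
    by (simp add: algebra_simps)
  also have "of_nat \<dots> \<le> (of_nat (time_bound R K m) :: ennreal)"
  proof -
    let ?b = "floorlog 2 (2 * m)"
    have b: "B \<le> ?b" unfolding B_def using n_le by (rule floorlog_mono)
    have "n * (5 * B + 7) \<le> 2 * m * (5 * ?b + 7)"
      using b n_le by (intro mult_mono) simp_all
    moreover have "Q \<le> 2 * ?b * (2 * ?b) * (?b + 1)"
      unfolding Q_def using b by (intro mult_mono) simp_all
    then have "(2 * Q + 1) * (round_time + 1) \<le>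
        (2 * (2 * ?b * (2 * ?b) * (?b + 1)) + 1) * (109 * m + R + 4 * K + 30)"
      using n_le by (intro mult_mono) (simp_all add: round_time_def)
    ultimately have "3 * B + n * (5 * B + 7) + 15 * m + 14 + (2 * Q + 1) * (round_time + 1) \<le>
      3 * ?b + 2 * m * (5 * ?b + 7) + 15 * m + 14 +
      (2 * (2 * ?b * (2 * ?b) * (?b + 1)) + 1) * (109 * m + R + 4 * K + 30)"
      using b by linarith
    then show ?thesis
      unfolding time_bound_def Let_def by (simp only: of_nat_le_iff)
  qed
  finally show ?thesis .
qed

lemma detection_correct:
  "words_below W (detection_prog R p, input [n, m] es \<omega>)"
  "halted (after k (detection_prog R p, input [n, m] es \<omega>)) \<Longrightarrow>
    outp (snd (after k (detection_prog R p, input [n, m] es \<omega>))) = detection_output es E"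
  "run_time (detection_prog R p, input [n, m] es \<omega>) \<le> enat (detection_time (coin_level \<omega>))"
proof -
  let ?c = "(detection_prog R p, input [n, m] es \<omega>)"
  obtain k0 t where k0: "k0 \<le> detection_time (coin_level \<omega>)" "after k0 ?c = ([], t)"
    "outp t = detection_output es E" "words_below W ?c"
    using wp_sound[OF detection_wp input_ok] by blast
  show "words_below W ?c" by (rule k0)
  show "outp (snd (after k ?c)) = detection_output es E" if "halted (after k ?c)"
    using halted_unique[OF k0(2) that] k0(3) by simp
  have "run_time ?c \<le> enat k0" by (rule run_time_le) (simp add: k0(2) halted_def)
  also have "\<dots> \<le> enat (detection_time (coin_level \<omega>))" using k0(1) by simp
  finally show "run_time ?c \<le> enat (detection_time (coin_level \<omega>))" .
qed

end

text \<open>Here 64 * 3 ^ 4 = 5184 is at most 2 ^ 13, hence at most \<open>(m + 2) ^ 13\<close>;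
  with the fourth power this makes 17. The \<open>d\<close> leaves room for the lister's own
  words.\<close>

lemma W_large_enough: "n \<le> 2 * m \<Longrightarrow> 64 * (n + m + 4) ^ 4 \<le> (m + 2 :: nat) ^ (17 + d)"
proof -
  assume "n \<le> 2 * m"
  then have "64 * (n + m + 4) ^ 4 \<le> 64 * (3 * (m + 2)) ^ 4"
    by (intro mult_left_mono power_mono) simp_all
  also have "\<dots> = 5184 * (m + 2) ^ 4" by (simp only: power_mult_distrib) simp
  also have "\<dots> \<le> 2 ^ 13 * (m + 2) ^ 4" by (intro mult_right_mono) simp_all
  also have "\<dots> \<le> (m + 2) ^ 13 * (m + 2) ^ 4" by (intro mult_right_mono power_mono) simp_all
  also have "\<dots> = (m + 2) ^ 17" by (simp only: power_add[symmetric]) simp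
  also have "\<dots> \<le> (m + 2) ^ (17 + d)" by (intro power_increasing) simp_all
  finally show ?thesis .
qed

lemma represents_n_le:
  assumes "represents n es E"
  shows "n \<le> 2 * length es"
proof -
  interpret graph_input n es E "64 * (n + length es + 4) ^ 4"
    by standard (use assms in simp_all)
  show ?thesis by (rule n_le)
qed

lemma listing_solves_detection:
  assumes p: "\<forall>i\<in>set p. embeddable R i"
    and lister: "\<And>n es E. represents n es E \<Longrightarrow>
      (let m = card E; c = (p, input [n, m, m] es undefined) in
         words_below ((m + 2) ^ d) c \<and>
         (\<exists>k. real k \<le> T m \<and> halted (after k c) \<and> listing_correct E m (outp (snd (after k c)))))"
  shows "las_vegas_edge_detection_solvable (\<lambda>m. real (time_bound R (nat \<lfloor>T m\<rfloor>) m))"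
  unfolding las_vegas_edge_detection_solvable_def
proof (rule exI[of _ "detection_prog R p"], rule exI[of _ "17 + d"], intro allI impI)
  fix n es E assume rep: "represents n es E"
  let ?m = "length es"
  have m: "card E = ?m" using rep by (metis distinct_card length_map represents_def)
  interpret listing_round n es E "(?m + 2) ^ (17 + d)" p R "nat \<lfloor>T ?m\<rfloor>"
  proof
    show "64 * (n + ?m + 4) ^ 4 \<le> (?m + 2) ^ (17 + d)"
      using W_large_enough represents_n_le[OF rep] by blast
    fix N es' E' assume *: "represents N es' E'" "card E' = ?m"
    let ?c = "(p, input [N, ?m, ?m] es' undefined)"
    obtain k where k: "words_below ((?m + 2) ^ d) ?c" "real k \<le> T ?m" "halted (after k ?c)"
      "listing_correct E' ?m (outp (snd (after k ?c)))"
      using lister[OF *(1)] unfolding *(2) Let_def by blast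
    obtain t where t: "after k ?c = ([], t)"
      using k(3) by (cases "after k ?c") (auto simp: halted_def)
    have "k \<le> nat \<lfloor>T ?m\<rfloor>" using k(2) by (simp add: le_nat_floor)
    moreover have "words_below ((?m + 2) ^ (17 + d)) ?c"
      using k(1) by (rule words_below_mono) (intro power_increasing; simp)
    ultimately show "\<exists>k\<le>nat \<lfloor>T ?m\<rfloor>. \<exists>t. after k ?c = ([], t) \<and> listing_correct E' ?m (outp t) \<and>
        words_below ((?m + 2) ^ (17 + d)) ?c"
      using k(4) t by auto
  qed (use rep p in auto)
  let ?c = "\<lambda>\<omega>. (detection_prog R p, input [n, ?m] es \<omega>)"
  \<comment> \<open>Monotonicity of the integral is purely pointwise, so measurability is only an
    issue for the bound, not for \<open>run_time\<close>.\<close>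
  have "(\<integral>\<^sup>+ \<omega>. ennreal_of_enat (run_time (?c \<omega>)) \<partial>coin_tape) \<le>
      (\<integral>\<^sup>+ \<omega>. of_nat (detection_time (coin_level \<omega>)) \<partial>coin_tape)"
  proof (rule nn_integral_mono)
    fix \<omega>
    have "ennreal_of_enat (run_time (?c \<omega>)) \<le> ennreal_of_enat (enat (detection_time (coin_level \<omega>)))"
      using detection_correct(3) by (simp only: ennreal_of_enat_le_iff)
    then show "ennreal_of_enat (run_time (?c \<omega>)) \<le> of_nat (detection_time (coin_level \<omega>))" by simp
  qed
  also have "\<dots> \<le> of_nat (time_bound R (nat \<lfloor>T ?m\<rfloor>) ?m)" by (rule expected_detection_time)
  also have "\<dots> = ennreal (real (time_bound R (nat \<lfloor>T ?m\<rfloor>) ?m))" by (simp add: ennreal_of_nat_eq_real_of_nat)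
  finally show "let m = card E; c = (\<lambda>\<omega>. (detection_prog R p, input [n, m] es \<omega>)) in
     (\<forall>\<omega>. words_below ((m + 2) ^ (17 + d)) (c \<omega>)) \<and>
     (\<forall>\<omega> k. halted (after k (c \<omega>)) \<longrightarrow> outp (snd (after k (c \<omega>))) = detection_output es E) \<and>
     (\<integral>\<^sup>+ \<omega>. ennreal_of_enat (run_time (c \<omega>)) \<partial>coin_tape) \<le> ennreal (real (time_bound R (nat \<lfloor>T m\<rfloor>) m))"
    unfolding m Let_def using detection_correct(1,2) by blast
qed

section \<open>Listing takes linear time\<close>

text \<open>The book: triangles \<open>{0, 1, v}\<close> with the common edge \<open>{0, 1}\<close>.\<close>

definition book :: "nat \<Rightarrow> (nat \<times> nat) list" where
  "book m = (0, 1) # map (\<lambda>i. (i mod 2, 2 + i div 2)) [0..<m]"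

text \<open>\<open>book m\<close> has \<open>m + 1\<close> edges. For odd \<open>m\<close> the last
  outer vertex has just one edge, so their number is rounded up.\<close>

lemma book_represents: "represents (2 + Suc m div 2) (book m) (set (map ends_of (book m)))"
  unfolding represents_def
proof (intro conjI refl)
  have ends: "ends_of (i mod 2, 2 + i div 2) = {i mod 2, 2 + i div 2}" for i :: nat
    by (simp add: ends_of_def)
  have ne: "i mod 2 \<noteq> 2 + j div 2" for i j :: nat
  proof -
    have "i mod 2 < 2" by simp
    then show ?thesis by linarith
  qed
  have lt: "2 + i div 2 < 2 + Suc m div 2" if "i < m" for i using that by linarith
  show "simple_graph {..<2 + Suc m div 2} (set (map ends_of (book m)))"
    unfolding simple_graph_def
  proof (intro conjI ballI)
    fix e assume "e \<in> set (map ends_of (book m))"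
    then consider "e = {0, 1}" | i where "i < m" "e = {i mod 2, 2 + i div 2}"
      by (auto simp: book_def ends_of_def)
    then show "e \<subseteq> {..<2 + Suc m div 2}" "card e = 2"
      using ne lt by (cases; simp add: less_Suc_eq; fastforce)+
  qed simp
  show "no_isolated {..<2 + Suc m div 2} (set (map ends_of (book m)))"
    unfolding no_isolated_def
  proof
    fix v assume v: "v \<in> {..<2 + Suc m div 2}"
    show "\<exists>e\<in>set (map ends_of (book m)). v \<in> e"
    proof (cases "v < 2")
      case True
      then have "v \<in> ends_of (0, 1)" by (auto simp: ends_of_def)
      then show ?thesis by (auto simp: book_def)
    next
      case False
      let ?i = "2 * (v - 2)"
      have "?i < m" using False v by simp
      moreover have "v \<in> ends_of (?i mod 2, 2 + ?i div 2)" using False by (simp add: ends_of_def)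
      ultimately show ?thesis by (auto simp: book_def intro!: bexI[of _ ?i])
    qed
  qed
  have "i = j" if "ends_of (i mod 2, 2 + i div 2) = ends_of (j mod 2, 2 + j div 2)" for i j :: nat
  proof -
    have "i mod 2 = j mod 2" "i div 2 = j div 2"
      using that ne unfolding ends by (metis add_left_cancel doubleton_eq_iff)+
    then show ?thesis by (metis div_mult_mod_eq)
  qed
  then have "inj_on (\<lambda>i. ends_of (i mod 2, 2 + i div 2)) {0..<m}" by (intro inj_onI)
  moreover have "ends_of (0, 1) \<noteq> ends_of (i mod 2, 2 + i div 2)" for i :: nat
    by (auto simp: ends_of_def doubleton_eq_iff)
  ultimately show "distinct (map ends_of (book m))"
    by (auto simp: book_def distinct_map comp_def)
qed

lemma finite_triangles: "simple_graph V E \<Longrightarrow> finite (triangles E)"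
  by (rule finite_subset[OF triangles_subset_Pow]) (auto simp: simple_graph_def intro: finite_subset[of _ V])

lemma book_triangles: "m div 2 \<le> card (triangles (set (map ends_of (book m))))"
proof -
  let ?E = "set (map ends_of (book m))"
  have "{0, 1, 2 + j} \<in> triangles ?E" if "j < m div 2" for j
  proof (rule trianglesI)
    have E: "ends_of (i mod 2, 2 + i div 2) \<in> ?E" if "i < m" for i
      using that by (auto simp: book_def)
    show "{0, 1} \<in> ?E" by (auto simp: book_def ends_of_def)
    have "2 * j < m" "2 * j + 1 < m" using that by linarith+
    from E[OF this(1)] E[OF this(2)] show "{0, 2 + j} \<in> ?E" "{1, 2 + j} \<in> ?E"
      by (simp_all add: ends_of_def)
  qed simp_all
  then have "(\<lambda>j. {0, 1, 2 + j}) ` {..<m div 2} \<subseteq> triangles ?E" by auto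
  moreover have "inj_on (\<lambda>j. {0, 1, 2 + j}) {..<m div 2}"
    by (auto simp: inj_on_def insert_eq_iff)
  moreover have "finite (triangles ?E)"
    using finite_triangles book_represents unfolding represents_def by blast
  ultimately show ?thesis
    by (metis card_image card_lessThan card_mono)
qed

text \<open>Whether the lister stops at m triangles or lists all, it outputs at least
  \<open>(m - 1) div 2\<close> triples of three words each. From m = 6 on, three times that number
  is at least m.\<close>

lemma listing_time_ge:
  assumes lister: "\<And>n es E. represents n es E \<Longrightarrow>
      (let m = card E; c = (p, input [n, m, m] es undefined) in
         words_below ((m + 2) ^ d) c \<and>
         (\<exists>k. real k \<le> T m \<and> halted (after k c) \<and> listing_correct E m (outp (snd (after k c)))))"
    and "6 \<le> m"
  shows "real m \<le> T m"
proof -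
  let ?es = "book (m - 1)" and ?E = "set (map ends_of (book (m - 1)))"
  note rep = book_represents[of "m - 1"]
  have "length ?es = m" using assms(2) by (simp add: book_def)
  then have card: "card ?E = m"
    using rep by (metis distinct_card length_map represents_def)
  let ?c = "(p, input [2 + Suc (m - 1) div 2, m, m] ?es undefined)"
  obtain k where k: "real k \<le> T m" "listing_correct ?E m (outp (snd (after k ?c)))"
    using lister[OF rep] unfolding card Let_def by blast
  obtain ts where ts: "outp (snd (after k ?c)) = concat (map (\<lambda>(a, b, c). [a, b, c]) ts)"
    "distinct (map tri_of ts)" "length ts = m \<or> set (map tri_of ts) = triangles ?E"
    using k(2) unfolding listing_correct_def by blast
  have "(m - 1) div 2 \<le> length ts"
    using ts(3) book_triangles[of "m - 1"] distinct_card[OF ts(2)] by auto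
  moreover have "3 * length ts \<le> k"
    using outp_after_le[of k p "snd ?c"] unfolding ts(1)
    by (simp only: snd_conv ts(1) length_concat_triples) (simp add: input_def)
  ultimately have "m \<le> k" using assms(2) by linarith
  with k(1) show ?thesis by linarith
qed

section \<open>The reduction\<close>

text \<open>With h the cube of the bit length plus one, the overhead sums to 3 + 14 + 15 + 14 = 46
  multiples of h K, and the rounds to 9 * (143 + R), where 143 = 109 + 4 + 30. Since 46 + 9 * 143 =
  1333, the constant 1400 is enough.\<close>

lemma time_bound_le:
  assumes "m \<le> K" "1 \<le> K"
  shows "time_bound R K m \<le> (1400 + 9 * R) * ((floorlog 2 (2 * m) + 1) ^ 3 * K)"
proof -
  define b where "b = floorlog 2 (2 * m)"
  let ?h = "(b + 1) ^ 3"
  have h: "1 \<le> ?h" "b + 1 \<le> ?h" by simp_all (simp add: self_le_power)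
  have h': "b * b * (b + 1) \<le> ?h" unfolding power3_eq_cube by (intro mult_mono) simp_all
  have "3 * b \<le> 3 * (?h * K)"
    using mult_mono[of b ?h 1 K] h assms by simp
  moreover have "2 * m * (5 * b + 7) \<le> 14 * (?h * K)"
    using mult_mono[of "2 * m" "2 * K" "5 * b + 7" "7 * ?h"] h assms by (simp add: mult_ac)
  moreover have "15 * m \<le> 15 * (?h * K)" "14 \<le> 14 * (?h * K)"
    using mult_mono[of 1 ?h m K] mult_mono[of 1 ?h 1 K] h assms by simp_all
  moreover have "(2 * (2 * b * (2 * b) * (b + 1)) + 1) * (109 * m + R + 4 * K + 30) \<le>
      (9 * ?h) * ((143 + R) * K)"
  proof (rule mult_mono)
    show "2 * (2 * b * (2 * b) * (b + 1)) + 1 \<le> 9 * ?h"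
    proof -
      have "2 * (2 * b * (2 * b) * (b + 1)) = 8 * (b * b * (b + 1))" by (simp add: algebra_simps)
      also have "\<dots> \<le> 8 * ?h" using h' by (rule mult_le_mono2)
      finally show ?thesis using h(1) by linarith
    qed
    show "109 * m + R + 4 * K + 30 \<le> (143 + R) * K"
    proof -
      have "R \<le> R * K" using assms(2) by simp
      then have "109 * m + R + 4 * K + 30 \<le> 143 * K + R * K" using assms by linarith
      then show ?thesis by (simp add: distrib_right)
    qed
  qed simp_all
  ultimately have "time_bound R K m \<le> 46 * (?h * K) + (9 * ?h) * ((143 + R) * K)"
    unfolding time_bound_def Let_def b_def[symmetric] by linarith
  also have "\<dots> \<le> (1400 + 9 * R) * (?h * K)"
    by (simp add: algebra_simps)
  finally show ?thesis unfolding b_def .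
qed

text \<open>The left side is at most 3 plus the binary logarithm of m, and 3 is at most three times
  that logarithm once m is at least 2.\<close>

lemma floorlog_le_ln:
  assumes "2 \<le> m"
  shows "real (floorlog 2 (2 * m) + 1) \<le> 4 / ln 2 * ln (real m)"
proof -
  have "2 ^ (floorlog 2 (2 * m) - 1) \<le> 2 * m"
    using floorlog_bounds[of "2 * m" 2] assms by simp
  then have "2 ^ (floorlog 2 (2 * m) - 1) \<le> real (2 * m)"
    by (metis of_nat_le_iff of_nat_numeral of_nat_power)
  then have "real (floorlog 2 (2 * m) - 1) \<le> log 2 (real (2 * m))"
    using assms by (subst le_log_iff) (simp_all add: powr_realpow)
  also have "\<dots> = 1 + log 2 (real m)" using assms by (simp add: log_mult)
  finally have "real (floorlog 2 (2 * m) + 1) \<le> 3 + log 2 (real m)" by linarith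
  moreover have "1 \<le> log 2 (real m)" using assms by (simp add: le_log_iff)
  ultimately have "real (floorlog 2 (2 * m) + 1) \<le> 4 * log 2 (real m)" by linarith
  then show ?thesis by (simp add: log_def)
qed

theorem theorem5:
  fixes T :: "nat \<Rightarrow> real"
  assumes "triangle_listing_solvable (\<lambda>m. m) T"
  shows "\<exists>f\<in>soft_O T. las_vegas_edge_detection_solvable f"
proof -
  obtain p d where p: "deterministic p" and
    "\<And>n es E \<omega>. represents n es E \<Longrightarrow>
      (let m = card E; c = (p, input [n, m, m] es \<omega>) in
         words_below ((m + 2) ^ d) c \<and>
         (\<exists>k. real k \<le> T m \<and> halted (after k c) \<and> listing_correct E m (outp (snd (after k c)))))"
    using assms unfolding triangle_listing_solvable_def by blast
  note lister = this(2)[of _ _ _ undefined]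
  obtain R where R: "\<forall>i\<in>set p. embeddable R i"
    using deterministic_embeddable[OF p] by blast
  let ?f = "\<lambda>m. real (time_bound R (nat \<lfloor>T m\<rfloor>) m)"
  have "?f \<in> O(\<lambda>m. T m * ln (real m) ^ 3)"
  proof (rule bigoI)
    show "\<forall>\<^sub>F m in at_top. norm (?f m) \<le> (real (1400 + 9 * R) * (4 / ln 2) ^ 3) * norm (T m * ln (real m) ^ 3)"
      using eventually_ge_at_top[of 6]
    proof eventually_elim
      case (elim m)
      let ?K = "nat \<lfloor>T m\<rfloor>" and ?h = "floorlog 2 (2 * m) + 1"
      have T: "real m \<le> T m" using listing_time_ge[OF lister elim] .
      then have K: "m \<le> ?K" "1 \<le> ?K" "real ?K \<le> T m" "0 \<le> T m"
        using elim by (simp_all add: le_nat_floor le_nat_iff le_floor_iff)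
      have "?f m \<le> real ((1400 + 9 * R) * (?h ^ 3 * ?K))"
        using time_bound_le[OF K(1,2)] by (simp only: of_nat_le_iff)
      also have "\<dots> = real (1400 + 9 * R) * (real ?h ^ 3 * real ?K)" by simp
      also have "\<dots> \<le> real (1400 + 9 * R) * ((4 / ln 2 * ln (real m)) ^ 3 * T m)"
        using floorlog_le_ln[of m] elim K
        by (intro mult_left_mono mult_mono power_mono) (simp_all add: zero_le_power)
      also have "\<dots> = (real (1400 + 9 * R) * (4 / ln 2) ^ 3) * (T m * ln (real m) ^ 3)"
        by (simp add: power_mult_distrib power_divide)
      also have "\<dots> = (real (1400 + 9 * R) * (4 / ln 2) ^ 3) * norm (T m * ln (real m) ^ 3)"
        using K(4) elim by simp
      finally show ?case by simp
    qed
  qed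
  then have "?f \<in> soft_O T" unfolding soft_O_def by blast
  moreover have "las_vegas_edge_detection_solvable ?f"
    using listing_solves_detection[OF R lister] .
  ultimately show ?thesis by blast
qed

end
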